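(* Let $0<n\le m$ be integers (not necessarily coprime), $d=\gcd(n,m)$, let $p,q$ be positive integers with $mp-nq=d$, and let $f(x,y)=y^n-x^m$. Let $\mathcal{F}_W\in Fol(f)$ be a foliation defined by a 1-form $$W=\mathrm{d}f+\bigl(\Delta(x,y)+f(x,y)g(x,y)\bigr)(nx\,\mathrm{d}y-my\,\mathrm{d}x),$$ where $g\in\mathbb{C}\{x,y\}$ and $\Delta(x,y)=\sum_{0\le i\le m-2,\;0\le j\le n-2}a_{i,j}x^iy^j$ with $a_{i,j}\in\mathbb{C}$. Then $\mathcal{F}_W$ is a generalized curve foliation if and only if $\upsilon_{n,m}(\Delta)\ge mn-n-m$ and, for every $\xi\in\mathbb{C}$ with $\xi^d=1$, $$1+\sum_{n(r+1)+m(s+1)=mn}a_{r,s}\,\xi^{\,p(r+1)+q(s+1)-qn}\notin\mathbb{Q}^{-}\cup\{0\},$$ where the sum runs over the pairs $(r,s)$ with $0\le r\le m-2$, $0\le s\le n-2$ and $n(r+1)+m(s+1)=mn$.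
   Context: The weighted order is $\upsilon_{n,m}\bigl(\sum_{i,j}a_{i,j}x^iy^j\bigr)=\min\{in+jm: a_{i,j}\neq0\}$ (equal to $+\infty$ for the zero series). $\mathbb{Q}^{+}$ and $\mathbb{Q}^{-}$ denote the positive and the negative rationals. A singular holomorphic foliation at the origin $\mathcal{F}_W:\{W=0\}$ is given by a 1-form $W=R\,\mathrm{d}x+S\,\mathrm{d}y$ with $R,S\in\mathbb{C}\{x,y\}$ without common factors and $R(0,0)=S(0,0)=0$. A separatrix of $\mathcal{F}_W$ is a branch $\{g=0\}$ ($g\in\mathbb{C}\{x,y\}$ irreducible non-unit) such that $g$ divides $W\wedge \mathrm{d}g$ (i.e. divides its coefficient with respect to $\mathrm{d}x\wedge \mathrm{d}y$). $\mathcal{F}_W$ is nondicritical if it has finitely many separatrices; if these are $\{f_i=0\}$, $1\le i\le r$ (distinct), its union of separatrices is the reduced curve $\{f_1\cdots f_r=0\}$. For $f$ reduced, $[Fol(f)]$ is the set of 1-forms $W$ defining a nondicritical foliation $\mathcal{F}_W$ such that $f$ divides $W\wedge \mathrm{d}f$, and $Fol(f)$ is the set of foliations defined by elements of $[Fol(f)]$ whose union of separatrices is $\{f=0\}$. Let $\lambda_1,\lambda_2$ be the eigenvalues of $\begin{pmatrix}-S_x(0,0)&-S_y(0,0)\\ R_x(0,0)&R_y(0,0)\end{pmatrix}$. The singularity at the origin is irreducible if either $\lambda_1\lambda_2\ne0$ and $\lambda_1/\lambda_2\notin\mathbb{Q}^{+}$ (simple), or exactly one of $\lambda_1,\lambda_2$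 is zero (saddle-node). The reduction of singularities (Seidenberg) of $\mathcal{F}_W$ is the finite composition of point blow-ups after which all singularities of the strict transform are irreducible. $\mathcal{F}_W$ is a generalized curve foliation if no saddle-nodes appear in its reduction of singularities. *)

theory Defs
  imports "HOL-Analysis.Analysis" "HOL-Computational_Algebra.Computational_Algebra"
begin

text \<open>
  A formal series \<open>\<Sum>i j. a\<^sub>i\<^sub>j x\<^sup>i y\<^sup>j\<close> is an element of \<open>complex fps fps\<close>, the outer variable
  being \<open>x\<close> and the inner one \<open>y\<close>.
\<close>

definition convergent2 :: "complex fps fps \<Rightarrow> bool" where
  "convergent2 F \<longleftrightarrow>
     (\<exists>r>0. (\<lambda>(i, j). norm (fps_nth (fps_nth F i) j) * r ^ (i + j)) summable_on UNIV)"

lemma convergent2_iff_bounded: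
  "convergent2 F \<longleftrightarrow> (\<exists>r>0. \<exists>C. \<forall>i j. norm (fps_nth (fps_nth F i) j) * r ^ (i + j) \<le> C)"
proof
  assume "convergent2 F"
  then obtain r where r: "r > 0"
    and s: "(\<lambda>(i, j). norm (fps_nth (fps_nth F i) j) * r ^ (i + j)) summable_on UNIV"
    unfolding convergent2_def by blast
  let ?f = "\<lambda>(i, j). norm (fps_nth (fps_nth F i) j) * r ^ (i + j)"
  have nn: "0 \<le> ?f z" for z using r by (cases z) auto
  have "?f (i, j) \<le> infsum ?f UNIV" for i j
  proof -
    have "infsum ?f {(i, j)} \<le> infsum ?f UNIV"
      by (rule infsum_mono2) (use s nn in auto)
    then show ?thesis by simp
  qed
  then show "\<exists>r>0. \<exists>C. \<forall>i j. norm (fps_nth (fps_nth F i) j) * r ^ (i + j) \<le> C"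
    using r by (intro exI[of _ r] conjI exI[of _ "infsum ?f UNIV"]) auto
next
  assume "\<exists>r>0. \<exists>C. \<forall>i j. norm (fps_nth (fps_nth F i) j) * r ^ (i + j) \<le> C"
  then obtain r C where r: "r > 0"
    and b: "\<And>i j. norm (fps_nth (fps_nth F i) j) * r ^ (i + j) \<le> C" by blast
  have g: "(\<lambda>i. (1 / 2 :: real) ^ i) summable_on UNIV"
    by (rule norm_summable_imp_summable_on) (simp add: summable_geometric)
  have "(\<lambda>(i, j). (1 / 2 :: real) ^ i * (1 / 2) ^ j) summable_on UNIV \<times> UNIV"
    by (rule summable_on_SigmaI[where g = "\<lambda>i. (1 / 2) ^ i * infsum (\<lambda>j. (1 / 2) ^ j) UNIV"])
      (use g in \<open>auto intro!: has_sum_cmult_right summable_on_cmult_left has_sum_infsum\<close>)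
  then have "(\<lambda>z. C * (case z of (i, j) \<Rightarrow> (1 / 2 :: real) ^ i * (1 / 2) ^ j)) summable_on UNIV"
    by (intro summable_on_cmult_right) simp
  then have "(\<lambda>(i, j). norm (fps_nth (fps_nth F i) j) * (r / 2) ^ (i + j)) summable_on UNIV"
  proof (rule summable_on_comparison_test)
    fix z :: "nat \<times> nat"
    obtain i j where z: "z = (i, j)" by force
    have "norm (fps_nth (fps_nth F i) j) * (r / 2) ^ (i + j)
        = (norm (fps_nth (fps_nth F i) j) * r ^ (i + j)) * ((1 / 2) ^ i * (1 / 2) ^ j)"
      by (simp add: power_add field_simps)
    also have "\<dots> \<le> C * ((1 / 2) ^ i * (1 / 2) ^ j)"
      by (intro mult_right_mono b) auto
    finally show "(case z of (i, j) \<Rightarrow> norm (fps_nth (fps_nth F i) j) * (r / 2) ^ (i + j))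
        \<le> C * (case z of (i, j) \<Rightarrow> (1 / 2) ^ i * (1 / 2) ^ j)"
      by (simp add: z)
  qed (use r in \<open>auto\<close>)
  then show "convergent2 F"
    unfolding convergent2_def using r by (intro exI[of _ "r / 2"]) auto
qed

lemma convergent2E:
  assumes "convergent2 F"
  obtains r C where "0 < r" "r \<le> 1" "1 \<le> C" "\<And>i j. norm (fps_nth (fps_nth F i) j) \<le> C / r ^ (i + j)"
proof -
  from assms obtain r C where r: "r > 0"
    and b: "\<And>i j. norm (fps_nth (fps_nth F i) j) * r ^ (i + j) \<le> C"
    unfolding convergent2_iff_bounded by blast
  define s D where "s = min r 1" and "D = max C 1"
  have "norm (fps_nth (fps_nth F i) j) \<le> D / s ^ (i + j)" for i j
  proof -
    have "norm (fps_nth (fps_nth F i) j) * s ^ (i + j)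
        \<le> norm (fps_nth (fps_nth F i) j) * r ^ (i + j)"
      using r by (intro mult_left_mono power_mono) (auto simp: s_def)
    also have "\<dots> \<le> D" using b[of i j] by (simp add: D_def)
    finally show ?thesis using r by (simp add: field_simps s_def)
  qed
  then show thesis using r by (intro that[of s D]) (auto simp: s_def D_def)
qed

lemma convergent2I:
  assumes "0 < r" "\<And>i j. norm (fps_nth (fps_nth F i) j) \<le> C / r ^ (i + j)"
  shows "convergent2 F"
  unfolding convergent2_iff_bounded
  using assms by (intro exI[of _ r] conjI exI[of _ C]) (auto simp: field_simps)

lemma convergent2_polynomial:
  assumes "\<And>i j. N < i + j \<Longrightarrow> fps_nth (fps_nth F i) j = 0"
  shows "convergent2 F"
proof (rule convergent2I[where r = 1])
  fix i j
  let ?S = "{..N} \<times> {..N}"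
  let ?h = "\<lambda>z. norm (fps_nth (fps_nth F (fst z)) (snd z))"
  have nn: "0 \<le> sum ?h ?S" by (intro sum_nonneg) auto
  have "norm (fps_nth (fps_nth F i) j) \<le> sum ?h ?S"
  proof (cases "i + j \<le> N")
    case True
    then have "?h (i, j) \<le> sum ?h ?S" by (intro member_le_sum) auto
    then show ?thesis by simp
  qed (use assms nn in auto)
  then show "norm (fps_nth (fps_nth F i) j) \<le> sum ?h ?S / 1 ^ (i + j)" by simp
qed simp

lemma convergent2_add:
  assumes "convergent2 F" "convergent2 G"
  shows "convergent2 (F + G)"
proof -
  from assms(1) obtain r C where F: "0 < r" "r \<le> 1" "1 \<le> C"
    "\<And>i j. norm (fps_nth (fps_nth F i) j) \<le> C / r ^ (i + j)" by (rule convergent2E) blast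
  from assms(2) obtain s D where G: "0 < s" "s \<le> 1" "1 \<le> D"
    "\<And>i j. norm (fps_nth (fps_nth G i) j) \<le> D / s ^ (i + j)" by (rule convergent2E) blast
  show ?thesis
  proof (rule convergent2I[where r = "min r s" and C = "C + D"])
    fix i j
    have "norm (fps_nth (fps_nth (F + G) i) j) \<le> C / r ^ (i + j) + D / s ^ (i + j)"
      using F(4)[of i j] G(4)[of i j] by (auto intro: norm_triangle_le)
    also have "\<dots> \<le> C / min r s ^ (i + j) + D / min r s ^ (i + j)"
      using F(1,3) G(1,3) by (intro add_mono divide_left_mono power_mono mult_pos_pos) auto
    finally show "norm (fps_nth (fps_nth (F + G) i) j) \<le> (C + D) / min r s ^ (i + j)"
      by (simp add: add_divide_distrib)
  qed (use F G in auto)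
qed

lemma convergent2_uminus:
  assumes "convergent2 F" shows "convergent2 (- F)"
  using assms unfolding convergent2_def by simp

lemma fps2_mult_nth:
  "fps_nth (fps_nth (F * G) i) j =
     (\<Sum>k\<le>i. \<Sum>l\<le>j. fps_nth (fps_nth F k) l * fps_nth (fps_nth G (i - k)) (j - l))"
  by (simp add: fps_mult_nth fps_sum_nth atLeast0AtMost)

lemma Suc_le_2_power: "real (Suc n) \<le> 2 ^ n"
  by (induction n) auto

lemma convergent2_mult:
  assumes "convergent2 F" "convergent2 G"
  shows "convergent2 (F * G)"
proof -
  from assms(1) obtain r C where F: "0 < r" "r \<le> 1" "1 \<le> C"
    "\<And>i j. norm (fps_nth (fps_nth F i) j) \<le> C / r ^ (i + j)" by (rule convergent2E) blast
  from assms(2) obtain s D where G: "0 < s" "s \<le> 1" "1 \<le> D"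
    "\<And>i j. norm (fps_nth (fps_nth G i) j) \<le> D / s ^ (i + j)" by (rule convergent2E) blast
  define t where "t = min r s"
  have t: "0 < t" "t \<le> r" "t \<le> s" using F G by (auto simp: t_def)
  have F': "norm (fps_nth (fps_nth F i) j) \<le> C / t ^ (i + j)" for i j
    by (rule order_trans[OF F(4)]) (use t F in \<open>auto intro!: divide_left_mono power_mono\<close>)
  have G': "norm (fps_nth (fps_nth G i) j) \<le> D / t ^ (i + j)" for i j
    by (rule order_trans[OF G(4)]) (use t G in \<open>auto intro!: divide_left_mono power_mono\<close>)
  show ?thesis
  proof (rule convergent2I[where r = "t / 2" and C = "C * D"])
    fix i j
    have "norm (fps_nth (fps_nth (F * G) i) j) \<le>
        (\<Sum>k\<le>i. \<Sum>l\<le>j. norm (fps_nth (fps_nth F k) l) * norm (fps_nth (fps_nth G (i - k)) (j - l)))"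
      unfolding fps2_mult_nth by (intro sum_norm_le) (simp add: norm_mult)
    also have "\<dots> \<le> (\<Sum>k\<le>i. \<Sum>l\<le>j. C * D / t ^ (i + j))"
    proof (intro sum_mono)
      fix k l assume kl: "k \<in> {..i}" "l \<in> {..j}"
      have "norm (fps_nth (fps_nth F k) l) * norm (fps_nth (fps_nth G (i - k)) (j - l))
          \<le> (C / t ^ (k + l)) * (D / t ^ ((i - k) + (j - l)))"
        using t F(3) by (intro mult_mono F' G') auto
      also have "\<dots> = C * D / t ^ ((k + l) + ((i - k) + (j - l)))"
        by (simp only: power_add times_divide_times_eq)
      also have "(k + l) + ((i - k) + (j - l)) = i + j" using kl by auto
      finally show "norm (fps_nth (fps_nth F k) l) * norm (fps_nth (fps_nth G (i - k)) (j - l))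
          \<le> C * D / t ^ (i + j)" .
    qed
    also have "\<dots> = (real (Suc i) * real (Suc j)) * (C * D / t ^ (i + j))" by simp
    also have "\<dots> \<le> (2 ^ i * 2 ^ j) * (C * D / t ^ (i + j))"
      using F(3) G(3) t by (intro mult_right_mono mult_mono Suc_le_2_power) auto
    also have "\<dots> = C * D / (t / 2) ^ (i + j)" by (simp add: power_add power_divide)
    finally show "norm (fps_nth (fps_nth (F * G) i) j) \<le> C * D / (t / 2) ^ (i + j)" .
  qed (use t in auto)
qed

typedef cps = "{F. convergent2 F}"
  morphisms fps_of_cps Abs_cps
  by (intro exI[of _ 0]) (auto intro: convergent2_polynomial[of 0])

setup_lifting type_definition_cps

instantiation cps :: idom
begin

lift_definition zero_cps :: cps is 0
  by (rule convergent2_polynomial[of 0]) auto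

lift_definition one_cps :: cps is 1
  by (rule convergent2_polynomial[of 0]) auto

lift_definition plus_cps :: "cps \<Rightarrow> cps \<Rightarrow> cps" is "(+)"
  by (rule convergent2_add)

lift_definition uminus_cps :: "cps \<Rightarrow> cps" is uminus
  by (rule convergent2_uminus)

lift_definition minus_cps :: "cps \<Rightarrow> cps \<Rightarrow> cps" is "(-)"
  by (metis convergent2_add convergent2_uminus add_uminus_conv_diff)

lift_definition times_cps :: "cps \<Rightarrow> cps \<Rightarrow> cps" is "(*)"
  by (rule convergent2_mult)

instance
  by standard (transfer; simp add: algebra_simps)+

end

definition cps_coeff :: "cps \<Rightarrow> nat \<Rightarrow> nat \<Rightarrow> complex" where
  "cps_coeff F i j = fps_nth (fps_nth (fps_of_cps F) i) j"

lift_definition cps_const :: "complex \<Rightarrow> cps" is "\<lambda>c. fps_const (fps_const c)"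
  by (rule convergent2_polynomial[of 0]) auto

lift_definition cps_X :: cps is fps_X
  by (rule convergent2_polynomial[of 1]) (auto simp: fps_X_def)

lift_definition cps_Y :: cps is "fps_const fps_X"
  by (rule convergent2_polynomial[of 1]) (auto simp: fps_X_def)

lift_definition cps_dx :: "cps \<Rightarrow> cps" is fps_deriv
proof -
  fix F assume "convergent2 F"
  then obtain r C where F: "0 < r" "r \<le> 1" "1 \<le> C"
    "\<And>i j. norm (fps_nth (fps_nth F i) j) \<le> C / r ^ (i + j)" by (rule convergent2E) blast
  show "convergent2 (fps_deriv F)"
  proof (rule convergent2I[where r = "r / 2" and C = "C / r"])
    fix i j
    have "fps_deriv F = Abs_fps (\<lambda>n. of_nat (Suc n) * fps_nth F (Suc n))"
      by (simp add: fps_deriv_def)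
    then have "norm (fps_nth (fps_nth (fps_deriv F) i) j)
        = real (Suc i) * norm (fps_nth (fps_nth F (Suc i)) j)"
      by (simp only: fps_nth_Abs_fps fps_of_nat[symmetric] fps_mult_left_const_nth
          norm_mult norm_of_nat)
    also have "\<dots> \<le> 2 ^ (i + j) * (C / r ^ (Suc i + j))"
    proof (intro mult_mono F(4))
      have "real (Suc i) \<le> 2 ^ i" by (rule Suc_le_2_power)
      also have "\<dots> \<le> 2 ^ (i + j)" by (rule power_increasing) auto
      finally show "real (Suc i) \<le> 2 ^ (i + j)" .
    qed (use F in auto)
    also have "\<dots> = C / r / (r / 2) ^ (i + j)" using F by (simp add: power_divide)
    finally show "norm (fps_nth (fps_nth (fps_deriv F) i) j) \<le> C / r / (r / 2) ^ (i + j)" .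
  qed (use F in auto)
qed

lift_definition cps_dy :: "cps \<Rightarrow> cps" is "\<lambda>F. Abs_fps (\<lambda>i. fps_deriv (fps_nth F i))"
proof -
  fix F :: "complex fps fps" assume "convergent2 F"
  then obtain r C where F: "0 < r" "r \<le> 1" "1 \<le> C"
    "\<And>i j. norm (fps_nth (fps_nth F i) j) \<le> C / r ^ (i + j)" by (rule convergent2E) blast
  show "convergent2 (Abs_fps (\<lambda>i. fps_deriv (fps_nth F i)))"
  proof (rule convergent2I[where r = "r / 2" and C = "C / r"])
    fix i j
    have "norm (fps_nth (fps_nth (Abs_fps (\<lambda>i. fps_deriv (fps_nth F i))) i) j)
        = real (Suc j) * norm (fps_nth (fps_nth F i) (Suc j))"
      by (simp add: norm_mult del: of_nat_Suc)
    also have "\<dots> \<le> 2 ^ (i + j) * (C / r ^ (i + Suc j))"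
    proof (intro mult_mono F(4))
      have "real (Suc j) \<le> 2 ^ j" by (rule Suc_le_2_power)
      also have "\<dots> \<le> 2 ^ (i + j)" by (rule power_increasing) auto
      finally show "real (Suc j) \<le> 2 ^ (i + j)" .
    qed (use F in auto)
    also have "\<dots> = C / r / (r / 2) ^ (i + j)" using F by (simp add: power_divide)
    finally show "norm (fps_nth (fps_nth (Abs_fps (\<lambda>i. fps_deriv (fps_nth F i))) i) j)
        \<le> C / r / (r / 2) ^ (i + j)" .
  qed (use F in auto)
qed

text \<open>The infimum of the empty set is \<open>\<infinity>\<close>, so the zero series has weighted order \<open>\<infinity>\<close>.\<close>

definition weighted_order :: "nat \<Rightarrow> nat \<Rightarrow> cps \<Rightarrow> ereal" where
  "weighted_order n m F = (INF (i, j) \<in> {(i, j). cps_coeff F i j \<noteq> 0}. ereal (real (i * n + j * m)))"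

text \<open>The pair \<open>(R, S)\<close> is the 1-form \<open>R dx + S dy\<close>; sums of forms are sums of pairs.\<close>

type_synonym form = "cps \<times> cps"

definition form_scale :: "cps \<Rightarrow> form \<Rightarrow> form" (infixr "*\<^sub>F" 75) where
  "h *\<^sub>F W = (h * fst W, h * snd W)"

definition form_d :: "cps \<Rightarrow> form" where
  "form_d f = (cps_dx f, cps_dy f)"

text \<open>The coefficient of \<open>V \<and> W\<close> with respect to \<open>dx \<and> dy\<close>.\<close>

definition wedge :: "form \<Rightarrow> form \<Rightarrow> cps" where
  "wedge V W = fst V * snd W - snd V * fst W"

definition singular :: "form \<Rightarrow> bool" where
  "singular W \<longleftrightarrow> cps_coeff (fst W) 0 0 = 0 \<and> cps_coeff (snd W) 0 0 = 0"

definition is_foliation_form :: "form \<Rightarrow> bool" where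
  "is_foliation_form W \<longleftrightarrow>
     (\<forall>h. h dvd fst W \<and> h dvd snd W \<longrightarrow> h dvd 1) \<and> singular W"

text \<open>Two 1-forms without common factors define the same foliation iff they differ by a unit.\<close>

definition foliation :: "form \<Rightarrow> form set" where
  "foliation W = {u *\<^sub>F W |u. u dvd 1}"

text \<open>The curve germ \<open>{g = 0}\<close>, represented by the set of all its equations.\<close>

definition curve :: "cps \<Rightarrow> cps set" where
  "curve g = {h. g dvd h \<and> h dvd g}"

definition separatrices :: "form \<Rightarrow> cps set set" where
  "separatrices W = {curve g |g. irreducible g \<and> g dvd wedge W (form_d g)}"

definition nondicritical :: "form \<Rightarrow> bool" where
  "nondicritical W \<longleftrightarrow> finite (separatrices W)"

definition union_of_separatrices :: "form \<Rightarrow> cps \<Rightarrow> bool" where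
  "union_of_separatrices W f \<longleftrightarrow>
     (\<exists>G. finite G \<and> inj_on curve G \<and> curve ` G = separatrices W \<and> curve (\<Prod>G) = curve f)"

definition Fol_forms :: "cps \<Rightarrow> form set" where
  "Fol_forms f = {W. is_foliation_form W \<and> nondicritical W \<and> f dvd wedge W (form_d f)}"

definition Fol :: "cps \<Rightarrow> form set set" where
  "Fol f = {foliation W |W. W \<in> Fol_forms f \<and> union_of_separatrices W f}"

definition linear_part :: "form \<Rightarrow> complex^2^2" where
  "linear_part W =
     vector [vector [- cps_coeff (cps_dx (snd W)) 0 0, - cps_coeff (cps_dy (snd W)) 0 0],
             vector [  cps_coeff (cps_dx (fst W)) 0 0,   cps_coeff (cps_dy (fst W)) 0 0]]"

text \<open>\<open>l1\<close>, \<open>l2\<close> are the eigenvalues of \<open>A\<close>, counted with algebraic multiplicity.\<close>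

definition eigenvalues :: "complex^2^2 \<Rightarrow> complex \<Rightarrow> complex \<Rightarrow> bool" where
  "eigenvalues A l1 l2 \<longleftrightarrow> (\<forall>z. det (mat z - A) = (z - l1) * (z - l2))"

definition pos_rats :: "complex set" where
  "pos_rats = {of_rat c |c. c > 0}"

definition neg_rats :: "complex set" where
  "neg_rats = {of_rat c |c. c < 0}"

definition simple_singularity :: "form \<Rightarrow> bool" where
  "simple_singularity W \<longleftrightarrow> singular W \<and>
     (\<exists>l1 l2. eigenvalues (linear_part W) l1 l2 \<and> l1 * l2 \<noteq> 0 \<and> l1 / l2 \<notin> pos_rats)"

definition saddle_node :: "form \<Rightarrow> bool" where
  "saddle_node W \<longleftrightarrow> singular W \<and>
     (\<exists>l1 l2. eigenvalues (linear_part W) l1 l2 \<and> l1 \<noteq> 0 \<and> l2 = 0)"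

definition irreducible_singularity :: "form \<Rightarrow> bool" where
  "irreducible_singularity W \<longleftrightarrow> simple_singularity W \<or> saddle_node W"

text \<open>
  The points of the exceptional divisor of a point blow-up are the directions at the point:
  \<open>Some t\<close> is the direction \<open>[1 : t]\<close>, with the chart \<open>\<pi>(x, y) = (x, x (y + t))\<close> centred there,
  and \<open>None\<close> is the direction \<open>[0 : 1]\<close>, with the chart \<open>\<pi>(x, y) = (x y, y)\<close>.

  The coefficient of \<open>x\<^sup>k\<close> in \<open>\<Sum>i j. a\<^sub>i\<^sub>j x\<^sup>i (x (y + t))\<^sup>j\<close> is \<open>\<Sum>j\<le>k. a\<^sub>k\<^sub>-\<^sub>j\<^sub>,\<^sub>j (y + t)\<^sup>j\<close>, and the
  coefficient of \<open>x\<^sup>k\<close> in \<open>\<Sum>i j. a\<^sub>i\<^sub>j (x y)\<^sup>i y\<^sup>j\<close> is \<open>y\<^sup>k \<Sum>j. a\<^sub>k\<^sub>j y\<^sup>j\<close>.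
\<close>

type_synonym direction = "complex option"

definition fps_blowup_fin :: "complex \<Rightarrow> complex fps fps \<Rightarrow> complex fps fps" where
  "fps_blowup_fin t F =
     Abs_fps (\<lambda>k. \<Sum>j\<le>k. fps_const (fps_nth (fps_nth F (k - j)) j) * (fps_X + fps_const t) ^ j)"

definition fps_blowup_inf :: "complex fps fps \<Rightarrow> complex fps fps" where
  "fps_blowup_inf F = Abs_fps (\<lambda>k. fps_X ^ k * fps_nth F k)"

lemma fps_X_plus_const_power_bound:
  "norm (fps_nth ((fps_X + fps_const (t :: complex)) ^ j) l) \<le> (1 + norm t) ^ j"
proof (induction j arbitrary: l)
  case 0
  show ?case by simp
next
  case (Suc j)
  let ?P = "(fps_X + fps_const t) ^ j"
  have "fps_nth ((fps_X + fps_const t) ^ Suc j) l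
      = (if l = 0 then 0 else fps_nth ?P (l - 1)) + t * fps_nth ?P l"
    by (simp add: distrib_right)
  also have "norm \<dots> \<le> norm (if l = 0 then 0 else fps_nth ?P (l - 1)) + norm t * norm (fps_nth ?P l)"
    by (metis norm_triangle_ineq norm_mult)
  also have "\<dots> \<le> (1 + norm t) ^ j + norm t * (1 + norm t) ^ j"
    using Suc by (intro add_mono mult_left_mono) auto
  also have "\<dots> = (1 + norm t) ^ Suc j" by (simp add: algebra_simps)
  finally show ?case .
qed

lemma fps_X_plus_const_power_zero:
  "j < l \<Longrightarrow> fps_nth ((fps_X + fps_const (t :: complex)) ^ j) l = 0"
proof (induction j arbitrary: l)
  case 0
  then show ?case by simp
next
  case (Suc j)
  then show ?case by (simp add: distrib_right)
qed

lift_definition cps_blowup_fin :: "complex \<Rightarrow> cps \<Rightarrow> cps" is fps_blowup_fin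
proof -
  fix t :: complex and F assume "convergent2 F"
  then obtain r C where F: "0 < r" "r \<le> 1" "1 \<le> C"
    "\<And>i j. norm (fps_nth (fps_nth F i) j) \<le> C / r ^ (i + j)" by (rule convergent2E) blast
  define M where "M = 1 + norm t"
  have M: "1 \<le> M" by (simp add: M_def)
  define s where "s = r / (2 * M)"
  have s: "0 < s" "s \<le> 1" using F M by (auto simp: s_def field_simps)
  have nth: "fps_nth (fps_nth (fps_blowup_fin t F) k) l =
      (\<Sum>j\<le>k. fps_nth (fps_nth F (k - j)) j * fps_nth ((fps_X + fps_const t) ^ j) l)" for k l
    by (simp add: fps_blowup_fin_def fps_sum_nth)
  show "convergent2 (fps_blowup_fin t F)"
  proof (rule convergent2I[where r = s and C = C])
    fix k l
    have "norm (fps_nth (fps_nth (fps_blowup_fin t F) k) l) \<le> (\<Sum>j\<le>k. C / r ^ k * M ^ k)"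
      unfolding nth
    proof (rule sum_norm_le)
      fix j assume j: "j \<in> {..k}"
      have "norm (fps_nth (fps_nth F (k - j)) j) \<le> C / r ^ k"
        using F(4)[of "k - j" j] j by simp
      moreover have "norm (fps_nth ((fps_X + fps_const t) ^ j) l) \<le> M ^ k"
        using fps_X_plus_const_power_bound[of t j l] power_increasing[of j k M] M j
        by (auto simp: M_def)
      ultimately show "norm (fps_nth (fps_nth F (k - j)) j * fps_nth ((fps_X + fps_const t) ^ j) l)
          \<le> C / r ^ k * M ^ k"
        unfolding norm_mult using F M by (intro mult_mono) auto
    qed
    also have "\<dots> = real (Suc k) * (C / r ^ k * M ^ k)" by simp
    also have "\<dots> \<le> 2 ^ k * (C / r ^ k * M ^ k)"
      using F M by (intro mult_right_mono Suc_le_2_power) auto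
    also have "\<dots> = C / s ^ k" by (simp add: s_def power_divide power_mult_distrib)
    finally have 1: "norm (fps_nth (fps_nth (fps_blowup_fin t F) k) l) \<le> C / s ^ k" .
    have "C / s ^ k \<le> C / s ^ (k + l)"
      using s F by (intro divide_left_mono power_decreasing) auto
    then show "norm (fps_nth (fps_nth (fps_blowup_fin t F) k) l) \<le> C / s ^ (k + l)"
      using 1 by simp
  qed (use s in auto)
qed

lift_definition cps_blowup_inf :: "cps \<Rightarrow> cps" is fps_blowup_inf
proof -
  fix F assume "convergent2 F"
  then obtain r C where F: "0 < r" "r \<le> 1" "1 \<le> C"
    "\<And>i j. norm (fps_nth (fps_nth F i) j) \<le> C / r ^ (i + j)" by (rule convergent2E) blast
  show "convergent2 (fps_blowup_inf F)"
  proof (rule convergent2I[where r = r and C = C])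
    fix k l
    have nth: "fps_nth (fps_nth (fps_blowup_inf F) k) l =
        (if l < k then 0 else fps_nth (fps_nth F k) (l - k))"
      by (simp add: fps_blowup_inf_def fps_X_power_mult_nth)
    show "norm (fps_nth (fps_nth (fps_blowup_inf F) k) l) \<le> C / r ^ (k + l)"
    proof (cases "l < k")
      case True
      then show ?thesis using F by (simp add: nth)
    next
      case False
      have "norm (fps_nth (fps_nth F k) (l - k)) \<le> C / r ^ (k + (l - k))" by (rule F(4))
      also have "\<dots> \<le> C / r ^ (k + l)"
        using F by (intro divide_left_mono power_decreasing) auto
      finally show ?thesis using False by (simp add: nth)
    qed
  qed (use F in auto)
qed

text \<open>
  With \<open>W = R dx + S dy\<close> one has \<open>\<pi>\<^sup>* dy = (y + t) dx + x dy\<close> in the first kind of chart and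
  \<open>\<pi>\<^sup>* dx = y dx + x dy\<close> in the second.
\<close>

fun pullback :: "direction \<Rightarrow> form \<Rightarrow> form" where
  "pullback (Some t) (R, S) =
     (cps_blowup_fin t R + (cps_Y + cps_const t) * cps_blowup_fin t S,
      cps_X * cps_blowup_fin t S)"
| "pullback None (R, S) =
     (cps_Y * cps_blowup_inf R,
      cps_X * cps_blowup_inf R + cps_blowup_inf S)"

fun exceptional :: "direction \<Rightarrow> cps" where
  "exceptional (Some t) = cps_X"
| "exceptional None = cps_Y"

text \<open>
  The germ of the strict transform at a point of the exceptional divisor: the pull-back divided by
  the largest possible power of the equation of the exceptional divisor.
\<close>

definition strict_transform :: "direction \<Rightarrow> form \<Rightarrow> form" where
  "strict_transform c W =
     (THE V. (\<exists>k. pullback c W = exceptional c ^ k *\<^sub>F V) \<and>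
             \<not> (exceptional c dvd fst V \<and> exceptional c dvd snd V))"

text \<open>
  A list of directions \<open>[c\<^sub>1, \<dots>, c\<^sub>k]\<close> denotes a point infinitely near to the origin: the point
  \<open>c\<^sub>k\<close> of the exceptional divisor of the blow-up of the point \<open>[c\<^sub>1, \<dots>, c\<^sub>k\<^sub>-\<^sub>1]\<close>; the empty list is
  the origin itself.
\<close>

definition germ_at :: "form \<Rightarrow> direction list \<Rightarrow> form" where
  "germ_at W cs = fold strict_transform cs W"

text \<open>
  A finite composition of point blow-ups is given by the finite set \<open>T\<close> of its centres, which
  contains with a point also the points it lies over.  The points over the origin of the resulting
  surface are the origin itself if there is no blow-up, and otherwise those points of the
  exceptional divisors which have not been blown up.
\<close>

definition blowup_centres :: "direction list set \<Rightarrow> bool" where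
  "blowup_centres T \<longleftrightarrow> finite T \<and> (\<forall>cs c. cs @ [c] \<in> T \<longrightarrow> cs \<in> T)"

definition points_after :: "direction list set \<Rightarrow> direction list set" where
  "points_after T = {cs. cs \<notin> T \<and> (cs = [] \<or> butlast cs \<in> T)}"

text \<open>
  The second condition is minimality: only points which are not yet irreducible are blown up.
  It makes \<open>T\<close> unique; existence is Seidenberg's theorem.
\<close>

definition reduction_of_singularities :: "form \<Rightarrow> direction list set \<Rightarrow> bool" where
  "reduction_of_singularities W T \<longleftrightarrow>
     blowup_centres T \<and>
     (\<forall>cs\<in>T. singular (germ_at W cs) \<and> \<not> irreducible_singularity (germ_at W cs)) \<and>
     (\<forall>cs\<in>points_after T. singular (germ_at W cs) \<longrightarrow> irreducible_singularity (germ_at W cs))"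

definition generalized_curve :: "form \<Rightarrow> bool" where
  "generalized_curve W \<longleftrightarrow>
     (\<exists>T. reduction_of_singularities W T \<and> (\<forall>cs\<in>points_after T. \<not> saddle_node (germ_at W cs)))"

end

theory Submission
  imports Defs
begin

text \<open>
  Put \<open>h = \<Delta> + f g\<close>, \<open>N = n / d\<close> and \<open>M = m / d\<close>.  Along \<open>x = s\<^sup>N\<close>, \<open>y = s\<^sup>M w\<close> the form
  \<open>n x dy - m y dx\<close> becomes \<open>n s\<^sup>N\<^sup>+\<^sup>M dw\<close>, so that \<open>W\<close> becomes
  \<open>m N s\<^sup>N\<^sup>m\<^sup>-\<^sup>1 (w\<^sup>n - 1) ds + n (s\<^sup>N\<^sup>m w\<^sup>n\<^sup>-\<^sup>1 + s\<^sup>N\<^sup>+\<^sup>M h) dw\<close>.  Everything is read off from this expression.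

  \<^item> If \<open>h\<close> has a term of weight less than \<open>m n - n - m\<close>, the coefficient of \<open>dw\<close> dominates: the
    divisor \<open>s = 0\<close> is not invariant and the leaves cross it transversally.
  \<^item> Otherwise the divisor is invariant and the branches of \<open>f\<close> meet it at the points with
    \<open>w\<^sup>n = 1\<close>.  The number \<open>1 + \<Sum> a\<^sub>r\<^sub>s \<xi>\<^sup>e\<close>, with the exponents \<open>e\<close> of the statement and
    \<open>\<xi> = w\<^sup>-\<^sup>N\<close>, is called the residue at such a point; up to a negative rational factor it is
    the quotient of the two eigenvalues.  If it is a negative rational number, the point is a
    node with two transversal invariant curves, and leaves of the form
    \<open>w = w\<^sub>0 (1 + s\<^sup>a v(s))\<close> pass through it, after a ramification of \<open>s\<close>.
  \<^item> If the residue is zero, the point is a saddle-node, and for the remaining values it is simple.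

  In the first case, and for a negative rational residue, there is thus an analytic leaf outside
  \<open>f = 0\<close> (\<open>dicritical_of_small_weight\<close>, \<open>dicritical_of_negative_residue\<close>), which is impossible
  since the separatrices of \<open>W\<close> are the branches of \<open>f\<close>.  So for the foliations under consideration
  the weighted order is large enough and no residue is a negative rational number, and the question
  is whether a residue vanishes.  The leaf is a solution of a regular differential equation, which
  is analytic by \<open>analytic_ode_solution\<close>.  To obtain a separatrix in the sense of an irreducible
  series one needs an equation of it: the series vanishing on a parametrized curve form a nonzero
  prime ideal, which is principal by Weierstrass division, and its generator is the equation
  (\<open>separatrix_of_integral_curve\<close>).

  For the reduction of singularities, the weighted blow-up is a composition of point blow-ups
  which carry out Euclid's algorithm on \<open>(n, m)\<close> (\<open>toric_reduction\<close>).  Up to the last step there is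
  only one point which is not regular or simple.  On the last divisor the only points not of this
  kind can be those on the branches of \<open>f\<close>, where the eigenvalues are those described above
  (\<open>final_points_on_curve\<close>).  Since a reduction of singularities blows up exactly the points that
  are not irreducible, it passes through all these centres and shows a saddle-node if and only if
  some residue vanishes (\<open>generalized_curve_iff_residues\<close>).  For \<open>n = m = 2\<close> the linear part at the
  origin is not nilpotent, and the origin itself decides (\<open>generalized_curve_node\<close>).
\<close>

section \<open>Coefficients of convergent series\<close>

abbreviation xrow :: "cps \<Rightarrow> nat \<Rightarrow> complex fps" where
  "xrow F i \<equiv> fps_nth (fps_of_cps F) i"

lemma xrow_nth: "fps_nth (xrow F i) j = cps_coeff F i j"
  by (simp add: cps_coeff_def)

lemma cps_eqI: "(\<And>i j. cps_coeff F i j = cps_coeff G i j) \<Longrightarrow> F = G"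
  unfolding cps_coeff_def by (simp add: fps_of_cps_inject[symmetric] fps_eq_iff)

lemma cps_coeff_0 [simp]: "cps_coeff 0 i j = 0"
  by (simp add: cps_coeff_def zero_cps.rep_eq)

lemma cps_coeff_1: "cps_coeff 1 i j = (if i = 0 \<and> j = 0 then 1 else 0)"
  by (simp add: cps_coeff_def one_cps.rep_eq)

lemma cps_coeff_add [simp]: "cps_coeff (F + G) i j = cps_coeff F i j + cps_coeff G i j"
  by (simp add: cps_coeff_def plus_cps.rep_eq)

lemma cps_coeff_uminus [simp]: "cps_coeff (- F) i j = - cps_coeff F i j"
  by (simp add: cps_coeff_def uminus_cps.rep_eq)

lemma cps_coeff_diff [simp]: "cps_coeff (F - G) i j = cps_coeff F i j - cps_coeff G i j"
  by (simp add: cps_coeff_def minus_cps.rep_eq)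

lemma cps_coeff_sum: "cps_coeff (\<Sum>x\<in>A. F x) i j = (\<Sum>x\<in>A. cps_coeff (F x) i j)"
  by (induction A rule: infinite_finite_induct) auto

lemma cps_coeff_mult:
  "cps_coeff (F * G) i j = (\<Sum>k\<le>i. \<Sum>l\<le>j. cps_coeff F k l * cps_coeff G (i - k) (j - l))"
  by (simp add: cps_coeff_def times_cps.rep_eq fps2_mult_nth)

lemma xrow_mult: "xrow (F * G) i = (\<Sum>k\<le>i. xrow F k * xrow G (i - k))"
  by (simp add: times_cps.rep_eq fps_mult_nth atLeast0AtMost)

lemma xrow_add: "xrow (F + G) i = xrow F i + xrow G i"
  by (simp add: plus_cps.rep_eq)

lemma cps_coeff_const: "cps_coeff (cps_const c) i j = (if i = 0 \<and> j = 0 then c else 0)"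
  by (simp add: cps_coeff_def cps_const.rep_eq)

lemma cps_coeff_const_mult [simp]: "cps_coeff (cps_const c * F) i j = c * cps_coeff F i j"
  by (simp add: cps_coeff_def times_cps.rep_eq cps_const.rep_eq fps_mult_left_const_nth)

lemma cps_coeff_X: "cps_coeff cps_X i j = (if i = 1 \<and> j = 0 then 1 else 0)"
  by (auto simp: cps_coeff_def cps_X.rep_eq fps_X_def)

lemma cps_coeff_Y: "cps_coeff cps_Y i j = (if i = 0 \<and> j = 1 then 1 else 0)"
  by (auto simp: cps_coeff_def cps_Y.rep_eq fps_X_def)

lemma cps_coeff_X_mult: "cps_coeff (cps_X * F) i j = (if i = 0 then 0 else cps_coeff F (i - 1) j)"
  by (simp add: cps_coeff_def times_cps.rep_eq cps_X.rep_eq)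

lemma cps_coeff_Y_mult: "cps_coeff (cps_Y * F) i j = (if j = 0 then 0 else cps_coeff F i (j - 1))"
  by (simp add: cps_coeff_def times_cps.rep_eq cps_Y.rep_eq fps_mult_left_const_nth)

lemma cps_coeff_X_power_mult:
  "cps_coeff (cps_X ^ k * F) i j = (if i < k then 0 else cps_coeff F (i - k) j)"
  by (induction k arbitrary: i) (auto simp: cps_coeff_X_mult mult.assoc)

lemma cps_coeff_Y_power_mult:
  "cps_coeff (cps_Y ^ k * F) i j = (if j < k then 0 else cps_coeff F i (j - k))"
  by (induction k arbitrary: j) (auto simp: cps_coeff_Y_mult mult.assoc)

lemma cps_coeff_X_power: "cps_coeff (cps_X ^ k) i j = (if i = k \<and> j = 0 then 1 else 0)"
  using cps_coeff_X_power_mult[of k 1 i j] by (auto simp: cps_coeff_1)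

lemma cps_coeff_Y_power: "cps_coeff (cps_Y ^ k) i j = (if i = 0 \<and> j = k then 1 else 0)"
  using cps_coeff_Y_power_mult[of k 1 i j] by (auto simp: cps_coeff_1)

lemma cps_const_numeral_simps:
  "cps_const 0 = 0" "cps_const 1 = 1" "cps_const (a * b) = cps_const a * cps_const b"
  "cps_const (a + b) = cps_const a + cps_const b"
  by (rule cps_eqI; simp add: cps_coeff_1 cps_coeff_const)+

lemma cps_of_nat: "of_nat n = cps_const (of_nat n)"
  by (induction n) (auto simp: cps_const_numeral_simps)

lemma cps_coeff_of_nat_mult [simp]: "cps_coeff (of_nat n * F) i j = of_nat n * cps_coeff F i j"
  by (simp add: cps_of_nat)

lemma cps_coeff_dx: "cps_coeff (cps_dx F) i j = of_nat (Suc i) * cps_coeff F (Suc i) j"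
proof -
  have "fps_nth (fps_deriv (fps_of_cps F)) i = of_nat (Suc i) * fps_nth (fps_of_cps F) (Suc i)"
    by simp
  then show ?thesis
    unfolding cps_coeff_def cps_dx.rep_eq
    by (simp only: fps_of_nat[symmetric] fps_mult_left_const_nth)
qed

lemma cps_coeff_dy: "cps_coeff (cps_dy F) i j = of_nat (Suc j) * cps_coeff F i (Suc j)"
  by (simp add: cps_coeff_def cps_dy.rep_eq)

lemma cps_boundE:
  obtains r C where "0 < r" "r \<le> 1" "1 \<le> C" "\<And>i j. norm (cps_coeff F i j) \<le> C / r ^ (i + j)"
  using fps_of_cps[of F] unfolding cps_coeff_def mem_Collect_eq 
  by (rule convergent2E) (use that in \<open>simp add: cps_coeff_def\<close>)

text \<open>
  Elements of the ring are constructed from their coefficients and a Cauchy estimate; a power of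
  a variable can then be cancelled by shifting the coefficients.
\<close>

lemma cps_of_coeffs:
  assumes "0 < r" "\<And>i j. norm (c i j) \<le> C / r ^ (i + j)"
  obtains F where "\<And>i j. cps_coeff F i j = c i j"
proof -
  let ?F = "Abs_fps (\<lambda>i. Abs_fps (c i))"
  have "convergent2 ?F"
    using assms by (intro convergent2I[of r _ C]) auto
  then show thesis
    by (intro that[of "Abs_cps ?F"]) (simp add: cps_coeff_def Abs_cps_inverse)
qed

lemma cps_X_power_factor:
  assumes "\<And>i j. i < k \<Longrightarrow> cps_coeff F i j = 0"
  obtains G where "F = cps_X ^ k * G" "\<And>i j. cps_coeff G i j = cps_coeff F (i + k) j"
proof -
  obtain r C where r: "0 < r" "r \<le> 1" "1 \<le> C"
    and b: "\<And>i j. norm (cps_coeff F i j) \<le> C / r ^ (i + j)" by (rule cps_boundE) blast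
  have "norm (cps_coeff F (i + k) j) \<le> (C / r ^ k) / r ^ (i + j)" for i j
    using b[of "i + k" j] by (simp add: power_add field_simps)
  with r(1) obtain G where G: "\<And>i j. cps_coeff G i j = cps_coeff F (i + k) j"
    by (rule cps_of_coeffs) blast
  show thesis
    by (rule that[OF _ G], rule cps_eqI) (use assms in \<open>auto simp: cps_coeff_X_power_mult G\<close>)
qed

lemma cps_Y_power_factor:
  assumes "\<And>i j. j < k \<Longrightarrow> cps_coeff F i j = 0"
  obtains G where "F = cps_Y ^ k * G" "\<And>i j. cps_coeff G i j = cps_coeff F i (j + k)"
proof -
  obtain r C where r: "0 < r" "r \<le> 1" "1 \<le> C"
    and b: "\<And>i j. norm (cps_coeff F i j) \<le> C / r ^ (i + j)" by (rule cps_boundE) blast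
  have "norm (cps_coeff F i (j + k)) \<le> (C / r ^ k) / r ^ (i + j)" for i j
    using b[of i "j + k"] by (simp add: power_add field_simps)
  with r(1) obtain G where G: "\<And>i j. cps_coeff G i j = cps_coeff F i (j + k)"
    by (rule cps_of_coeffs) blast
  show thesis
    by (rule that[OF _ G], rule cps_eqI) (use assms in \<open>auto simp: cps_coeff_Y_power_mult G\<close>)
qed

lemma cps_X_dvd_iff: "cps_X dvd F \<longleftrightarrow> (\<forall>j. cps_coeff F 0 j = 0)"
proof
  assume "cps_X dvd F"
  then show "\<forall>j. cps_coeff F 0 j = 0" by (auto simp: dvd_def cps_coeff_X_mult)
next
  assume *: "\<forall>j. cps_coeff F 0 j = 0"
  obtain G where "F = cps_X ^ 1 * G" by (rule cps_X_power_factor[of 1 F]) (use * in auto)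
  then show "cps_X dvd F" by simp
qed

lemma cps_Y_dvd_iff: "cps_Y dvd F \<longleftrightarrow> (\<forall>i. cps_coeff F i 0 = 0)"
proof
  assume "cps_Y dvd F"
  then show "\<forall>i. cps_coeff F i 0 = 0" by (auto simp: dvd_def cps_coeff_Y_mult)
next
  assume *: "\<forall>i. cps_coeff F i 0 = 0"
  obtain G where "F = cps_Y ^ 1 * G" by (rule cps_Y_power_factor[of 1 F]) (use * in auto)
  then show "cps_Y dvd F" by simp
qed

section \<open>Weierstrass division\<close>

text \<open>
  The quotient \<open>q\<close> of \<open>h\<close> by \<open>g = y\<^sup>N + e\<close> is the fixed point of
  \<open>q = A(h) - A(q e)\<close>, where \<open>A\<close> drops the terms of degree less than \<open>N\<close> in \<open>y\<close> and divides the
  others by \<open>y\<^sup>N\<close>.  If \<open>x\<close> has weight \<open>N + 1\<close> and \<open>y\<close> weight 1, all terms of \<open>e\<close> have weight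
  greater than \<open>N\<close>, so that a coefficient of \<open>q\<close> is determined by those of smaller weight.
\<close>

function weierstrass_quotient ::
  "nat \<Rightarrow> (nat \<Rightarrow> nat \<Rightarrow> complex) \<Rightarrow> (nat \<Rightarrow> nat \<Rightarrow> complex) \<Rightarrow> nat \<Rightarrow> nat \<Rightarrow> complex" where
  "weierstrass_quotient N e h i j = h i (j + N) -
     (\<Sum>k\<le>i. \<Sum>l\<le>j + N. if N < (N + 1) * k + l
        then e k l * weierstrass_quotient N e h (i - k) (j + N - l) else 0)"
  by pat_completeness auto
termination
proof (relation "Wellfounded.measure (\<lambda>(N, e, h, i, j). (N + 1) * i + j)")
  show "wf (Wellfounded.measure (\<lambda>(N, e :: nat \<Rightarrow> nat \<Rightarrow> complex, h :: nat \<Rightarrow> nat \<Rightarrow> complex, i, j).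
      (N + 1) * i + j))" by simp
  show "((N, e, h, i - k, j + N - l), N, e, h, i, j) \<in>
      Wellfounded.measure (\<lambda>(N, e, h, i, j). (N + 1) * i + j)"
    if *: "k \<in> {..i}" "l \<in> {..j + N}" "N < (N + 1) * k + l"
    for N :: nat and e h :: "nat \<Rightarrow> nat \<Rightarrow> complex" and i j k l
  proof -
    have "(N + 1) * (i - k) + (N + 1) * k = (N + 1) * i"
      using *(1) by (simp flip: add_mult_distrib2)
    then have "(N + 1) * (i - k) + (j + N - l) < (N + 1) * i + j"
      using *(2,3) unfolding atMost_iff by linarith
    then show ?thesis by simp
  qed
qed

declare weierstrass_quotient.simps [simp del]

lemma half_power_sum_le: "(\<Sum>k\<le>n. (1 / 2 :: real) ^ k) \<le> 2"
proof -
  have "(\<Sum>k\<le>n. (1 / 2 :: real) ^ k) = 2 - (1 / 2) ^ n"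
    by (induction n) (auto simp: field_simps)
  then show ?thesis by simp
qed

text \<open>
  For \<open>\<rho>\<close> small the weighted terms of \<open>e\<close> add up to at most \<open>\<rho>\<^sup>N / 2\<close>, since each of them has
  weight at least \<open>N + 1\<close>; so the bound \<open>B \<rho>\<^sup>-\<^sup>w\<close> for the coefficients of weight \<open>w\<close> is inherited
  from the smaller weights.
\<close>

lemma weierstrass_quotient_bound:
  fixes e h :: "nat \<Rightarrow> nat \<Rightarrow> complex" and N :: nat
  assumes r: "0 < r" "r \<le> 1" "1 \<le> C"
    and e: "\<And>i j. norm (e i j) \<le> C / r ^ (i + j)"
    and h: "\<And>i j. norm (h i j) \<le> C / r ^ (i + j)"
  defines "\<rho> \<equiv> (r / 2) ^ (N + 1) / (8 * C)"
  shows "norm (weierstrass_quotient N e h i j) \<le> (2 * C / r ^ N) / \<rho> ^ ((N + 1) * i + j)"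
proof (induction "(N + 1) * i + j" arbitrary: i j rule: less_induct)
  case less
  let ?B = "2 * C / r ^ N"
  let ?w = "\<lambda>k l. (N + 1) * k + l"
  define D where "D = C * (2 / r) ^ (N + 1)"
  have \<rho>: "0 < \<rho>" using r by (simp add: \<rho>_def)
  have \<rho>D: "\<rho> * D = 1 / 8"
    using r by (simp add: \<rho>_def D_def power_divide field_simps)
  \<comment> \<open>The factor \<open>8 C\<close> in \<open>\<rho>\<close> makes \<open>\<rho> D\<close> equal to \<open>1 / 8\<close>; the two geometric series below contribute
      a factor of at most 4, which leaves \<open>1 / 2\<close>.\<close>
  have "\<rho> \<le> (r / 2) ^ (N + 1) / 1"
    unfolding \<rho>_def using r by (intro divide_left_mono) auto
  also have "\<dots> \<le> (r / 2) ^ 1 / 1"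
    using r by (intro divide_right_mono power_decreasing) auto
  finally have \<rho>r: "\<rho> \<le> r / 2" by simp
  have term_bound: "norm (e k l) * \<rho> ^ (?w k l - N) \<le> \<rho> * D * ((1 / 2) ^ k * (1 / 2) ^ l)"
    if kl: "N < ?w k l" for k l
  proof -
    have "norm (e k l) * \<rho> ^ (?w k l - N) = norm (e k l) * \<rho> * \<rho> ^ (?w k l - N - 1)"
    proof -
      have "?w k l - N = Suc (?w k l - N - 1)" using kl by linarith
      then show ?thesis by (metis power_Suc mult.assoc)
    qed
    also have "\<dots> \<le> (C / r ^ (k + l)) * \<rho> * (r / 2) ^ (?w k l - N - 1)"
      using \<rho> \<rho>r r by (intro mult_mono e power_mono) auto
    also have "\<dots> \<le> (C / r ^ (k + l)) * \<rho> * ((r / 2) ^ (k + l) / (r / 2) ^ (N + 1))"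
    proof (intro mult_left_mono)
      have "(r / 2) ^ (?w k l - N - 1) = (r / 2) ^ ?w k l / (r / 2) ^ (N + 1)"
        using kl r by (subst power_diff[symmetric]) auto
      also have "\<dots> \<le> (r / 2) ^ (k + l) / (r / 2) ^ (N + 1)"
        using r by (intro divide_right_mono power_decreasing) auto
      finally show "(r / 2) ^ (?w k l - N - 1) \<le> (r / 2) ^ (k + l) / (r / 2) ^ (N + 1)" .
    qed (use r \<rho> in auto)
    also have "\<dots> = \<rho> * D * ((1 / 2) ^ k * (1 / 2) ^ l)"
      using r by (simp add: D_def power_divide power_add mult_ac)
    finally show ?thesis .
  qed
  have sum_bound: "(\<Sum>k\<le>i. \<Sum>l\<le>j + N. if N < ?w k l then norm (e k l) * \<rho> ^ (?w k l - N) else 0)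
      \<le> 1 / 2"
  proof -
    have "(\<Sum>k\<le>i. \<Sum>l\<le>j + N. if N < ?w k l then norm (e k l) * \<rho> ^ (?w k l - N) else 0)
        \<le> (\<Sum>k\<le>i. \<Sum>l\<le>j + N. \<rho> * D * ((1 / 2) ^ k * (1 / 2) ^ l))"
    proof (intro sum_mono)
      fix k l
      show "(if N < ?w k l then norm (e k l) * \<rho> ^ (?w k l - N) else 0)
          \<le> \<rho> * D * ((1 / 2) ^ k * (1 / 2) ^ l)"
      proof (cases "N < ?w k l")
        case True
        then show ?thesis by (simp only: if_True term_bound)
      next
        case False
        then show ?thesis by (simp add: \<rho>D)
      qed
    qed
    also have "\<dots> = \<rho> * D * ((\<Sum>k\<le>i. (1 / 2) ^ k) * (\<Sum>l\<le>j + N. (1 / 2) ^ l))"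
      unfolding sum_product by (simp only: sum_distrib_left)
    also have "\<dots> \<le> \<rho> * D * (2 * 2)"
      using \<rho>D by (intro mult_left_mono mult_mono half_power_sum_le sum_nonneg) auto
    finally show ?thesis using \<rho>D by simp
  qed
  let ?q = "weierstrass_quotient N e h"
  have "norm (?q i j) \<le> norm (h i (j + N)) + norm (\<Sum>k\<le>i. \<Sum>l\<le>j + N. if N < ?w k l
        then e k l * ?q (i - k) (j + N - l) else 0)"
    by (subst weierstrass_quotient.simps) (rule norm_triangle_ineq4)
  also have "\<dots> \<le> norm (h i (j + N)) + (\<Sum>k\<le>i. \<Sum>l\<le>j + N. (if N < ?w k l
      then norm (e k l) * \<rho> ^ (?w k l - N) else 0) * (?B / \<rho> ^ ?w i j))"
  proof (intro add_left_mono sum_norm_le)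
    fix k l assume kl: "k \<in> {..i}" "l \<in> {..j + N}"
    show "norm (if N < ?w k l then e k l * ?q (i - k) (j + N - l) else 0) \<le>
        (if N < ?w k l then norm (e k l) * \<rho> ^ (?w k l - N) else 0) * (?B / \<rho> ^ ?w i j)"
    proof (cases "N < ?w k l")
      case True
      have "(N + 1) * (i - k) + (N + 1) * k = (N + 1) * i"
        using kl(1) by (simp flip: add_mult_distrib2)
      then have w: "?w (i - k) (j + N - l) + (?w k l - N) = ?w i j"
        using kl(2) True unfolding atMost_iff by linarith
      then have "?w (i - k) (j + N - l) < ?w i j" using True by linarith
      then have IH: "norm (?q (i - k) (j + N - l)) \<le> ?B / \<rho> ^ ?w (i - k) (j + N - l)"
        by (rule less)
      have "norm (e k l * ?q (i - k) (j + N - l))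
          \<le> norm (e k l) * (?B / \<rho> ^ ?w (i - k) (j + N - l))"
        unfolding norm_mult by (intro mult_left_mono IH) auto
      also have "\<dots> = norm (e k l) * \<rho> ^ (?w k l - N) * (?B / \<rho> ^ ?w i j)"
        unfolding w[symmetric] power_add using \<rho> by simp
      finally show ?thesis using True by simp
    qed auto
  qed
  also have "\<dots> = norm (h i (j + N)) + (\<Sum>k\<le>i. \<Sum>l\<le>j + N. if N < ?w k l
      then norm (e k l) * \<rho> ^ (?w k l - N) else 0) * (?B / \<rho> ^ ?w i j)"
    by (simp only: sum_distrib_right)
  also have "\<dots> \<le> (?B / 2) / \<rho> ^ ?w i j + 1 / 2 * (?B / \<rho> ^ ?w i j)"
  proof (intro add_mono mult_right_mono sum_bound)
    have "norm (h i (j + N)) \<le> C / r ^ (i + (j + N))" by (rule h)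
    also have "\<dots> = (?B / 2) / r ^ (i + j)" by (simp add: power_add)
    also have "\<dots> \<le> (?B / 2) / r ^ ?w i j"
      using r by (intro divide_left_mono power_decreasing) auto
    also have "\<dots> \<le> (?B / 2) / \<rho> ^ ?w i j"
      using r \<rho> \<rho>r by (intro divide_left_mono power_mono) auto
    finally show "norm (h i (j + N)) \<le> (?B / 2) / \<rho> ^ ?w i j" .
  qed (use r \<rho> in auto)
  finally show ?case by simp
qed


text \<open>
  The quotient does not change if \<open>g\<close> and \<open>h\<close> are divided by the same constant, so that
  \<open>g = y\<^sup>N + e\<close> may be assumed; by construction \<open>h - q g\<close> has degree less than \<open>N\<close> in \<open>y\<close>.
\<close>

theorem weierstrass_division:
  assumes "\<And>j. j < N \<Longrightarrow> cps_coeff g 0 j = 0" and "cps_coeff g 0 N \<noteq> 0"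
  obtains q r where "h = q * g + r" "\<And>i j. N \<le> j \<Longrightarrow> cps_coeff r i j = 0"
proof -
  define c where "c = cps_coeff g 0 N"
  define e where "e = (\<lambda>i j. if i = 0 \<and> j = N then 0 else cps_coeff g i j / c)"
  define h' where "h' = (\<lambda>i j. cps_coeff h i j / c)"
  have c: "c \<noteq> 0" using assms by (simp add: c_def)
  obtain r1 C1 where 1: "0 < r1" "r1 \<le> 1" "1 \<le> C1"
    "\<And>i j. norm (cps_coeff (cps_const (1 / c) * g) i j) \<le> C1 / r1 ^ (i + j)"
    by (rule cps_boundE) blast
  obtain r2 C2 where 2: "0 < r2" "r2 \<le> 1" "1 \<le> C2"
    "\<And>i j. norm (cps_coeff (cps_const (1 / c) * h) i j) \<le> C2 / r2 ^ (i + j)"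
    by (rule cps_boundE) blast
  define r C where "r = min r1 r2" and "C = max C1 C2"
  have r: "0 < r" "r \<le> 1" "1 \<le> C" using 1 2 by (auto simp: r_def C_def)
  have C1: "C1 / r1 ^ k \<le> C / r ^ k" for k
    using 1 2 by (intro frac_le power_mono) (auto simp: r_def C_def)
  have C2: "C2 / r2 ^ k \<le> C / r ^ k" for k
    using 1 2 by (intro frac_le power_mono) (auto simp: r_def C_def)
  have e: "norm (e i j) \<le> C / r ^ (i + j)" for i j
  proof -
    have "norm (e i j) \<le> norm (cps_coeff (cps_const (1 / c) * g) i j)" by (simp add: e_def)
    also have "\<dots> \<le> C / r ^ (i + j)" using 1(4) C1 by (rule order_trans)
    finally show ?thesis .
  qed
  have h: "norm (h' i j) \<le> C / r ^ (i + j)" for i j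
  proof -
    have "norm (h' i j) \<le> norm (cps_coeff (cps_const (1 / c) * h) i j)" by (simp add: h'_def)
    also have "\<dots> \<le> C / r ^ (i + j)" using 2(4) C2 by (rule order_trans)
    finally show ?thesis .
  qed
  define \<rho> where "\<rho> = (r / 2) ^ (N + 1) / (8 * C)"
  define Q where "Q = weierstrass_quotient N e h'"
  have \<rho>: "0 < \<rho>" "\<rho> \<le> 1"
  proof -
    have "(r / 2) ^ (N + 1) \<le> 1" using r by (intro power_le_one) auto
    then have "(r / 2) ^ (N + 1) \<le> 8 * C" using r by linarith
    then show "0 < \<rho>" "\<rho> \<le> 1"
      unfolding \<rho>_def using r by (simp_all add: divide_le_eq_1_pos del: power_Suc)
  qed
  have "norm (Q i j) \<le> (2 * C / r ^ N) / (\<rho> ^ (N + 1)) ^ (i + j)" for i j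
  proof -
    have "norm (Q i j) \<le> (2 * C / r ^ N) / \<rho> ^ ((N + 1) * i + j)"
      unfolding Q_def \<rho>_def by (rule weierstrass_quotient_bound[OF r e h])
    also have "\<dots> \<le> (2 * C / r ^ N) / \<rho> ^ ((N + 1) * (i + j))"
      using \<rho> r by (intro divide_left_mono power_decreasing) auto
    finally show ?thesis by (simp only: power_mult)
  qed
  moreover have "0 < \<rho> ^ (N + 1)" using \<rho> by simp
  ultimately obtain q where q: "\<And>i j. cps_coeff q i j = Q i j" using cps_of_coeffs by blast
  have "cps_coeff (q * g) i (j + N) = cps_coeff h i (j + N)" for i j
  proof -
    have g: "cps_coeff g k l = c * ((if k = 0 \<and> l = N then 1 else 0) +
        (if N < (N + 1) * k + l then e k l else 0))" for k l
      using c assms(1)[of l] by (cases k) (auto simp: e_def c_def)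
    have "cps_coeff (g * q) i (j + N) =
        (\<Sum>k\<le>i. \<Sum>l\<le>j + N. c * ((if k = 0 then if l = N then Q (i - k) (j + N - l) else 0 else 0) +
          (if N < (N + 1) * k + l then e k l * Q (i - k) (j + N - l) else 0)))"
      unfolding cps_coeff_mult g q by (intro sum.cong) (auto simp: algebra_simps)
    also have "\<dots> = c * ((\<Sum>k\<le>i. if k = 0 then (\<Sum>l\<le>j + N. if l = N then Q (i - k) (j + N - l) else 0) else 0)
          + (\<Sum>k\<le>i. \<Sum>l\<le>j + N. if N < (N + 1) * k + l then e k l * Q (i - k) (j + N - l) else 0))"
      unfolding sum_distrib_left[symmetric] sum.distrib
      by (intro arg_cong2[where f = "(*)"] arg_cong2[where f = "(+)"] sum.cong) auto
    also have "(\<Sum>k\<le>i. if k = 0 then (\<Sum>l\<le>j + N. if l = N then Q (i - k) (j + N - l) else 0) else 0)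
        = Q i j" by (simp add: sum.delta)
    also have "Q i j = h' i (j + N) -
        (\<Sum>k\<le>i. \<Sum>l\<le>j + N. if N < (N + 1) * k + l then e k l * Q (i - k) (j + N - l) else 0)"
      unfolding Q_def by (subst weierstrass_quotient.simps) simp
    finally show ?thesis using c by (simp add: h'_def mult.commute)
  qed
  note * = this
  have "cps_coeff (h - q * g) i j = 0" if "N \<le> j" for i j
    using *[of i "j - N"] that by simp
  then show thesis by (intro that[of q "h - q * g"]) auto
qed

text \<open>
  For \<open>N = 0\<close> the remainder vanishes, and dividing 1 by \<open>F\<close> gives the inverse of \<open>F\<close>.
\<close>

lemma cps_unit_iff: "F dvd 1 \<longleftrightarrow> cps_coeff F 0 0 \<noteq> 0"
proof
  assume "F dvd 1"
  then obtain G where "1 = F * G" by (auto simp: dvd_def)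
  moreover have "cps_coeff (F * G) 0 0 = cps_coeff F 0 0 * cps_coeff G 0 0"
    by (simp add: cps_coeff_mult)
  ultimately have "cps_coeff F 0 0 * cps_coeff G 0 0 = 1" by (metis cps_coeff_1)
  then show "cps_coeff F 0 0 \<noteq> 0" by auto
next
  assume "cps_coeff F 0 0 \<noteq> 0"
  then obtain q r where "1 = q * F + r" "\<And>i j. 0 \<le> j \<Longrightarrow> cps_coeff r i j = 0"
    using weierstrass_division[of 0 F 1] by blast
  moreover from this have "r = 0" by (intro cps_eqI) auto
  ultimately show "F dvd 1" by (metis add.right_neutral dvd_triv_right)
qed

section \<open>Restriction of series to a parametrized curve\<close>

text \<open>
  The series \<open>F(s\<^sup>N, Y(s))\<close> for \<open>N > 0\<close> and \<open>Y(0) = 0\<close>.  The power \<open>x\<^sup>i\<close> contributes only to the degrees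
  \<open>k \<ge> N i \<ge> i\<close>, so that each coefficient is a finite sum.
\<close>

definition curve_eval :: "nat \<Rightarrow> complex fps \<Rightarrow> cps \<Rightarrow> complex fps" where
  "curve_eval N Y F = Abs_fps (\<lambda>k. \<Sum>i\<le>k. fps_nth (fps_X ^ (N * i) * (xrow F i oo Y)) k)"

lemma curve_eval_nth:
  assumes "0 < N" "k \<le> K"
  shows "fps_nth (curve_eval N Y F) k = fps_nth (\<Sum>i\<le>K. fps_X ^ (N * i) * (xrow F i oo Y)) k"
proof -
  have "fps_nth (\<Sum>i\<le>K. fps_X ^ (N * i) * (xrow F i oo Y)) k
      = (\<Sum>i\<le>K. fps_nth (fps_X ^ (N * i) * (xrow F i oo Y)) k)" by (simp add: fps_sum_nth)
  also have "\<dots> = (\<Sum>i\<le>k. fps_nth (fps_X ^ (N * i) * (xrow F i oo Y)) k)"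
  proof (rule sum.mono_neutral_right)
    show "\<forall>i\<in>{..K} - {..k}. fps_nth (fps_X ^ (N * i) * (xrow F i oo Y)) k = 0"
    proof
      fix i assume "i \<in> {..K} - {..k}"
      then have "k < 1 * i" by auto
      also have "\<dots> \<le> N * i" using assms by (intro mult_right_mono) auto
      finally show "fps_nth (fps_X ^ (N * i) * (xrow F i oo Y)) k = 0"
        by (simp add: fps_X_power_mult_nth)
    qed
  qed (use assms in auto)
  finally show ?thesis by (simp add: curve_eval_def)
qed

lemma curve_eval_mult_nth:
  assumes "0 < N" "k \<le> K"
  shows "fps_nth (curve_eval N Y F * H) k
      = fps_nth ((\<Sum>i\<le>K. fps_X ^ (N * i) * (xrow F i oo Y)) * H) k"
  unfolding fps_mult_nth
  by (intro sum.cong refl arg_cong2[where f = "(*)"] curve_eval_nth) (use assms in auto)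

lemma curve_eval_add: "curve_eval N Y (F + G) = curve_eval N Y F + curve_eval N Y G"
  by (intro fps_ext)
    (simp add: curve_eval_def xrow_add fps_compose_add_distrib ring_distribs sum.distrib)

text \<open>
  In degree \<open>k\<close> both sides are sums over the pairs \<open>(a, b)\<close> of powers of \<open>x\<close>, those with \<open>a + b > k\<close>
  contributing nothing.
\<close>

lemma curve_eval_mult:
  assumes N: "0 < N" and Y: "fps_nth Y 0 = 0"
  shows "curve_eval N Y (F * G) = curve_eval N Y F * curve_eval N Y G"
proof (rule fps_ext)
  fix k
  let ?T = "\<lambda>F i. fps_X ^ (N * i) * (xrow F i oo Y)"
  have vanish: "fps_nth (?T F a * ?T G b) k = 0" if "k < a + b" for a b
  proof -
    have "?T F a * ?T G b = fps_X ^ (N * (a + b)) * ((xrow F a oo Y) * (xrow G b oo Y))"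
      by (simp only: power_add add_mult_distrib2 mult_ac)
    then have "fps_nth (?T F a * ?T G b) k
        = fps_nth (fps_X ^ (N * (a + b)) * ((xrow F a oo Y) * (xrow G b oo Y))) k"
      by (rule arg_cong)
    moreover have "k < N * (a + b)"
      using that N by (metis One_nat_def Suc_leI le_trans less_le_not_le mult_le_mono1 nat_mult_1 not_le)
    ultimately show ?thesis by (simp only: fps_X_power_mult_nth if_True)
  qed
  have "fps_nth (curve_eval N Y F * curve_eval N Y G) k
      = fps_nth ((\<Sum>a\<le>k. ?T F a) * (\<Sum>b\<le>k. ?T G b)) k"
    unfolding fps_mult_nth
    by (intro sum.cong refl arg_cong2[where f = "(*)"] curve_eval_nth[OF N]) auto
  also have "\<dots> = (\<Sum>(a, b)\<in>{..k} \<times> {..k}. fps_nth (?T F a * ?T G b) k)"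
    by (simp add: sum_product fps_sum_nth sum.cartesian_product case_prod_unfold)
  also have "\<dots> = (\<Sum>(a, b)\<in>{(a, b). a + b \<le> k}. fps_nth (?T F a * ?T G b) k)"
    by (rule sum.mono_neutral_right) (auto intro: vanish)
  also have "\<dots> = (\<Sum>i\<le>k. \<Sum>a\<le>i. fps_nth (?T F a * ?T G (i - a)) k)"
    by (rule sum.triangle_reindex_eq)
  also have "\<dots> = (\<Sum>i\<le>k. fps_nth (?T (F * G) i) k)"
  proof (rule sum.cong[OF refl])
    fix i
    have "?T (F * G) i = (\<Sum>a\<le>i. ?T F a * ?T G (i - a))"
      unfolding xrow_mult fps_compose_sum_distrib fps_compose_mult_distrib[OF Y] sum_distrib_left
    proof (rule sum.cong[OF refl])
      fix a assume "a \<in> {..i}"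
      then have "N * i = N * a + N * (i - a)" by (simp flip: add_mult_distrib2)
      then show "fps_X ^ (N * i) * ((xrow F a oo Y) * (xrow G (i - a) oo Y)) = ?T F a * ?T G (i - a)"
        by (simp add: power_add)
    qed
    then show "(\<Sum>a\<le>i. fps_nth (?T F a * ?T G (i - a)) k) = fps_nth (?T (F * G) i) k"
      by (simp add: fps_sum_nth)
  qed
  finally show "fps_nth (curve_eval N Y (F * G)) k = fps_nth (curve_eval N Y F * curve_eval N Y G) k"
    by (simp add: curve_eval_def)
qed

lemma xrow_const: "xrow (cps_const c) i = (if i = 0 then fps_const c else 0)"
  by (simp add: cps_const.rep_eq)

lemma curve_eval_const [simp]: "curve_eval N Y (cps_const c) = fps_const c"
proof (rule fps_ext)
  fix k
  have "fps_nth (curve_eval N Y (cps_const c)) k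
      = (\<Sum>i\<le>k. if i = 0 then fps_nth (fps_const c) k else 0)"
    unfolding curve_eval_def fps_nth_Abs_fps xrow_const by (intro sum.cong) auto
  then show "fps_nth (curve_eval N Y (cps_const c)) k = fps_nth (fps_const c) k" by simp
qed

lemma curve_eval_0 [simp]: "curve_eval N Y 0 = 0"
  using curve_eval_const[of N Y 0] by (simp add: cps_const_numeral_simps)

lemma curve_eval_1 [simp]: "curve_eval N Y 1 = 1"
  using curve_eval_const[of N Y 1] by (simp add: cps_const_numeral_simps)

lemma curve_eval_of_nat [simp]: "curve_eval N Y (of_nat n) = of_nat n"
  by (simp add: cps_of_nat fps_of_nat)

lemma curve_eval_uminus [simp]: "curve_eval N Y (- F) = - curve_eval N Y F"
  using curve_eval_add[of N Y F "- F"] by (simp add: eq_neg_iff_add_eq_0 add.commute)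

lemma curve_eval_diff: "curve_eval N Y (F - G) = curve_eval N Y F - curve_eval N Y G"
  using curve_eval_add[of N Y F "- G"] by simp

lemma curve_eval_X [simp]:
  assumes "0 < N" shows "curve_eval N Y cps_X = fps_X ^ N"
proof (rule fps_ext)
  fix k
  have "fps_nth (curve_eval N Y cps_X) k
      = fps_nth (\<Sum>i\<le>Suc k. fps_X ^ (N * i) * (xrow cps_X i oo Y)) k"
    by (rule curve_eval_nth) (use assms in auto)
  also have "(\<Sum>i\<le>Suc k. fps_X ^ (N * i) * (xrow cps_X i oo Y))
      = (\<Sum>i\<le>Suc k. if i = 1 then fps_X ^ N else 0)"
    by (intro sum.cong) (auto simp: cps_X.rep_eq)
  finally show "fps_nth (curve_eval N Y cps_X) k = fps_nth (fps_X ^ N) k" by simp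
qed

lemma curve_eval_Y [simp]:
  assumes "fps_nth Y 0 = 0" shows "curve_eval N Y cps_Y = Y"
proof (rule fps_ext)
  fix k
  have "fps_nth (curve_eval N Y cps_Y) k = (\<Sum>i\<le>k. if i = 0 then fps_nth Y k else 0)"
    unfolding curve_eval_def fps_nth_Abs_fps
    by (intro sum.cong) (auto simp: cps_Y.rep_eq assms)
  then show "fps_nth (curve_eval N Y cps_Y) k = fps_nth Y k" by simp
qed

lemma curve_eval_power:
  assumes "0 < N" "fps_nth Y 0 = 0"
  shows "curve_eval N Y (F ^ k) = curve_eval N Y F ^ k"
  by (induction k) (auto simp: curve_eval_mult[OF assms])

lemma curve_eval_prod:
  assumes "0 < N" "fps_nth Y 0 = 0"
  shows "curve_eval N Y (prod F A) = (\<Prod>x\<in>A. curve_eval N Y (F x))"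
  by (induction A rule: infinite_finite_induct) (auto simp: curve_eval_mult[OF assms])

lemma curve_eval_0_nth: "fps_nth (curve_eval N Y F) 0 = cps_coeff F 0 0"
  by (simp add: curve_eval_def xrow_nth)

text \<open>
  The chain rule along the curve, whose velocity is \<open>(N s\<^sup>N\<^sup>-\<^sup>1, Y')\<close>.
\<close>

lemma curve_eval_deriv:
  assumes N: "0 < N" and Y: "fps_nth Y 0 = 0"
  shows "fps_deriv (curve_eval N Y F) =
    curve_eval N Y (cps_dx F) * (of_nat N * fps_X ^ (N - 1)) + curve_eval N Y (cps_dy F) * fps_deriv Y"
proof (rule fps_ext)
  fix k
  let ?T = "\<lambda>F i. fps_X ^ (N * i) * (xrow F i oo Y)"
  have dy: "xrow (cps_dy F) i = fps_deriv (xrow F i)" for i by (simp add: cps_dy.rep_eq)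
  have dx: "xrow (cps_dx F) i = of_nat (Suc i) * xrow F (Suc i)" for i
    by (simp add: cps_dx.rep_eq)
  have of_nat_compose: "of_nat a oo Y = of_nat a" for a
    by (simp add: fps_of_nat[symmetric])
  have deriv_T: "fps_deriv (?T F i) =
      of_nat (N * i) * fps_X ^ (N * i - 1) * (xrow F i oo Y) + ?T (cps_dy F) i * fps_deriv Y" for i
    by (simp add: fps_deriv_power fps_compose_deriv[OF Y] dy fps_of_nat algebra_simps
        flip: of_nat_mult)
  have "fps_nth (fps_deriv (curve_eval N Y F)) k = of_nat (k + 1) * fps_nth (curve_eval N Y F) (k + 1)"
    by simp
  also have "\<dots> = fps_nth (fps_deriv (\<Sum>i\<le>Suc k. ?T F i)) k"
    by (simp only: curve_eval_nth[OF N, of "k + 1" "Suc k"] fps_deriv_nth)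
  also have "fps_deriv (\<Sum>i\<le>Suc k. ?T F i) =
      (\<Sum>i\<le>Suc k. of_nat (N * i) * fps_X ^ (N * i - 1) * (xrow F i oo Y))
      + (\<Sum>i\<le>Suc k. ?T (cps_dy F) i) * fps_deriv Y"
    by (simp only: fps_deriv_sum deriv_T sum.distrib sum_distrib_right)
  also have "(\<Sum>i\<le>Suc k. of_nat (N * i) * fps_X ^ (N * i - 1) * (xrow F i oo Y))
      = (\<Sum>i\<le>k. of_nat (N * Suc i) * fps_X ^ (N * Suc i - 1) * (xrow F (Suc i) oo Y))"
    by (subst sum.atMost_Suc_shift) simp
  also have "\<dots> = (\<Sum>i\<le>k. ?T (cps_dx F) i) * (of_nat N * fps_X ^ (N - 1))"
  proof -
    have "N * Suc i - 1 = N * i + (N - 1)" for i using N by simp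
    then show ?thesis
      unfolding dx fps_compose_mult_distrib[OF Y] of_nat_compose sum_distrib_right
      by (intro sum.cong) (simp_all only: power_add of_nat_mult mult_ac)
  qed
  finally show "fps_nth (fps_deriv (curve_eval N Y F)) k = fps_nth (curve_eval N Y (cps_dx F) *
      (of_nat N * fps_X ^ (N - 1)) + curve_eval N Y (cps_dy F) * fps_deriv Y) k"
    unfolding fps_add_nth
      curve_eval_mult_nth[OF N order_refl, of Y "cps_dx F"]
      curve_eval_mult_nth[OF N le_SucI[OF order_refl], of Y "cps_dy F"] .
qed

section \<open>The separatrix carried by a parametrized integral curve\<close>

definition convergent1 :: "complex fps \<Rightarrow> bool" where
  "convergent1 Y \<longleftrightarrow> (\<exists>r C. 0 < r \<and> (\<forall>k. norm (fps_nth Y k) \<le> C / r ^ k))"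

lemma convergent1E:
  assumes "convergent1 Y"
  obtains r C where "0 < r" "r \<le> 1" "1 \<le> C" "\<And>k. norm (fps_nth Y k) \<le> C / r ^ k"
proof -
  from assms obtain r C where r: "0 < r" and b: "\<And>k. norm (fps_nth Y k) \<le> C / r ^ k"
    by (auto simp: convergent1_def)
  have "norm (fps_nth Y k) \<le> max C 1 / min r 1 ^ k" for k
    by (rule order_trans[OF b]) (use r in \<open>intro frac_le power_mono, auto\<close>)
  then show thesis using r by (intro that[of "min r 1" "max C 1"]) auto
qed

lemma ex_root_of_unity:
  assumes "0 < N"
  obtains \<zeta> :: complex where "\<zeta> ^ N = 1" "norm \<zeta> = 1" "\<And>i. \<zeta> ^ i = 1 \<longleftrightarrow> N dvd i"
proof -
  define \<zeta> where "\<zeta> = exp (2 * of_real pi * \<i> * of_nat 1 / of_nat N)"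
  have *: "\<zeta> ^ i = exp (2 * of_real pi * \<i> * of_nat i / of_nat N)" for i
    by (simp add: \<zeta>_def exp_of_nat_mult[symmetric] field_simps)
  have "\<zeta> ^ i = 1 \<longleftrightarrow> N dvd i" for i
    unfolding * using assms by (subst complex_root_unity_eq_1) auto
  moreover from this have "\<zeta> ^ N = 1" by simp
  moreover have "norm \<zeta> = 1" by (simp add: \<zeta>_def norm_exp)
  ultimately show thesis using that by blast
qed

text \<open>
  The product of the conjugates \<open>y - Y(\<zeta>\<^sup>k s)\<close> over the \<open>N\<close>-th roots of unity is invariant under
  \<open>s \<mapsto> \<zeta> s\<close>, hence a series in \<open>s\<^sup>N\<close> and \<open>y\<close>.
\<close>

lemma curve_has_equation:
  assumes N: "0 < N" and Y: "fps_nth Y 0 = 0" and "convergent1 Y"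
  obtains G where "G \<noteq> 0" "curve_eval N Y G = 0"
proof -
  obtain r C where r: "0 < r" "r \<le> 1" "1 \<le> C" and b: "\<And>k. norm (fps_nth Y k) \<le> C / r ^ k"
    using convergent1E[OF \<open>convergent1 Y\<close>] by blast
  obtain \<zeta> :: complex where \<zeta>: "\<zeta> ^ N = 1" "norm \<zeta> = 1" "\<And>i. \<zeta> ^ i = 1 \<longleftrightarrow> N dvd i"
    using ex_root_of_unity[OF N] by blast
  have "\<exists>L. \<forall>i j. cps_coeff L i j = (if j = 0 then (\<zeta> ^ k) ^ i * fps_nth Y i else 0)" for k
  proof -
    have "norm (if j = 0 then (\<zeta> ^ k) ^ i * fps_nth Y i else 0) \<le> C / r ^ (i + j)" for i j
      using b[of i] \<zeta>(2) r by (simp add: norm_mult norm_power)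
    with r(1) show ?thesis by (rule cps_of_coeffs) blast
  qed
  then obtain L where L: "\<And>k i j. cps_coeff (L k) i j = (if j = 0 then (\<zeta> ^ k) ^ i * fps_nth Y i else 0)"
    by metis
  define B where "B = (\<lambda>k. cps_Y - L k)"
  define P where "P = (\<Prod>k<N. B k)"
  have B: "cps_coeff (B (Suc k)) i j = \<zeta> ^ i * cps_coeff (B k) i j" for k i j
    by (auto simp: B_def L cps_coeff_Y power_mult_distrib)
  have B_nz: "B k \<noteq> 0" for k
  proof
    assume "B k = 0"
    then have "cps_coeff (B k) 0 1 = 0" by simp
    then show False by (simp add: B_def L cps_coeff_Y)
  qed
  \<comment> \<open>The substitution \<open>s \<mapsto> \<zeta> s\<close> multiplies the coefficient of \<open>s\<^sup>i\<close> by \<open>\<zeta>\<^sup>i\<close> and permutes the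
      factors cyclically.\<close>
  have twist: "cps_coeff (\<Prod>k<M. B (Suc k)) i j = \<zeta> ^ i * cps_coeff (\<Prod>k<M. B k) i j" for M i j
  proof (induction M arbitrary: i j)
    case 0
    then show ?case by (simp add: cps_coeff_1)
  next
    case (Suc M)
    have "cps_coeff (\<Prod>k<Suc M. B (Suc k)) i j =
        (\<Sum>k\<le>i. \<Sum>l\<le>j. (\<zeta> ^ k * cps_coeff (\<Prod>k<M. B k) k l) * (\<zeta> ^ (i - k) * cps_coeff (B M) (i - k) (j - l)))"
      unfolding prod.lessThan_Suc cps_coeff_mult Suc B ..
    also have "\<dots> = (\<Sum>k\<le>i. \<Sum>l\<le>j. \<zeta> ^ i * (cps_coeff (\<Prod>k<M. B k) k l * cps_coeff (B M) (i - k) (j - l)))"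
    proof (intro sum.cong refl)
      fix k l assume "k \<in> {..i}"
      then have "\<zeta> ^ i = \<zeta> ^ k * \<zeta> ^ (i - k)" by (simp flip: power_add)
      then show "(\<zeta> ^ k * cps_coeff (\<Prod>k<M. B k) k l) * (\<zeta> ^ (i - k) * cps_coeff (B M) (i - k) (j - l))
          = \<zeta> ^ i * (cps_coeff (\<Prod>k<M. B k) k l * cps_coeff (B M) (i - k) (j - l))" by simp
    qed
    finally show ?case by (simp add: cps_coeff_mult sum_distrib_left)
  qed
  have "B N = B 0"
    by (rule cps_eqI) (simp add: B_def L \<zeta>(1))
  then have "B 0 * (\<Prod>k<N. B (Suc k)) = B 0 * P"
    unfolding P_def by (simp only: prod.lessThan_Suc_shift[symmetric] prod.lessThan_Suc) (simp add: mult.commute)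
  then have "(\<Prod>k<N. B (Suc k)) = P" using B_nz[of 0] by simp
  then have "cps_coeff P i j = \<zeta> ^ i * cps_coeff P i j" for i j
    using twist[of N i j] by (simp add: P_def)
  then have P_nz: "cps_coeff P i j = 0" if "\<not> N dvd i" for i j
    using that \<zeta>(3)[of i] by (metis mult_cancel_right2)
  have eval_P: "curve_eval 1 Y P = 0"
  proof -
    have "curve_eval 1 Y (L 0) = Y"
    proof (rule fps_ext)
      fix k
      have "xrow (L 0) i = fps_const (fps_nth Y i)" for i
        by (rule fps_ext) (auto simp: xrow_nth L)
      then have "fps_nth (curve_eval 1 Y (L 0)) k = (\<Sum>i\<le>k. if i = k then fps_nth Y k else 0)"
        unfolding curve_eval_def fps_nth_Abs_fps
        by (intro sum.cong) (auto simp: fps_X_power_mult_nth)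
      then show "fps_nth (curve_eval 1 Y (L 0)) k = fps_nth Y k" by simp
    qed
    then have "curve_eval 1 Y (B 0) = 0" by (simp add: B_def curve_eval_diff Y)
    then show ?thesis unfolding P_def using N Y by (subst curve_eval_prod) auto
  qed
  obtain r' C' where r': "0 < r'" "r' \<le> 1" "1 \<le> C'"
    and b': "\<And>i j. norm (cps_coeff P i j) \<le> C' / r' ^ (i + j)" by (rule cps_boundE) blast
  have bG: "norm (cps_coeff P (N * i) j) \<le> C' / (r' ^ N) ^ (i + j)" for i j
  proof -
    have "j \<le> N * j" using N by simp
    then have "C' / r' ^ (N * i + j) \<le> C' / r' ^ (N * (i + j))"
      unfolding add_mult_distrib2 using r' by (intro divide_left_mono power_decreasing add_left_mono) auto
    then show ?thesis using b'[of "N * i" j] by (simp add: power_mult)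
  qed
  have "0 < r' ^ N" using r' by simp
  then obtain G where G: "\<And>i j. cps_coeff G i j = cps_coeff P (N * i) j"
    using cps_of_coeffs[of "r' ^ N" "\<lambda>i j. cps_coeff P (N * i) j" C', OF _ bG] by metis
  have "P \<noteq> 0" unfolding P_def using B_nz by simp
  then obtain i j where "cps_coeff P i j \<noteq> 0" using cps_eqI[of P 0] by auto
  moreover from this obtain i' where "i = N * i'" using P_nz[of i j] by (auto simp: dvd_def)
  ultimately have "G \<noteq> 0" using G by force
  moreover have "curve_eval N Y G = 0"
  proof (rule fps_ext)
    fix k
    have row_G: "xrow G i = xrow P (N * i)" for i by (rule fps_ext) (simp add: xrow_nth G)
    have row_P: "xrow P i = 0" if "\<not> N dvd i" for i
      by (rule fps_ext) (simp add: xrow_nth P_nz[OF that])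
    have "fps_nth (curve_eval N Y G) k = fps_nth (\<Sum>i\<le>k. fps_X ^ (N * i) * (xrow P (N * i) oo Y)) k"
      by (simp only: curve_eval_nth[OF N order_refl] row_G)
    also have "(\<Sum>i\<le>k. fps_X ^ (N * i) * (xrow P (N * i) oo Y))
        = (\<Sum>i\<in>(*) N ` {..k}. fps_X ^ i * (xrow P i oo Y))"
      using N by (subst sum.reindex) (auto simp: inj_on_def)
    also have "\<dots> = (\<Sum>i\<le>N * k. fps_X ^ (1 * i) * (xrow P i oo Y))"
    proof (rule sum.mono_neutral_cong_left)
      show "\<forall>i\<in>{..N * k} - (*) N ` {..k}. fps_X ^ (1 * i) * (xrow P i oo Y) = 0"
      proof
        fix i assume i: "i \<in> {..N * k} - (*) N ` {..k}"
        have "\<not> N dvd i"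
        proof
          assume "N dvd i"
          then obtain i' where "i = N * i'" by (auto simp: dvd_def)
          with i N show False by auto
        qed
        then show "fps_X ^ (1 * i) * (xrow P i oo Y) = 0" by (simp add: row_P)
      qed
    qed auto
    also have "fps_nth \<dots> k = fps_nth (curve_eval 1 Y P) k"
      using N by (subst curve_eval_nth[of 1 k "N * k"]) auto
    finally show "fps_nth (curve_eval N Y G) k = fps_nth 0 k" by (simp only: eval_P)
  qed
  ultimately show thesis using that by blast
qed

text \<open>
  Among the series that vanish on the curve, one for which the order of \<open>g(0, y)\<close> is minimal
  divides all others: the remainder of a Weierstrass division by \<open>g\<close>, freed from powers of \<open>x\<close>,
  would have smaller order.
\<close>

lemma curve_ideal_principal:
  assumes N: "0 < N" and Y: "fps_nth Y 0 = 0" and conv: "convergent1 Y"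
  obtains g where "g \<noteq> 0" "\<And>F. curve_eval N Y F = 0 \<longleftrightarrow> g dvd F"
proof -
  \<comment> \<open>As \<open>x\<close> is not identically zero on the curve, the largest power of \<open>x\<close> in \<open>G\<close> can be cancelled.\<close>
  have reduce: "\<exists>F i j. curve_eval N Y F = 0 \<and> cps_coeff F 0 j \<noteq> 0 \<and> cps_coeff G i j \<noteq> 0"
    if G: "G \<noteq> 0" "curve_eval N Y G = 0" for G
  proof -
    have "\<exists>i j. cps_coeff G i j \<noteq> 0" using G(1) cps_eqI[of G 0] by auto
    define k where "k = (LEAST i. \<exists>j. cps_coeff G i j \<noteq> 0)"
    have k: "\<exists>j. cps_coeff G k j \<noteq> 0"
      unfolding k_def by (rule LeastI_ex) fact
    then obtain j where j: "cps_coeff G k j \<noteq> 0" by blast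
    have below: "cps_coeff G i j = 0" if "i < k" for i j
      using not_less_Least[of i "\<lambda>i. \<exists>j. cps_coeff G i j \<noteq> 0"] that by (auto simp: k_def)
    obtain F where F: "G = cps_X ^ k * F" "\<And>i j. cps_coeff F i j = cps_coeff G (i + k) j"
      using cps_X_power_factor[of k G, OF below] by metis
    have "fps_X ^ (N * k) * curve_eval N Y F = 0"
      using G(2) N by (simp add: F(1) curve_eval_mult[OF N Y] curve_eval_power[OF N Y] power_mult)
    then have "curve_eval N Y F = 0" by simp
    then show ?thesis using j F(2)[of 0 j] by (metis add_0)
  qed
  define Q where "Q = (\<lambda>M. \<exists>F. curve_eval N Y F = 0 \<and> cps_coeff F 0 M \<noteq> 0)"
  obtain G where "G \<noteq> 0" "curve_eval N Y G = 0" by (rule curve_has_equation[OF assms])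
  then have "\<exists>M. Q M" using reduce unfolding Q_def by blast
  define M where "M = (LEAST M. Q M)"
  have "Q M" unfolding M_def by (rule LeastI_ex) fact
  then obtain g where g: "curve_eval N Y g = 0" "cps_coeff g 0 M \<noteq> 0" by (auto simp: Q_def)
  have least: "\<not> Q j" if "j < M" for j using that not_less_Least by (auto simp: M_def)
  have g0: "cps_coeff g 0 j = 0" if "j < M" for j using least[OF that] g(1) by (auto simp: Q_def)
  have dvd: "g dvd h" if h: "curve_eval N Y h = 0" for h
  proof -
    obtain q r where qr: "h = q * g + r" "\<And>i j. M \<le> j \<Longrightarrow> cps_coeff r i j = 0"
      using weierstrass_division[of M g h] g0 g(2) by blast
    have "curve_eval N Y r = 0"
      using h g(1) by (simp add: qr(1) curve_eval_add curve_eval_mult[OF N Y])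
    have "r = 0"
    proof (rule ccontr)
      assume "r \<noteq> 0"
      then obtain F i j where "curve_eval N Y F = 0" "cps_coeff F 0 j \<noteq> 0" "cps_coeff r i j \<noteq> 0"
        using reduce \<open>curve_eval N Y r = 0\<close> by blast
      then have "Q j" "j < M" using qr(2) by (auto simp: Q_def not_le[symmetric])
      then show False using least by blast
    qed
    then show ?thesis by (simp add: qr(1))
  qed
  have eval0: "curve_eval N Y F = 0" if "g dvd F" for F
    using that g(1) by (auto simp: dvd_def curve_eval_mult[OF N Y])
  have "g \<noteq> 0" using g(2) by auto
  then show thesis by (rule that) (rule iffI[OF dvd eval0])
qed

text \<open>
  If the curve is tangent to the kernel of \<open>W\<close>, both \<open>W\<close> and \<open>dg\<close> annihilate its velocity
  \<open>(N s\<^sup>N\<^sup>-\<^sup>1, Y')\<close>, so \<open>W \<and> dg\<close> vanishes along it.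
\<close>

theorem separatrix_of_integral_curve:
  assumes N: "0 < N" and Y: "fps_nth Y 0 = 0" and conv: "convergent1 Y"
    and tangent: "curve_eval N Y (fst W) * (of_nat N * fps_X ^ (N - 1))
      + curve_eval N Y (snd W) * fps_deriv Y = 0"
  obtains g where "irreducible g" "g dvd wedge W (form_d g)" "curve_eval N Y g = 0"
proof -
  obtain g where g: "g \<noteq> 0" "\<And>F. curve_eval N Y F = 0 \<longleftrightarrow> g dvd F"
    using curve_ideal_principal[OF N Y conv] by blast
  have "\<not> g dvd 1" using g(2)[of 1] by simp
  moreover have "g dvd a \<or> g dvd b" if "g dvd a * b" for a b
    using that by (simp add: g(2)[symmetric] curve_eval_mult[OF N Y])
  ultimately have "irreducible g"
  proof (intro irreducibleI)
    fix a b assume *: "\<And>a b. g dvd a * b \<Longrightarrow> g dvd a \<or> g dvd b" and ab: "g = a * b"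
    have "a * b dvd a \<or> a * b dvd b" using *[of a b] by (simp add: ab)
    moreover have "a * b dvd a * 1 \<longleftrightarrow> b dvd 1" "a * b dvd 1 * b \<longleftrightarrow> a dvd 1"
      using g(1) ab by (simp_all only: dvd_mult_cancel_left dvd_mult_cancel_right) auto
    ultimately show "a dvd 1 \<or> b dvd 1" using g(1) ab by auto
  qed (use g(1) in auto)
  moreover have g0: "curve_eval N Y g = 0" by (simp add: g(2))
  moreover have "curve_eval N Y (wedge W (form_d g)) = 0"
  proof -
    let ?e = "curve_eval N Y"
    define v where "v = (of_nat N * fps_X ^ (N - 1) :: complex fps)"
    have v: "v \<noteq> 0" using N by (simp add: v_def)
    have "?e (cps_dx g) * v + ?e (cps_dy g) * fps_deriv Y = 0"
      using curve_eval_deriv[OF N Y, of g] g0 by (simp add: v_def)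
    moreover have "?e (fst W) * v + ?e (snd W) * fps_deriv Y = 0"
      using tangent by (simp add: v_def)
    ultimately have "v * (?e (fst W) * ?e (cps_dy g) - ?e (snd W) * ?e (cps_dx g)) = 0"
      by algebra
    then show ?thesis
      using v by (simp add: wedge_def form_d_def curve_eval_diff curve_eval_mult[OF N Y])
  qed
  ultimately show thesis using that g(2) by blast
qed

section \<open>Analytic differential equations\<close>

text \<open>
  The sum of absolute values of the terms up to degree \<open>k\<close> is submultiplicative, and bounds on it
  can be proved by induction on \<open>k\<close>; a bound independent of \<open>k\<close> means convergence.
\<close>

definition trunc_norm :: "real \<Rightarrow> nat \<Rightarrow> complex fps \<Rightarrow> real" where
  "trunc_norm \<rho> k F = (\<Sum>l\<le>k. norm (fps_nth F l) * \<rho> ^ l)"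

lemma trunc_norm_nonneg: "0 \<le> \<rho> \<Longrightarrow> 0 \<le> trunc_norm \<rho> k F"
  by (simp add: trunc_norm_def sum_nonneg)

lemma trunc_norm_mult:
  assumes "0 \<le> \<rho>"
  shows "trunc_norm \<rho> k (F * G) \<le> trunc_norm \<rho> k F * trunc_norm \<rho> k G"
proof -
  let ?f = "\<lambda>a b. (norm (fps_nth F a) * \<rho> ^ a) * (norm (fps_nth G b) * \<rho> ^ b)"
  have "trunc_norm \<rho> k (F * G) \<le> (\<Sum>l\<le>k. \<Sum>a\<le>l. ?f a (l - a))"
    unfolding trunc_norm_def
  proof (rule sum_mono)
    fix l
    have "norm (fps_nth (F * G) l) \<le> (\<Sum>a\<le>l. norm (fps_nth F a) * norm (fps_nth G (l - a)))"
      unfolding fps_mult_nth atLeast0AtMost by (rule sum_norm_le) (simp add: norm_mult)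
    then have "norm (fps_nth (F * G) l) * \<rho> ^ l
        \<le> (\<Sum>a\<le>l. norm (fps_nth F a) * norm (fps_nth G (l - a))) * \<rho> ^ l"
      using assms by (intro mult_right_mono) auto
    also have "\<dots> = (\<Sum>a\<le>l. ?f a (l - a))"
      unfolding sum_distrib_right
    proof (rule sum.cong[OF refl])
      fix a assume "a \<in> {..l}"
      then have "\<rho> ^ l = \<rho> ^ a * \<rho> ^ (l - a)" by (simp flip: power_add)
      then show "norm (fps_nth F a) * norm (fps_nth G (l - a)) * \<rho> ^ l = ?f a (l - a)" by simp
    qed
    finally show "norm (fps_nth (F * G) l) * \<rho> ^ l \<le> (\<Sum>a\<le>l. ?f a (l - a))" .
  qed
  also have "\<dots> = (\<Sum>(a, b)\<in>{(a, b). a + b \<le> k}. ?f a b)"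
    by (rule sum.triangle_reindex_eq[symmetric])
  also have "\<dots> \<le> (\<Sum>(a, b)\<in>{..k} \<times> {..k}. ?f a b)"
    by (rule sum_mono2) (use assms in auto)
  also have "\<dots> = trunc_norm \<rho> k F * trunc_norm \<rho> k G"
    by (simp add: trunc_norm_def sum_product sum.cartesian_product)
  finally show ?thesis .
qed

lemma trunc_norm_power:
  assumes "0 \<le> \<rho>"
  shows "trunc_norm \<rho> k (F ^ j) \<le> trunc_norm \<rho> k F ^ j"
proof (induction j)
  case 0
  have "trunc_norm \<rho> k 1 = (\<Sum>l\<le>k. if l = 0 then 1 else 0)"
    unfolding trunc_norm_def by (intro sum.cong) auto
  then show ?case by simp
next
  case (Suc j)
  have "trunc_norm \<rho> k (F ^ Suc j) \<le> trunc_norm \<rho> k F * trunc_norm \<rho> k (F ^ j)"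
    unfolding power_Suc by (rule trunc_norm_mult[OF assms])
  also have "\<dots> \<le> trunc_norm \<rho> k F * trunc_norm \<rho> k F ^ j"
    by (intro mult_left_mono Suc trunc_norm_nonneg assms)
  finally show ?case by simp
qed

lemma fps_compose_nth':
  assumes "fps_nth z 0 = 0" "l \<le> k"
  shows "fps_nth (F oo z) l = (\<Sum>j\<le>k. fps_nth F j * fps_nth (z ^ j) l)"
proof -
  have "(\<Sum>j\<le>k. fps_nth F j * fps_nth (z ^ j) l) = (\<Sum>j\<le>l. fps_nth F j * fps_nth (z ^ j) l)"
    by (rule sum.mono_neutral_right)
      (use assms startsby_zero_power_prefix[OF assms(1)] in \<open>auto simp: not_le\<close>)
  then show ?thesis by (simp add: fps_compose_nth atLeast0AtMost)
qed

lemma curve_eval_1_nth: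
  assumes "fps_nth z 0 = 0"
  shows "fps_nth (curve_eval 1 z K) l =
    (\<Sum>i\<le>l. \<Sum>j\<le>l. cps_coeff K i j * fps_nth (z ^ j) (l - i))"
proof -
  have "fps_nth (curve_eval 1 z K) l = (\<Sum>i\<le>l. fps_nth (xrow K i oo z) (l - i))"
    unfolding curve_eval_def fps_nth_Abs_fps
    by (intro sum.cong) (auto simp: fps_X_power_mult_nth)
  also have "\<dots> = (\<Sum>i\<le>l. \<Sum>j\<le>l. cps_coeff K i j * fps_nth (z ^ j) (l - i))"
    by (intro sum.cong refl, subst fps_compose_nth'[OF assms, where k = l]) (auto simp: xrow_nth)
  finally show ?thesis .
qed

lemma fps_power_nth_cong:
  assumes "\<And>l. l \<le> k \<Longrightarrow> fps_nth z l = fps_nth z' l" "l \<le> k"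
  shows "fps_nth (z ^ j) l = fps_nth (z' ^ j) l"
  using assms(2)
proof (induction j arbitrary: l)
  case (Suc j)
  then show ?case by (simp add: fps_mult_nth assms(1))
qed simp

lemma curve_eval_1_cong:
  assumes "fps_nth z 0 = 0" "fps_nth z' 0 = 0" "\<And>l. l \<le> k \<Longrightarrow> fps_nth z l = fps_nth z' l"
  shows "fps_nth (curve_eval 1 z K) k = fps_nth (curve_eval 1 z' K) k"
  unfolding curve_eval_1_nth[OF assms(1)] curve_eval_1_nth[OF assms(2)]
  by (intro sum.cong refl arg_cong2[where f = "(*)"] fps_power_nth_cong[OF assms(3)]) auto

lemma geometric_sum_le:
  fixes t :: real assumes "0 \<le> t" "t \<le> r / 2" "0 < r"
  shows "(\<Sum>i\<le>k. t ^ i / r ^ i) \<le> 2"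
proof -
  have "(\<Sum>i\<le>k. t ^ i / r ^ i) \<le> (\<Sum>i\<le>k. (1 / 2) ^ i)"
    unfolding power_divide[symmetric]
    by (intro sum_mono power_mono) (use assms in \<open>auto simp: field_simps\<close>)
  also have "\<dots> \<le> 2" by (rule half_power_sum_le)
  finally show ?thesis .
qed

text \<open>
  The constant 4 bounds the product of the geometric series in \<open>\<rho> / r\<close> and \<open>|z| / r\<close>, both ratios
  being at most \<open>1 / 2\<close>.
\<close>

lemma trunc_norm_curve_eval:
  assumes z: "fps_nth z 0 = 0" and r: "0 < r" "0 \<le> C" and \<rho>: "0 \<le> \<rho>" "\<rho> \<le> r / 2"
    and K: "\<And>i j. norm (cps_coeff K i j) \<le> C / r ^ (i + j)"
    and zn: "trunc_norm \<rho> k z \<le> r / 2"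
  shows "trunc_norm \<rho> k (curve_eval 1 z K) \<le> 4 * C"
proof -
  let ?t = "trunc_norm \<rho> k z"
  let ?p = "\<lambda>j l. norm (fps_nth (z ^ j) l)"
  have bound: "norm (fps_nth (curve_eval 1 z K) l) * \<rho> ^ l \<le> (\<Sum>i\<le>k. \<Sum>j\<le>k.
      norm (cps_coeff K i j) * (if i \<le> l then ?p j (l - i) * \<rho> ^ l else 0))" if "l \<le> k" for l
  proof -
    have "norm (fps_nth (curve_eval 1 z K) l) \<le>
        (\<Sum>i\<le>l. \<Sum>j\<le>l. norm (cps_coeff K i j) * ?p j (l - i))"
      unfolding curve_eval_1_nth[OF z] by (intro sum_norm_le) (simp add: norm_mult)
    then have "norm (fps_nth (curve_eval 1 z K) l) * \<rho> ^ l \<le>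
        (\<Sum>i\<le>l. \<Sum>j\<le>l. norm (cps_coeff K i j) * ?p j (l - i)) * \<rho> ^ l"
      using \<rho> by (intro mult_right_mono) auto
    also have "\<dots> = (\<Sum>i\<le>l. \<Sum>j\<le>l. norm (cps_coeff K i j) * (if i \<le> l then ?p j (l - i) * \<rho> ^ l else 0))"
      unfolding sum_distrib_right by (intro sum.cong refl) simp
    also have "\<dots> \<le> (\<Sum>i\<le>l. \<Sum>j\<le>k. norm (cps_coeff K i j) * (if i \<le> l then ?p j (l - i) * \<rho> ^ l else 0))"
      using that \<rho> by (intro sum_mono sum_mono2) auto
    also have "\<dots> \<le> (\<Sum>i\<le>k. \<Sum>j\<le>k. norm (cps_coeff K i j) * (if i \<le> l then ?p j (l - i) * \<rho> ^ l else 0))"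
      using that \<rho> by (intro sum_mono2 sum_nonneg) auto
    finally show ?thesis .
  qed
  have inner: "(\<Sum>l\<le>k. if i \<le> l then ?p j (l - i) * \<rho> ^ l else 0) \<le> \<rho> ^ i * ?t ^ j" for i j
  proof -
    have "(\<Sum>l\<le>k. if i \<le> l then ?p j (l - i) * \<rho> ^ l else 0)
        = (\<Sum>l\<in>{i..k}. ?p j (l - i) * \<rho> ^ l)"
      by (simp add: sum.If_cases) (intro sum.cong, auto)
    also have "\<dots> = (\<Sum>l\<in>{l. l + i \<le> k}. ?p j l * \<rho> ^ (l + i))"
      by (rule sum.reindex_bij_witness[of _ "\<lambda>l. l + i" "\<lambda>l. l - i"]) auto
    also have "\<dots> \<le> (\<Sum>l\<le>k. ?p j l * \<rho> ^ (l + i))"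
      using \<rho> by (intro sum_mono2) auto
    also have "\<dots> = \<rho> ^ i * trunc_norm \<rho> k (z ^ j)"
      unfolding trunc_norm_def sum_distrib_left by (intro sum.cong) (simp_all add: power_add)
    also have "\<dots> \<le> \<rho> ^ i * ?t ^ j" using \<rho> by (intro mult_left_mono trunc_norm_power) auto
    finally show ?thesis .
  qed
  have t0: "0 \<le> ?t" by (rule trunc_norm_nonneg) (rule \<rho>)
  have "trunc_norm \<rho> k (curve_eval 1 z K) \<le> (\<Sum>l\<le>k. \<Sum>i\<le>k. \<Sum>j\<le>k.
      norm (cps_coeff K i j) * (if i \<le> l then ?p j (l - i) * \<rho> ^ l else 0))"
    unfolding trunc_norm_def by (intro sum_mono bound) auto
  also have "\<dots> = (\<Sum>i\<le>k. \<Sum>j\<le>k. \<Sum>l\<le>k.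
      norm (cps_coeff K i j) * (if i \<le> l then ?p j (l - i) * \<rho> ^ l else 0))"
    by (subst sum.swap, rule sum.cong[OF refl], rule sum.swap)
  also have "\<dots> \<le> (\<Sum>i\<le>k. \<Sum>j\<le>k. C / r ^ (i + j) * (\<rho> ^ i * ?t ^ j))"
    unfolding sum_distrib_left[symmetric]
    using \<rho> r t0 by (intro sum_mono mult_mono K inner sum_nonneg) auto
  also have "\<dots> = C * ((\<Sum>i\<le>k. \<rho> ^ i / r ^ i) * (\<Sum>j\<le>k. ?t ^ j / r ^ j))"
    by (subst sum_product, unfold sum_distrib_left)
      (intro sum.cong refl, simp add: power_add)
  also have "\<dots> \<le> C * (2 * 2)"
    using r \<rho> t0 zn by (intro mult_left_mono mult_mono geometric_sum_le sum_nonneg) auto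
  finally show ?thesis by simp
qed

text \<open>
  The coefficients of the solution are determined recursively, and if the first \<open>k\<close> terms
  have norm at most \<open>r / 2\<close> then \<open>K(s, z)\<close> has norm at most \<open>4 C\<close> up to degree \<open>k\<close>, so that by
  integration the first \<open>k + 1\<close> terms have norm at most \<open>4 C \<rho>\<close>.
\<close>

theorem analytic_ode_solution:
  obtains z where "fps_nth z 0 = 0" "convergent1 z" "fps_deriv z = curve_eval 1 z K"
proof -
  \<comment> \<open>Picard iteration: each application of \<open>T\<close> makes one more coefficient final.\<close>
  define T where "T = (\<lambda>z. Abs_fps (\<lambda>k. if k = 0 then 0 else fps_nth (curve_eval 1 z K) (k - 1) / of_nat k))"
  define Z where "Z = (\<lambda>n. (T ^^ n) 0)"
  define z where "z = Abs_fps (\<lambda>k. fps_nth (Z k) k)"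
  have T0: "fps_nth (T y) 0 = 0" for y by (simp add: T_def)
  have Z_Suc: "Z (Suc n) = T (Z n)" for n by (simp add: Z_def)
  have Z0: "fps_nth (Z n) 0 = 0" for n by (cases n) (simp_all add: Z_Suc T0 Z_def)
  have T_cong: "fps_nth (T y) k = fps_nth (T y') k"
    if "fps_nth y 0 = 0" "fps_nth y' 0 = 0" "\<And>l. l < k \<Longrightarrow> fps_nth y l = fps_nth y' l" for y y' k
    using curve_eval_1_cong[of y y' "k - 1" K] that by (cases k) (auto simp: T_def)
  have step: "fps_nth (Z (Suc n)) l = fps_nth (Z n) l" if "l \<le> n" for l n
    using that
  proof (induction n arbitrary: l)
    case 0
    then show ?case by (simp add: Z0)
  next
    case (Suc n)
    have "fps_nth (T (Z (Suc n))) l = fps_nth (T (Z n)) l"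
      by (rule T_cong) (use Suc Z0 in auto)
    then show ?case by (simp only: Z_Suc)
  qed
  have agree: "fps_nth (Z (l + n)) l = fps_nth z l" for l n
    by (induction n) (simp_all add: z_def step)
  have z0: "fps_nth z 0 = 0" by (simp add: z_def Z0)
  have fix_z: "fps_nth (T z) k = fps_nth z k" for k
  proof -
    have "fps_nth (T z) k = fps_nth (T (Z k)) k"
    proof (rule T_cong)
      fix l assume "l < k"
      then show "fps_nth z l = fps_nth (Z k) l" using agree[of l "k - l"] by simp
    qed (use z0 Z0 in auto)
    then show ?thesis using agree[of k 1] by (simp add: Z_Suc)
  qed
  have z_Suc: "fps_nth z (Suc k) = fps_nth (curve_eval 1 z K) k / of_nat (Suc k)" for k
    unfolding fix_z[of "Suc k", symmetric] by (simp add: T_def)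
  have "fps_deriv z = curve_eval 1 z K"
    by (rule fps_ext) (simp add: z_Suc del: of_nat_Suc)
  moreover have "convergent1 z"
  proof -
    obtain r C where r: "0 < r" "r \<le> 1" "1 \<le> C"
      and b: "\<And>i j. norm (cps_coeff K i j) \<le> C / r ^ (i + j)" by (rule cps_boundE) blast
    \<comment> \<open>Chosen so that \<open>4 C \<rho> = r / 2\<close>, the radius on which the bound for \<open>K(s, z)\<close> applies.\<close>
    define \<rho> where "\<rho> = r / (8 * C)"
    have \<rho>: "0 < \<rho>" "\<rho> \<le> r / 2" "\<rho> * (4 * C) = r / 2"
      using r by (auto simp: \<rho>_def field_simps)
    have small: "trunc_norm \<rho> k z \<le> r / 2" for k
    proof (induction k)
      case 0
      then show ?case using r by (simp add: trunc_norm_def z0)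
    next
      case (Suc k)
      have "trunc_norm \<rho> (Suc k) z = (\<Sum>l\<le>k. norm (fps_nth z (Suc l)) * \<rho> ^ Suc l)"
        unfolding trunc_norm_def by (subst sum.atMost_Suc_shift) (simp add: z0)
      also have "\<dots> \<le> (\<Sum>l\<le>k. \<rho> * (norm (fps_nth (curve_eval 1 z K) l) * \<rho> ^ l))"
      proof (rule sum_mono)
        fix l
        have "norm (fps_nth z (Suc l)) \<le> norm (fps_nth (curve_eval 1 z K) l)"
          using divide_left_mono[of 1 "real (Suc l)" "norm (fps_nth (curve_eval 1 z K) l)"]
          by (simp add: z_Suc norm_divide del: of_nat_Suc)
        then show "norm (fps_nth z (Suc l)) * \<rho> ^ Suc l
            \<le> \<rho> * (norm (fps_nth (curve_eval 1 z K) l) * \<rho> ^ l)"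
          using \<rho> by (simp add: mult_right_mono)
      qed
      also have "\<dots> = \<rho> * trunc_norm \<rho> k (curve_eval 1 z K)"
        by (simp add: trunc_norm_def sum_distrib_left)
      also have "\<dots> \<le> \<rho> * (4 * C)"
        by (intro mult_left_mono trunc_norm_curve_eval[OF z0 r(1) _ _ _ b] Suc) (use \<rho> r in auto)
      finally show ?case using \<rho> by simp
    qed
    have "norm (fps_nth z k) \<le> (r / 2) / \<rho> ^ k" for k
    proof -
      have "norm (fps_nth z k) * \<rho> ^ k \<le> trunc_norm \<rho> k z"
        unfolding trunc_norm_def by (rule member_le_sum) (use \<rho> in auto)
      then have "norm (fps_nth z k) * \<rho> ^ k \<le> r / 2" using small[of k] by linarith
      then show ?thesis using \<rho> by (simp add: pos_le_divide_eq)
    qed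
    then show ?thesis unfolding convergent1_def using \<rho>(1) by blast
  qed
  ultimately show thesis using z0 that by blast
qed

section \<open>Substitution of a quasi-homogeneous chart\<close>

text \<open>
  Half of the radius is given up to sum the geometric series that occur in a product; this costs a
  factor 4 in each step.
\<close>

lemma cps_power_bound:
  assumes r: "0 < r" "1 \<le> C" and U: "\<And>i j. norm (cps_coeff U i j) \<le> C / r ^ (i + j)"
  shows "norm (cps_coeff (U ^ n) a b) \<le> (4 * C) ^ n / (r / 2) ^ (a + b)"
proof (induction n arbitrary: a b)
  case 0
  then show ?case using r by (auto simp: cps_coeff_1)
next
  case (Suc n)
  let ?\<rho> = "r / 2"
  have "norm (cps_coeff (U ^ Suc n) a b) \<le>
      (\<Sum>k\<le>a. \<Sum>l\<le>b. norm (cps_coeff U k l) * norm (cps_coeff (U ^ n) (a - k) (b - l)))"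
    unfolding power_Suc cps_coeff_mult by (intro sum_norm_le) (simp add: norm_mult)
  also have "\<dots> \<le> (\<Sum>k\<le>a. \<Sum>l\<le>b. (4 * C) ^ n * C / ?\<rho> ^ (a + b) * ((1 / 2) ^ k * (1 / 2) ^ l))"
  proof (intro sum_mono)
    fix k l assume kl: "k \<in> {..a}" "l \<in> {..b}"
    have "norm (cps_coeff U k l) * norm (cps_coeff (U ^ n) (a - k) (b - l))
        \<le> (C / r ^ (k + l)) * ((4 * C) ^ n / ?\<rho> ^ ((a - k) + (b - l)))"
      using r by (intro mult_mono U Suc) auto
    also have "C / r ^ (k + l) = C / ?\<rho> ^ (k + l) * ((1 / 2) ^ k * (1 / 2) ^ l)"
      by (simp add: power_divide power_add)
    also have "C / ?\<rho> ^ (k + l) * ((1 / 2) ^ k * (1 / 2) ^ l) * ((4 * C) ^ n / ?\<rho> ^ ((a - k) + (b - l)))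
        = (4 * C) ^ n * C / ?\<rho> ^ ((k + l) + ((a - k) + (b - l))) * ((1 / 2) ^ k * (1 / 2) ^ l)"
      by (simp only: power_add times_divide_eq_left times_divide_eq_right divide_divide_eq_left mult_ac)
    also have "(k + l) + ((a - k) + (b - l)) = a + b" using kl by auto
    finally show "norm (cps_coeff U k l) * norm (cps_coeff (U ^ n) (a - k) (b - l))
        \<le> (4 * C) ^ n * C / ?\<rho> ^ (a + b) * ((1 / 2) ^ k * (1 / 2) ^ l)" .
  qed
  also have "\<dots> = (4 * C) ^ n * C / ?\<rho> ^ (a + b) * ((\<Sum>k\<le>a. (1 / 2) ^ k) * (\<Sum>l\<le>b. (1 / 2) ^ l))"
    by (subst sum_product, unfold sum_distrib_left) (rule refl)
  also have "\<dots> \<le> (4 * C) ^ n * C / ?\<rho> ^ (a + b) * (2 * 2)"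
    using r by (intro mult_left_mono mult_mono half_power_sum_le sum_nonneg) auto
  finally show ?case by (simp add: mult_ac)
qed

text \<open>
  The series \<open>s\<^sup>-\<^sup>k h(s\<^sup>N, s\<^sup>M U(s, z))\<close>, in which the monomial \<open>x\<^sup>i y\<^sup>j\<close> of \<open>h\<close> contributes to the
  coefficients of \<open>s\<^sup>p\<close> with \<open>p + k \<ge> N i + M j\<close>.
\<close>

lemma quasi_homogeneous_substitution:
  assumes N: "0 < N" and M: "0 < M"
    and low: "\<And>i j. cps_coeff h i j \<noteq> 0 \<Longrightarrow> k \<le> N * i + M * j"
  obtains H where
    "\<And>z. fps_nth z 0 = 0 \<Longrightarrow>
      curve_eval N (fps_X ^ M * curve_eval 1 z U) h = fps_X ^ k * curve_eval 1 z H"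
    "xrow H 0 = (\<Sum>i\<le>k. \<Sum>j\<le>k. if N * i + M * j = k
        then fps_const (cps_coeff h i j) * xrow U 0 ^ j else 0)"
proof -
  let ?w = "\<lambda>i j. N * i + M * j"
  have w_ge: "i + j \<le> ?w i j" for i j
    using N M by (intro add_mono) auto
  define c where "c = (\<lambda>p q. \<Sum>i\<le>p + k. \<Sum>j\<le>p + k. if ?w i j \<le> p + k
      then cps_coeff h i j * cps_coeff (U ^ j) (p + k - ?w i j) q else 0)"
  obtain r C where r: "0 < r" "r \<le> 1" "1 \<le> C"
    and hb: "\<And>i j. norm (cps_coeff h i j) \<le> C / r ^ (i + j)" by (rule cps_boundE) blast
  obtain s D where s: "0 < s" "s \<le> 1" "1 \<le> D"
    and Ub: "\<And>i j. norm (cps_coeff U i j) \<le> D / s ^ (i + j)" by (rule cps_boundE) blast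
  \<comment> \<open>The powers \<open>r\<^sup>-\<^sup>m\<close>, \<open>(4 D)\<^sup>m\<close> and \<open>(s / 2)\<^sup>-\<^sup>m\<close> with \<open>m = p + k\<close> come from the coefficients, and
      \<open>4\<^sup>m\<close> bounds the number \<open>(m + 1)\<^sup>2\<close> of summands.\<close>
  define \<theta> where "\<theta> = r * (s / 2) / (16 * D)"
  have "norm (c p q) \<le> (C / \<theta> ^ k) / \<theta> ^ (p + q)" for p q
  proof -
    let ?m = "p + k"
    let ?B = "C / r ^ ?m * ((4 * D) ^ ?m / (s / 2) ^ (?m + q))"
    have "norm (c p q) \<le> (\<Sum>i\<le>?m. \<Sum>j\<le>?m. ?B)"
      unfolding c_def
    proof (intro sum_norm_le)
      fix i j assume "i \<in> {..?m}" "j \<in> {..?m}"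
      show "norm (if ?w i j \<le> ?m then cps_coeff h i j * cps_coeff (U ^ j) (?m - ?w i j) q else 0) \<le> ?B"
      proof (cases "?w i j \<le> ?m")
        case True
        then have ij: "i + j \<le> ?m" using w_ge[of i j] by linarith
        have "norm (cps_coeff h i j) \<le> C / r ^ (i + j)" by (rule hb)
        also have "\<dots> \<le> C / r ^ ?m"
          using r ij by (intro divide_left_mono power_decreasing) auto
        finally have 1: "norm (cps_coeff h i j) \<le> C / r ^ ?m" .
        have "norm (cps_coeff (U ^ j) (?m - ?w i j) q) \<le> (4 * D) ^ j / (s / 2) ^ ((?m - ?w i j) + q)"
          by (rule cps_power_bound[OF s(1,3) Ub])
        also have "\<dots> \<le> (4 * D) ^ ?m / (s / 2) ^ (?m + q)"
          using s ij by (intro frac_le power_decreasing power_increasing) auto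
        finally have 2: "norm (cps_coeff (U ^ j) (?m - ?w i j) q) \<le> (4 * D) ^ ?m / (s / 2) ^ (?m + q)" .
        show ?thesis using True r s by (simp only: if_True norm_mult) (intro mult_mono 1 2, auto)
      qed (use r s in auto)
    qed
    also have "\<dots> = (real (Suc ?m) * real (Suc ?m)) * ?B" by simp
    also have "\<dots> \<le> (2 ^ ?m * 2 ^ ?m) * ?B"
      using r s by (intro mult_right_mono mult_mono Suc_le_2_power) auto
    also have "\<dots> = C / \<theta> ^ ?m / (s / 2) ^ q"
    proof -
      have "(16 :: real) ^ ?m = 2 ^ ?m * 2 ^ ?m * 4 ^ ?m" by (simp flip: power_mult_distrib)
      then show ?thesis
        unfolding \<theta>_def by (simp only: power_divide power_mult_distrib power_add[of _ ?m q]) (simp add: mult_ac)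
    qed
    also have "\<dots> \<le> C / \<theta> ^ ?m / \<theta> ^ q"
    proof -
      have "r * (s / 2) \<le> 1 * (s / 2)" using r s by (intro mult_right_mono) auto
      also have "\<dots> \<le> s / 2 * (16 * D)" using s by simp
      finally have "\<theta> \<le> s / 2" using s by (simp add: \<theta>_def pos_divide_le_eq)
      moreover have "0 < \<theta>" using r s by (simp add: \<theta>_def)
      ultimately show ?thesis using r by (intro divide_left_mono power_mono) auto
    qed
    finally show ?thesis by (simp add: power_add mult_ac)
  qed
  moreover have "0 < \<theta>" using r s by (simp add: \<theta>_def)
  ultimately obtain H where H: "\<And>p q. cps_coeff H p q = c p q"
    using cps_of_coeffs[of \<theta> c "C / \<theta> ^ k"] by metis
  have row_H: "xrow H p = (\<Sum>i\<le>p + k. \<Sum>j\<le>p + k. if ?w i j \<le> p + k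
      then fps_const (cps_coeff h i j) * xrow (U ^ j) (p + k - ?w i j) else 0)" for p
    by (rule fps_ext) (auto simp: xrow_nth H c_def fps_sum_nth intro!: sum.cong)
  have row_power: "xrow (U ^ j) 0 = xrow U 0 ^ j" for j
    by (induction j) (simp_all add: one_cps.rep_eq times_cps.rep_eq)
  show thesis
  proof (rule that)
    have "xrow H 0 = (\<Sum>i\<le>k. \<Sum>j\<le>k. if ?w i j \<le> k
        then fps_const (cps_coeff h i j) * xrow (U ^ j) (k - ?w i j) else 0)"
      by (simp only: row_H[of 0] add_0)
    also have "\<dots> = (\<Sum>i\<le>k. \<Sum>j\<le>k. if ?w i j = k
        then fps_const (cps_coeff h i j) * xrow U 0 ^ j else 0)"
    proof (intro sum.cong refl)
      fix i j
      show "(if ?w i j \<le> k then fps_const (cps_coeff h i j) * xrow (U ^ j) (k - ?w i j) else 0)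
          = (if ?w i j = k then fps_const (cps_coeff h i j) * xrow U 0 ^ j else 0)"
        using low[of i j] row_power by (cases "cps_coeff h i j = 0") auto
    qed
    finally show "xrow H 0 = \<dots>" .
  next
    fix z :: "complex fps" assume z: "fps_nth z 0 = 0"
    let ?Y = "fps_X ^ M * curve_eval 1 z U"
    \<comment> \<open>With \<open>b\<close> the power of \<open>s\<close> at which a coefficient of \<open>U\<^sup>j\<close> is placed, both sides are sums of the
        same terms over \<open>i\<close>, \<open>j\<close> and \<open>b\<close>.\<close>
    let ?E = "\<lambda>i j b t. fps_nth (xrow (U ^ j) (b - ?w i j) oo z) (t - b)"
    have Y0: "fps_nth ?Y 0 = 0" using M by (simp add: fps_X_power_mult_nth)
    show "curve_eval N ?Y h = fps_X ^ k * curve_eval 1 z H"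
    proof (rule fps_ext)
      fix t
      have left: "fps_nth (curve_eval N ?Y h) t = (\<Sum>i\<le>t. \<Sum>j\<le>t. \<Sum>b\<le>t.
          if ?w i j \<le> b then cps_coeff h i j * ?E i j b t else 0)"
      proof -
        have "fps_nth (curve_eval N ?Y h) t =
            (\<Sum>i\<le>t. if N * i \<le> t then fps_nth (xrow h i oo ?Y) (t - N * i) else 0)"
          unfolding curve_eval_def fps_nth_Abs_fps
          by (intro sum.cong) (auto simp: fps_X_power_mult_nth)
        also have "\<dots> = (\<Sum>i\<le>t. \<Sum>j\<le>t. \<Sum>b\<le>t.
            if ?w i j \<le> b then cps_coeff h i j * ?E i j b t else 0)"
        proof (rule sum.cong[OF refl])
          fix i
          show "(if N * i \<le> t then fps_nth (xrow h i oo ?Y) (t - N * i) else 0) =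
              (\<Sum>j\<le>t. \<Sum>b\<le>t. if ?w i j \<le> b then cps_coeff h i j * ?E i j b t else 0)"
          proof (cases "N * i \<le> t")
            case True
            have "fps_nth (xrow h i oo ?Y) (t - N * i)
                = (\<Sum>j\<le>t. cps_coeff h i j * fps_nth (?Y ^ j) (t - N * i))"
              using fps_compose_nth'[OF Y0, of "t - N * i" t] by (simp add: xrow_nth)
            also have "\<dots> = (\<Sum>j\<le>t. \<Sum>b\<le>t. if ?w i j \<le> b then cps_coeff h i j * ?E i j b t else 0)"
            proof (rule sum.cong[OF refl])
              fix j
              have "?Y ^ j = fps_X ^ (M * j) * curve_eval 1 z (U ^ j)"
                using z by (simp add: power_mult_distrib power_mult curve_eval_power)
              then have "fps_nth (?Y ^ j) (t - N * i) = (if ?w i j \<le> t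
                  then fps_nth (curve_eval 1 z (U ^ j)) (t - ?w i j) else 0)"
                using True by (auto simp: fps_X_power_mult_nth)
              also have "\<dots> = (if ?w i j \<le> t
                  then \<Sum>a\<le>t - ?w i j. fps_nth (xrow (U ^ j) a oo z) (t - ?w i j - a) else 0)"
                by (simp add: curve_eval_def fps_X_power_mult_nth)
              also have "\<dots> = (\<Sum>b\<le>t. if ?w i j \<le> b then ?E i j b t else 0)"
              proof (cases "?w i j \<le> t")
                case True
                have "(\<Sum>b\<le>t. if ?w i j \<le> b then ?E i j b t else 0) = (\<Sum>b\<in>{?w i j..t}. ?E i j b t)"
                  by (simp add: sum.If_cases) (intro sum.cong, auto)
                also have "\<dots> = (\<Sum>a\<le>t - ?w i j. fps_nth (xrow (U ^ j) a oo z) (t - ?w i j - a))"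
                  using True
                  by (intro sum.reindex_bij_witness[of _ "\<lambda>a. a + ?w i j" "\<lambda>b. b - ?w i j"]) auto
                finally show ?thesis using True by simp
              qed (auto intro!: sum.neutral[symmetric])
              finally show "cps_coeff h i j * fps_nth (?Y ^ j) (t - N * i) =
                  (\<Sum>b\<le>t. if ?w i j \<le> b then cps_coeff h i j * ?E i j b t else 0)"
                by (auto simp: sum_distrib_left intro!: sum.cong)
            qed
            finally show ?thesis using True by simp
          next
            case False
            then show ?thesis by (auto intro!: sum.neutral[symmetric])
          qed
        qed
        finally show ?thesis .
      qed
      have right: "fps_nth (fps_X ^ k * curve_eval 1 z H) t = (\<Sum>b\<le>t. \<Sum>i\<le>t. \<Sum>j\<le>t.
          if ?w i j \<le> b then cps_coeff h i j * ?E i j b t else 0)"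
      proof -
        have summand: "(if k \<le> b then fps_nth (xrow H (b - k) oo z) (t - b) else 0) =
            (\<Sum>i\<le>t. \<Sum>j\<le>t. if ?w i j \<le> b then cps_coeff h i j * ?E i j b t else 0)" if "b \<le> t" for b
        proof (cases "k \<le> b")
          case True
          have "xrow H (b - k) oo z = (\<Sum>i\<le>b. \<Sum>j\<le>b. if ?w i j \<le> b
              then fps_const (cps_coeff h i j) * (xrow (U ^ j) (b - ?w i j) oo z) else 0)"
            using True unfolding row_H fps_compose_sum_distrib
            by (intro sum.cong) (auto simp: fps_compose_mult_distrib[OF z])
          then have "fps_nth (xrow H (b - k) oo z) (t - b) =
              (\<Sum>i\<le>b. \<Sum>j\<le>b. if ?w i j \<le> b then cps_coeff h i j * ?E i j b t else 0)"
            by (auto simp: fps_sum_nth intro!: sum.cong)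
          also have "\<dots> = (\<Sum>i\<le>b. \<Sum>j\<le>t. if ?w i j \<le> b then cps_coeff h i j * ?E i j b t else 0)"
          proof (rule sum.cong[OF refl], rule sum.mono_neutral_left)
            fix i
            show "\<forall>j\<in>{..t} - {..b}. (if ?w i j \<le> b then cps_coeff h i j * ?E i j b t else 0) = 0"
            proof
              fix j assume "j \<in> {..t} - {..b}"
              then have "\<not> ?w i j \<le> b" using w_ge[of i j] by auto
              then show "(if ?w i j \<le> b then cps_coeff h i j * ?E i j b t else 0) = 0" by simp
            qed
          qed (use that in auto)
          also have "\<dots> = (\<Sum>i\<le>t. \<Sum>j\<le>t. if ?w i j \<le> b then cps_coeff h i j * ?E i j b t else 0)"
          proof (intro sum.mono_neutral_left ballI sum.neutral)
            fix i j assume "i \<in> {..t} - {..b}"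
            then have "\<not> ?w i j \<le> b" using w_ge[of i j] by auto
            then show "(if ?w i j \<le> b then cps_coeff h i j * ?E i j b t else 0) = 0" by simp
          qed (use that in auto)
          finally show ?thesis using True by simp
        next
          case False
          have "(if ?w i j \<le> b then cps_coeff h i j * ?E i j b t else 0) = 0" for i j
            using low[of i j] False by (cases "cps_coeff h i j = 0") auto
          then show ?thesis using False by simp
        qed
        have "fps_nth (fps_X ^ k * curve_eval 1 z H) t =
            (if k \<le> t then \<Sum>p\<le>t - k. fps_nth (xrow H p oo z) (t - k - p) else 0)"
          by (simp add: fps_X_power_mult_nth curve_eval_def)
        also have "\<dots> = (\<Sum>b\<le>t. if k \<le> b then fps_nth (xrow H (b - k) oo z) (t - b) else 0)"
        proof (cases "k \<le> t")
          case True
          have "(\<Sum>b\<le>t. if k \<le> b then fps_nth (xrow H (b - k) oo z) (t - b) else 0)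
              = (\<Sum>b\<in>{k..t}. fps_nth (xrow H (b - k) oo z) (t - b))"
            by (simp add: sum.If_cases) (intro sum.cong, auto)
          also have "\<dots> = (\<Sum>p\<le>t - k. fps_nth (xrow H p oo z) (t - k - p))"
            using True by (intro sum.reindex_bij_witness[of _ "\<lambda>a. a + k" "\<lambda>b. b - k"]) auto
          finally show ?thesis using True by simp
        qed (auto intro!: sum.neutral[symmetric])
        also have "\<dots> = (\<Sum>b\<le>t. \<Sum>i\<le>t. \<Sum>j\<le>t.
            if ?w i j \<le> b then cps_coeff h i j * ?E i j b t else 0)"
          by (rule sum.cong[OF refl], rule summand) simp
        finally show ?thesis .
      qed
      show "fps_nth (curve_eval N ?Y h) t = fps_nth (fps_X ^ k * curve_eval 1 z H) t"
        unfolding left right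
        by (subst sum.swap[of _ "{..t}" "{..t}"], subst (2) sum.swap) (rule refl)
    qed
  qed
qed

section \<open>Separatrices of dicritical deformations of a quasi-homogeneous curve\<close>

definition model_form :: "nat \<Rightarrow> nat \<Rightarrow> cps \<Rightarrow> form" where
  "model_form n m h = form_d (cps_Y ^ n - cps_X ^ m)
     + h *\<^sub>F (- (of_nat m * cps_Y), of_nat n * cps_X)"

lemma model_form_fst: "fst (model_form n m h) = - (of_nat m * (cps_X ^ (m - 1) + h * cps_Y))"
proof -
  have "cps_dx (cps_Y ^ n - cps_X ^ m) = - (of_nat m * cps_X ^ (m - 1))"
    by (rule cps_eqI) (auto simp: cps_coeff_dx cps_coeff_X_power cps_coeff_Y_power)
  then show ?thesis by (simp add: model_form_def form_d_def form_scale_def algebra_simps)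
qed

lemma model_form_snd: "snd (model_form n m h) = of_nat n * (cps_Y ^ (n - 1) + h * cps_X)"
proof -
  have "cps_dy (cps_Y ^ n - cps_X ^ m) = of_nat n * cps_Y ^ (n - 1)"
    by (rule cps_eqI) (auto simp: cps_coeff_dy cps_coeff_X_power cps_coeff_Y_power)
  then show ?thesis by (simp add: model_form_def form_d_def form_scale_def algebra_simps)
qed

lemma convergent1_const: "convergent1 (fps_const c)"
  unfolding convergent1_def by (intro exI[of _ 1] exI[of _ "norm c"]) auto

lemma convergent1_add:
  assumes "convergent1 F" "convergent1 G" shows "convergent1 (F + G)"
proof -
  obtain r C where r: "0 < r" "r \<le> 1" "1 \<le> C" and F: "\<And>k. norm (fps_nth F k) \<le> C / r ^ k"
    using convergent1E[OF assms(1)] by blast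
  obtain s D where s: "0 < s" "s \<le> 1" "1 \<le> D" and G: "\<And>k. norm (fps_nth G k) \<le> D / s ^ k"
    using convergent1E[OF assms(2)] by blast
  have "norm (fps_nth (F + G) k) \<le> (C + D) / min r s ^ k" for k
  proof -
    have "norm (fps_nth (F + G) k) \<le> C / r ^ k + D / s ^ k"
      using F[of k] G[of k] by (auto intro: norm_triangle_le)
    also have "\<dots> \<le> C / min r s ^ k + D / min r s ^ k"
      using r s by (intro add_mono divide_left_mono power_mono) auto
    finally show ?thesis by (simp add: add_divide_distrib)
  qed
  then show ?thesis
    unfolding convergent1_def using r s by (intro exI[of _ "min r s"] exI[of _ "C + D"]) auto
qed

lemma convergent1_const_mult: "convergent1 F \<Longrightarrow> convergent1 (fps_const c * F)"
  unfolding convergent1_def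
proof (elim exE conjE)
  fix r C assume "0 < r" and F: "\<forall>k. norm (fps_nth F k) \<le> C / r ^ k"
  then show "\<exists>r C. 0 < r \<and> (\<forall>k. norm (fps_nth (fps_const c * F) k) \<le> C / r ^ k)"
    using mult_left_mono[of "norm (fps_nth F k)" "C / r ^ k" "norm c" for k]
    by (intro exI[of _ r] exI[of _ "norm c * C"]) (auto simp: norm_mult)
qed

lemma convergent1_X_power_mult: 
  assumes "convergent1 F" shows "convergent1 (fps_X ^ a * F)"
proof -
  obtain r C where r: "0 < r" "r \<le> 1" "1 \<le> C" and F: "\<And>k. norm (fps_nth F k) \<le> C / r ^ k"
    using convergent1E[OF assms] by blast
  have "norm (fps_nth (fps_X ^ a * F) k) \<le> C / r ^ k" for k
  proof (cases "k < a")
    case False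
    have "norm (fps_nth F (k - a)) \<le> C / r ^ (k - a)" by (rule F)
    also have "\<dots> \<le> C / r ^ k" using r by (intro divide_left_mono power_decreasing) auto
    finally show ?thesis using False by (simp add: fps_X_power_mult_nth)
  qed (use r in \<open>simp add: fps_X_power_mult_nth\<close>)
  then show ?thesis unfolding convergent1_def using r by blast
qed

text \<open>
  On a curve \<open>x = s\<^sup>N\<close>, \<open>y = s\<^sup>M w(s)\<close> with \<open>N m = M n\<close>, the form \<open>n x dy - m y dx\<close> restricts to
  \<open>n s\<^sup>N\<^sup>+\<^sup>M dw\<close>, whatever \<open>w\<close> is.
\<close>

lemma separatrix_of_quasi_homogeneous_branch:
  assumes "0 < n" "0 < m" and N: "0 < N" and M: "0 < M" and NM: "N * m = M * n"
    and w: "convergent1 w" "w ^ n \<noteq> 1"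
    and eq: "of_nat (m * N) * fps_X ^ (N * m - 1) * (w ^ n - 1)
      + of_nat n * (fps_X ^ (N * m) * w ^ (n - 1)
        + fps_X ^ (N + M) * curve_eval N (fps_X ^ M * w) h) * fps_deriv w = 0"
  obtains g where "irreducible g" "g dvd wedge (model_form n m h) (form_d g)"
    "\<not> g dvd cps_Y ^ n - cps_X ^ m"
proof -
  define Y where "Y = fps_X ^ M * w"
  define e where "e = curve_eval N Y"
  have Y0: "fps_nth Y 0 = 0" using M by (simp add: Y_def fps_X_power_mult_nth)
  have conv: "convergent1 Y" unfolding Y_def by (rule convergent1_X_power_mult[OF w(1)])
  have e_mult: "e (F * G) = e F * e G" for F G unfolding e_def by (rule curve_eval_mult[OF N Y0])
  have e_power: "e (F ^ k) = e F ^ k" for F k unfolding e_def by (rule curve_eval_power[OF N Y0])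
  have e_add: "e (F + G) = e F + e G" for F G unfolding e_def by (rule curve_eval_add)
  have e_X: "e cps_X = fps_X ^ N" unfolding e_def by (rule curve_eval_X[OF N])
  have e_Y: "e cps_Y = Y" unfolding e_def by (rule curve_eval_Y[OF Y0])
  have e_simps: "e (of_nat k) = of_nat k" "e (- F) = - e F" for F k by (simp_all add: e_def)
  have "e (fst (model_form n m h)) * (of_nat N * fps_X ^ (N - 1))
      + e (snd (model_form n m h)) * fps_deriv Y = 0"
  proof -
    \<comment> \<open>Written with these factors, the relation \<open>N m = M n\<close> becomes \<open>P a = Q b\<close>, and the claim is a
        polynomial identity.\<close>
    define a b P Q where "a = (fps_X ^ (N - 1) :: complex fps)" "b = (fps_X ^ (M - 1) :: complex fps)"
      "P = (fps_X ^ (N * (m - 1)) :: complex fps)" "Q = (fps_X ^ (M * (n - 1)) :: complex fps)"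
    note ab = this
    define u where "u = w ^ (n - 1)"
    define \<nu> \<mu> N' M' where "\<nu> = (of_nat n :: complex fps)" "\<mu> = (of_nat m :: complex fps)"
      "N' = (of_nat N :: complex fps)" "M' = (of_nat M :: complex fps)"
    note coefs = this
    have XN: "fps_X ^ N = fps_X * a" using N by (simp add: ab flip: power_Suc)
    have XM: "fps_X ^ M = fps_X * b" using M by (simp add: ab flip: power_Suc)
    have wn: "w ^ n = u * w" using \<open>0 < n\<close> by (simp add: u_def flip: power_Suc2)
    have Nm: "N * m = N * (m - 1) + N" using \<open>0 < m\<close> by (cases m) auto
    have Mn: "M * n = M * (n - 1) + M" using \<open>0 < n\<close> by (cases n) auto
    have XNm: "fps_X ^ (N * m) = P * (fps_X * a)" unfolding Nm power_add ab(3) XN ..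
    have "fps_X ^ (N * m) = Q * (fps_X * b)" unfolding NM Mn power_add ab(4) XM ..
    with XNm have "fps_X * (P * a) = fps_X * (Q * b)" by (simp add: algebra_simps)
    then have PQ: "P * a = Q * b" by simp
    have XNm1: "fps_X ^ (N * m - 1) = P * a"
    proof -
      have "N * m - 1 = N * (m - 1) + (N - 1)" using Nm N by linarith
      then show ?thesis by (simp only: power_add ab)
    qed
    have dY: "fps_deriv Y = M' * b * w + fps_X * b * fps_deriv w"
      unfolding Y_def XM[symmetric] by (simp add: fps_deriv_power ab coefs fps_of_nat mult_ac)
    have eF: "e (fst (model_form n m h)) = - (\<mu> * (P + e h * Y))"
      by (simp add: model_form_fst e_mult e_add e_power e_X e_Y e_simps ab coefs flip: power_mult)
    have eG: "e (snd (model_form n m h)) = \<nu> * (Q * u + e h * (fps_X * a))"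
      by (simp add: model_form_snd e_mult e_add e_power e_X e_Y e_simps ab coefs u_def XN[unfolded ab]
        Y_def power_mult_distrib flip: power_mult)
    have NM': "N' * \<mu> = M' * \<nu>" unfolding coefs of_nat_mult[symmetric] NM ..
    have eq': "\<mu> * N' * (P * a) * (u * w - 1) + \<nu> * (P * (fps_X * a) * u
        + (fps_X * a * (fps_X * b)) * e h) * fps_deriv w = 0"
      using eq unfolding XNm XNm1 wn u_def[symmetric] power_add XN XM e_def Y_def coefs of_nat_mult .
    have "e (fst (model_form n m h)) * (N' * a) + e (snd (model_form n m h)) * fps_deriv Y
        = \<mu> * N' * (P * a) * (u * w - 1) + \<nu> * (P * (fps_X * a) * u
        + (fps_X * a * (fps_X * b)) * e h) * fps_deriv w"
      unfolding eF eG dY unfolding Y_def XM using PQ NM' by algebra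
    then show ?thesis unfolding eq' by (simp add: ab coefs)
  qed
  then obtain g where g: "irreducible g" "g dvd wedge (model_form n m h) (form_d g)" "e g = 0"
    using separatrix_of_integral_curve[OF N Y0 conv] unfolding e_def by blast
  have "e (cps_Y ^ n - cps_X ^ m) = fps_X ^ (N * m) * (w ^ n - 1)"
    unfolding e_def curve_eval_diff unfolding e_def[symmetric] e_power e_X e_Y
    by (simp add: Y_def power_mult_distrib NM algebra_simps flip: power_mult)
  then have "e (cps_Y ^ n - cps_X ^ m) \<noteq> 0" using w(2) by simp
  moreover have "e F = 0" if "g dvd F" for F using that g(3) by (auto simp: dvd_def e_mult)
  ultimately show thesis using that g by blast
qed

text \<open>
  If \<open>h\<close> has terms of small weight, the divisor of the weighted blow-up is not invariant and the
  leaves through its generic points are transversal to it.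
\<close>

theorem dicritical_of_small_weight:
  assumes "0 < n" "0 < m" and N: "0 < N" and M: "0 < M" and NM: "N * m = M * n"
    and ij: "cps_coeff h i0 j0 \<noteq> 0" "N * i0 + M * j0 + N + M < N * m"
  obtains g where "irreducible g" "g dvd wedge (model_form n m h) (form_d g)"
    "\<not> g dvd cps_Y ^ n - cps_X ^ m"
proof -
  define k where "k = (LEAST k. \<exists>i j. cps_coeff h i j \<noteq> 0 \<and> k = N * i + M * j)"
  have "\<exists>i j. cps_coeff h i j \<noteq> 0 \<and> k = N * i + M * j"
    unfolding k_def by (rule LeastI_ex) (use ij in blast)
  then obtain i1 j1 where k: "cps_coeff h i1 j1 \<noteq> 0" "k = N * i1 + M * j1" by blast
  have low: "k \<le> N * i + M * j" if "cps_coeff h i j \<noteq> 0" for i j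
    unfolding k_def by (rule Least_le) (use that in blast)
  define d where "d = N * m - N - M - k"
  have d: "0 < d" "N * m = N + M + k + d" using low[OF ij(1)] ij(2) by (auto simp: d_def)
  \<comment> \<open>The part of \<open>h\<close> of lowest weight \<open>k\<close> on the line \<open>x = 1\<close>; \<open>w0\<close> is neither a root of it nor on \<open>f\<close>.\<close>
  define p where "p = (\<Sum>i\<le>k. \<Sum>j\<le>k. if N * i + M * j = k then monom (cps_coeff h i j) j else 0)"
  have "i1 \<le> N * i1" "j1 \<le> M * j1" using N M by auto
  then have ij1: "i1 \<le> k" "j1 \<le> k" using k(2) by linarith+
  have "coeff p j1 = (\<Sum>i\<le>k. \<Sum>j\<le>k. if i = i1 then if j = j1 then cps_coeff h i1 j1 else 0 else 0)"
    unfolding p_def coeff_sum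
  proof (intro sum.cong refl)
    fix i j
    show "coeff (if N * i + M * j = k then monom (cps_coeff h i j) j else 0) j1
        = (if i = i1 then if j = j1 then cps_coeff h i1 j1 else 0 else 0)"
      using N k(2) by auto
  qed
  also have "\<dots> = (\<Sum>i\<le>k. if i = i1 then cps_coeff h i1 j1 else 0)"
    using ij1 by (intro sum.cong) auto
  also have "\<dots> = cps_coeff h i1 j1" using ij1 by simp
  finally have "p \<noteq> 0" using k(1) by auto
  moreover have "monom 1 n - 1 \<noteq> (0 :: complex poly)"
  proof
    assume "monom 1 n - 1 = (0 :: complex poly)"
    then have "poly (monom 1 n - 1 :: complex poly) 0 = 0" by simp
    then show False using \<open>0 < n\<close> by (simp add: poly_monom zero_power)
  qed
  ultimately have "finite {x. poly (p * (monom 1 n - 1)) x = 0}"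
    by (intro poly_roots_finite) auto
  then obtain w0 where w0: "poly (p * (monom 1 n - 1)) w0 \<noteq> 0"
    using ex_new_if_finite[OF infinite_UNIV_char_0] by blast
  \<comment> \<open>The leaf is \<open>w = w0 + z(s)\<close>.  Dividing the equation by \<open>s\<^sup>N\<^sup>+\<^sup>M\<^sup>+\<^sup>k\<close> leaves \<open>L z' = - m N s\<^sup>d\<^sup>-\<^sup>1 (w\<^sup>n - 1)\<close>
      with \<open>L(0, 0) \<noteq> 0\<close>.\<close>
  define U where "U = cps_const w0 + cps_Y"
  obtain H where H: "\<And>z. fps_nth z 0 = 0 \<Longrightarrow>
      curve_eval N (fps_X ^ M * curve_eval 1 z U) h = fps_X ^ k * curve_eval 1 z H"
    and H0: "xrow H 0 = (\<Sum>i\<le>k. \<Sum>j\<le>k. if N * i + M * j = k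
        then fps_const (cps_coeff h i j) * xrow U 0 ^ j else 0)"
    using quasi_homogeneous_substitution[OF N M low] by blast
  have U0: "fps_nth (xrow U 0) 0 = w0"
    by (simp add: xrow_nth U_def cps_coeff_const cps_coeff_Y)
  have "cps_coeff H 0 0 = poly p w0"
    unfolding xrow_nth[symmetric] H0 p_def poly_sum fps_sum_nth
    by (intro sum.cong refl) (simp add: poly_monom fps_power_zeroth U0)
  then have H00: "cps_coeff H 0 0 \<noteq> 0" using w0 by auto
  define L where "L = of_nat n * (cps_X ^ d * U ^ (n - 1) + H)"
  have "cps_coeff L 0 0 \<noteq> 0"
    using H00 d(1) \<open>0 < n\<close> by (simp add: L_def cps_coeff_X_power_mult)
  then obtain L' where L': "1 = L * L'" unfolding cps_unit_iff[symmetric] by (auto simp: dvd_def)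
  define K where "K = - (of_nat (m * N) * cps_X ^ (d - 1) * (U ^ n - 1)) * L'"
  obtain z where z: "fps_nth z 0 = 0" "convergent1 z" "fps_deriv z = curve_eval 1 z K"
    by (rule analytic_ode_solution)
  define e where "e = curve_eval 1 z"
  have e_mult: "e (F * G) = e F * e G" for F G unfolding e_def by (rule curve_eval_mult) (use z in auto)
  have e_power: "e (F ^ k) = e F ^ k" for F k unfolding e_def by (rule curve_eval_power) (use z in auto)
  have e_simps: "e (F + G) = e F + e G" "e (F - G) = e F - e G" "e (of_nat k) = of_nat k" "e 1 = 1"
    "e (- F) = - e F" for F G k
    by (simp_all add: e_def curve_eval_add curve_eval_diff)
  have e_X: "e cps_X = fps_X" using curve_eval_X[of 1 z] by (simp add: e_def)
  define w where "w = e U"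
  have w: "w = fps_const w0 + z" using z(1) by (simp add: w_def U_def e_simps) (simp add: e_def)
  have "convergent1 w" unfolding w by (intro convergent1_add convergent1_const z)
  moreover have "w ^ n \<noteq> 1"
  proof
    assume "w ^ n = 1"
    then have "fps_nth (w ^ n) 0 = 1" by simp
    then show False using w0 by (simp add: w z(1) fps_power_zeroth poly_monom)
  qed
  moreover have "of_nat (m * N) * fps_X ^ (N * m - 1) * (w ^ n - 1)
      + of_nat n * (fps_X ^ (N * m) * w ^ (n - 1)
        + fps_X ^ (N + M) * curve_eval N (fps_X ^ M * w) h) * fps_deriv w = 0"
  proof -
    define x :: "complex fps" where "x = fps_X ^ (N + M + k)"
    have "e L * e L' = 1" using L' e_mult[of L L'] e_simps(4) by simp
    moreover have "fps_deriv w = - (of_nat (m * N) * fps_X ^ (d - 1) * (w ^ n - 1)) * e L'"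
    proof -
      have "fps_deriv w = e K" by (simp add: w z(3) e_def)
      then show ?thesis by (simp add: K_def e_mult e_simps e_power e_X w_def)
    qed
    ultimately have "e L * fps_deriv w = - (of_nat (m * N) * fps_X ^ (d - 1) * (w ^ n - 1))"
      by (simp only: mult.left_commute[of "e L"] mult_1_right)
    moreover have "e L = of_nat n * (fps_X ^ d * w ^ (n - 1) + e H)"
      by (simp add: L_def e_mult e_simps e_power e_X w_def)
    ultimately have *: "of_nat n * (fps_X ^ d * w ^ (n - 1) + e H) * fps_deriv w
        = - (of_nat (m * N) * fps_X ^ (d - 1) * (w ^ n - 1))" by simp
    have h: "curve_eval N (fps_X ^ M * w) h = fps_X ^ k * e H"
      using H[OF z(1)] by (simp add: w_def e_def)
    have "N * m - 1 = (N + M + k) + (d - 1)" using d by linarith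
    then have x1: "fps_X ^ (N * m - 1) = x * fps_X ^ (d - 1)" by (simp only: x_def power_add)
    have x2: "fps_X ^ (N * m) = x * fps_X ^ d" by (simp only: d(2) x_def power_add)
    have x3: "fps_X ^ (N + M) * (fps_X ^ k * e H) = x * e H" by (simp only: x_def power_add mult_ac)
    have "c * (x * y) * v + b * (x * u * W + x * G) * D = x * (c * y * v + b * (u * W + G) * D)"
      for c y v b u W G D :: "complex fps" by (simp only: algebra_simps)
    then show ?thesis unfolding h x1 x2 x3 by (simp only: * add.right_inverse mult_zero_right)
  qed
  ultimately show thesis
    using separatrix_of_quasi_homogeneous_branch[OF assms(1,2) N M NM] that by blast
qed

text \<open>
  At the point of the divisor where a branch of \<open>f\<close> passes, a negative rational residue makes the
  singularity a node with two transversal invariant curves: besides the branch \<open>w = w0\<close> there are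
  the leaves \<open>w = w0 (1 + s\<^sup>a v(s))\<close>, where \<open>v(0)\<close> is arbitrary and equals 1 below.
\<close>

theorem dicritical_of_negative_residue:
  assumes "0 < n" "0 < m" and N: "0 < N" and M: "0 < M" and NM: "N * m = M * n"
    and wt: "N + M \<le> N * m"
    and low: "\<And>i j. cps_coeff h i j \<noteq> 0 \<Longrightarrow> N * m - N - M \<le> N * i + M * j"
    and w0: "w0 ^ n = 1" and a: "0 < a"
    and res: "of_nat (m * N) + of_nat a * (1 + w0 * (\<Sum>i\<le>N * m. \<Sum>j\<le>N * m.
      if N * i + M * j = N * m - N - M then cps_coeff h i j * w0 ^ j else 0)) = 0"
  obtains g where "irreducible g" "g dvd wedge (model_form n m h) (form_d g)"
    "\<not> g dvd cps_Y ^ n - cps_X ^ m"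
proof -
  define k where "k = N * m - N - M"
  \<comment> \<open>The unknown function is \<open>v = 1 + z\<close> with \<open>z(0) = 0\<close>, and \<open>E = s\<^sup>a v\<close>.\<close>
  define E where "E = cps_X ^ a * (1 + cps_Y)"
  define U where "U = cps_const w0 * (1 + E)"
  define h0 where "h0 = (\<Sum>i\<le>k. \<Sum>j\<le>k. if N * i + M * j = k then cps_coeff h i j * w0 ^ j else 0)"
  obtain H where H: "\<And>z. fps_nth z 0 = 0 \<Longrightarrow>
      curve_eval N (fps_X ^ M * curve_eval 1 z U) h = fps_X ^ k * curve_eval 1 z H"
    and H0: "xrow H 0 = (\<Sum>i\<le>k. \<Sum>j\<le>k. if N * i + M * j = k
        then fps_const (cps_coeff h i j) * xrow U 0 ^ j else 0)"
    using quasi_homogeneous_substitution[OF N M low, folded k_def] by blast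
  have row0: "xrow (F * G) 0 = xrow F 0 * xrow G 0" for F G by (simp add: xrow_mult)
  have row0_power: "xrow (F ^ l) 0 = xrow F 0 ^ l" for F l
    by (induction l) (simp_all add: row0 one_cps.rep_eq)
  have row_of_nat: "xrow (of_nat l) 0 = fps_const (of_nat l)" for l
    by (simp add: cps_of_nat xrow_const)
  have row_V: "xrow (1 + E) 0 = 1"
    using a by (simp add: E_def xrow_add row0 row0_power one_cps.rep_eq cps_X.rep_eq)
  have row_U: "xrow U 0 = fps_const w0" by (simp only: U_def row0 row_V xrow_const) simp
  have "xrow H 0 = (\<Sum>i\<le>k. \<Sum>j\<le>k. fps_const (if N * i + M * j = k then cps_coeff h i j * w0 ^ j else 0))"
    unfolding H0 row_U by (intro sum.cong refl) (simp add: fps_const_power)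
  also have "\<dots> = fps_const h0"
    by (rule fps_ext) (simp add: h0_def fps_sum_nth)
  finally have row_H: "xrow H 0 = fps_const h0" .
  have "h0 = (\<Sum>i\<le>N * m. \<Sum>j\<le>N * m. if N * i + M * j = k then cps_coeff h i j * w0 ^ j else 0)"
  proof -
    have ij: "i \<le> k \<and> j \<le> k" if "N * i + M * j = k" for i j
    proof -
      have "i \<le> N * i" "j \<le> M * j" using N M by auto
      then show ?thesis using that by linarith
    qed
    have kN: "k \<le> N * m" by (simp add: k_def)
    have "h0 = (\<Sum>i\<le>k. \<Sum>j\<le>N * m. if N * i + M * j = k then cps_coeff h i j * w0 ^ j else 0)"
      unfolding h0_def
      by (rule sum.cong[OF refl], rule sum.mono_neutral_left) (use ij kN in auto)
    also have "\<dots> = (\<Sum>i\<le>N * m. \<Sum>j\<le>N * m. if N * i + M * j = k then cps_coeff h i j * w0 ^ j else 0)"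
    proof (rule sum.mono_neutral_left)
      show "\<forall>i\<in>{..N * m} - {..k}.
          (\<Sum>j\<le>N * m. if N * i + M * j = k then cps_coeff h i j * w0 ^ j else 0) = 0"
      proof
        fix i assume "i \<in> {..N * m} - {..k}"
        then have "N * i + M * j \<noteq> k" for j using ij[of i j] by auto
        then show "(\<Sum>j\<le>N * m. if N * i + M * j = k then cps_coeff h i j * w0 ^ j else 0) = 0"
          by simp
      qed
    qed (use kN in auto)
    finally show ?thesis .
  qed
  with res have res': "of_nat (m * N) + of_nat a * (1 + w0 * h0) = 0" by (simp add: k_def)
  have w0n: "w0 * w0 ^ (n - 1) = 1" using w0 \<open>0 < n\<close> by (simp flip: power_Suc)
  define Q where "Q = (\<Sum>i<n. (1 + E) ^ i)"
  have EQ: "U ^ n - 1 = E * Q"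
  proof -
    have "cps_const w0 ^ n = cps_const (w0 ^ n)"
      by (induction n) (simp_all add: cps_const_numeral_simps)
    then have "U ^ n = (1 + E) ^ n"
      by (simp add: U_def power_mult_distrib w0 cps_const_numeral_simps)
    then show ?thesis using power_diff_1_eq[of "1 + E" n] by (simp add: Q_def)
  qed
  have row_Q: "xrow Q 0 = fps_const (of_nat n)"
  proof -
    have "xrow (\<Sum>i<l. (1 + E) ^ i) 0 = fps_const (of_nat l)" for l
    proof (induction l)
      case 0
      then show ?case by (simp add: zero_cps.rep_eq)
    next
      case (Suc l)
      then show ?case by (simp add: xrow_add[of "\<Sum>i<l. (1 + E) ^ i"] row0_power row_V) 
    qed
    then show ?thesis by (simp add: Q_def)
  qed
  define L where "L = of_nat n * cps_const w0 * (U ^ (n - 1) + H)"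
  have row_L: "xrow L 0 = fps_const (of_nat n * (1 + w0 * h0))"
  proof -
    have "xrow L 0 = fps_const (of_nat n * (w0 * w0 ^ (n - 1) + w0 * h0))"
      by (simp add: L_def row0 row_of_nat xrow_const xrow_add row0_power row_U row_H fps_const_power
        algebra_simps)
    then show ?thesis by (simp only: w0n)
  qed
  have "1 + w0 * h0 \<noteq> 0" using res' \<open>0 < m\<close> N by auto
  then have "cps_coeff L 0 0 \<noteq> 0" using \<open>0 < n\<close> by (simp add: xrow_nth[symmetric] row_L)
  then obtain L' where L': "1 = L * L'" unfolding cps_unit_iff[symmetric] by (auto simp: dvd_def)
  \<comment> \<open>The equation reads \<open>s L z' = - (1 + z) (m N Q + a L)\<close>.  By the choice of \<open>a\<close> the right-hand side
      vanishes for \<open>s = 0\<close>, so that \<open>s\<close> cancels and the equation is regular.\<close>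
  have "xrow (of_nat (m * N) * Q + of_nat a * L) 0
      = fps_const (of_nat n * (of_nat (m * N) + of_nat a * (1 + w0 * h0)))"
    by (simp add: xrow_add row0 row_of_nat row_Q row_L algebra_simps)
  then have "\<forall>j. cps_coeff (of_nat (m * N) * Q + of_nat a * L) 0 j = 0"
    unfolding res' by (simp add: xrow_nth[symmetric] del: cps_coeff_add)
  then obtain K2 where K2: "of_nat (m * N) * Q + of_nat a * L = cps_X * K2"
    unfolding cps_X_dvd_iff[symmetric] by (auto simp: dvd_def)
  define K where "K = - ((1 + cps_Y) * K2) * L'"
  obtain z where z: "fps_nth z 0 = 0" "convergent1 z" "fps_deriv z = curve_eval 1 z K"
    by (rule analytic_ode_solution)
  define e where "e = curve_eval 1 z"
  have e_mult: "e (F * G) = e F * e G" for F G unfolding e_def by (rule curve_eval_mult) (use z in auto)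
  have e_power: "e (F ^ k) = e F ^ k" for F k unfolding e_def by (rule curve_eval_power) (use z in auto)
  have e_simps: "e (F + G) = e F + e G" "e (F - G) = e F - e G" "e (of_nat k) = of_nat k" "e 1 = 1"
    "e (- F) = - e F" "e cps_Y = z" "e (cps_const c) = fps_const c" for F G k c
    using z(1) by (simp_all add: e_def curve_eval_add curve_eval_diff)
  have e_X: "e cps_X = fps_X" using curve_eval_X[of 1 z] by (simp add: e_def)
  define w where "w = e U"
  have eE: "e E = fps_X ^ a * (1 + z)" by (simp add: E_def e_mult e_simps e_power e_X)
  have w: "w = fps_const w0 * (1 + fps_X ^ a * (1 + z))"
    by (simp add: w_def U_def e_mult e_simps eE)
  have "convergent1 (1 + z)"
    using convergent1_add[OF convergent1_const[of 1] z(2)] by simp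
  from convergent1_add[OF convergent1_const[of 1] convergent1_X_power_mult[OF this, of a]]
  have "convergent1 w" unfolding w by (intro convergent1_const_mult) simp
  moreover have wn: "w ^ n - 1 = fps_X ^ a * (1 + z) * e Q"
    unfolding eE[symmetric] e_mult[symmetric] EQ[symmetric] by (simp add: e_simps e_power w_def)
  moreover have "w ^ n \<noteq> 1"
  proof -
    have "fps_nth (e Q) 0 \<noteq> 0"
      unfolding e_def curve_eval_0_nth xrow_nth[symmetric] row_Q using \<open>0 < n\<close> by simp
    then have "e Q \<noteq> 0" by auto
    moreover have "fps_nth (1 + z) 0 \<noteq> 0" using z(1) by simp
    then have "1 + z \<noteq> 0" by (metis fps_zero_nth)
    ultimately have "w ^ n - 1 \<noteq> 0" unfolding wn by simp
    then show ?thesis by auto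
  qed
  moreover have "of_nat (m * N) * fps_X ^ (N * m - 1) * (w ^ n - 1)
      + of_nat n * (fps_X ^ (N * m) * w ^ (n - 1)
        + fps_X ^ (N + M) * curve_eval N (fps_X ^ M * w) h) * fps_deriv w = 0"
  proof -
    define x y b where "x = (fps_X ^ (N * m - 1) :: complex fps)"
      "y = (fps_X ^ (a - 1) :: complex fps)" "b = (of_nat a :: complex fps)"
    note xyb = this
    define c where "c = (of_nat (m * N) :: complex fps)"
    have "e L * e L' = 1" using L' e_mult[of L L'] e_simps(4) by simp
    moreover have "fps_deriv z = - ((1 + z) * e K2) * e L'"
    proof -
      have "fps_deriv z = e K" by (simp add: z(3) e_def)
      then show ?thesis by (simp add: K_def e_mult e_simps)
    qed
    ultimately have Lz: "e L * fps_deriv z = - ((1 + z) * e K2)"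
      by (simp only: mult.left_commute[of "e L"] mult_1_right)
    have K2': "c * e Q + b * e L = fps_X * e K2"
      using arg_cong[OF K2, of e] by (simp add: e_mult e_simps e_X xyb c_def)
    have eL: "e L = of_nat n * fps_const w0 * (w ^ (n - 1) + e H)"
      by (simp add: L_def e_mult e_simps e_power w_def)
    have h: "curve_eval N (fps_X ^ M * w) h = fps_X ^ k * e H"
      using H[OF z(1)] by (simp add: w_def e_def)
    have "N * m = Suc (N * m - 1)" using wt N by linarith
    then have x2: "fps_X ^ (N * m) = fps_X * x" unfolding xyb by (metis power_Suc)
    have x3: "fps_X ^ (N + M) * (fps_X ^ k * e H) = fps_X * x * e H"
    proof -
      have "N * m = N + M + k" using wt by (simp add: k_def)
      then have "fps_X ^ (N + M) * fps_X ^ k = fps_X * x" using x2 by (simp only: power_add)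
      then show ?thesis by (simp only: mult.assoc[symmetric])
    qed
    have xa: "fps_X ^ a = fps_X * y" using a unfolding xyb by (simp flip: power_Suc)
    have dX: "fps_deriv (fps_X ^ a) = b * y"
      by (simp add: fps_deriv_power xyb fps_of_nat)
    have "fps_deriv w = fps_const w0 * (fps_deriv (fps_X ^ a) * (1 + z) + fps_X ^ a * fps_deriv z)"
      unfolding w by (simp add: add.commute)
    then have dw: "fps_deriv w = fps_const w0 * (y * (b * (1 + z) + fps_X * fps_deriv z))"
      unfolding dX unfolding xa by (simp only: algebra_simps)
    have "of_nat n * (fps_X * x * w ^ (n - 1) + fps_X * x * e H) * fps_deriv w
        = fps_X * x * e L * (y * (b * (1 + z) + fps_X * fps_deriv z))"
      unfolding dw eL by (simp only: algebra_simps)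
    moreover have "c * x * (s * y * v * q) + s * x * l * (y * (b * v + s * D))
        = s * x * y * (v * (c * q + b * l) + s * (l * D))" for s v q l D
      by (simp only: algebra_simps)
    moreover have "(1 + z) * (fps_X * e K2) + fps_X * (- ((1 + z) * e K2)) = 0"
      by (simp only: mult_minus_right mult.left_commute[of fps_X] add.right_inverse)
    ultimately show ?thesis
      unfolding h x2 x3 wn unfolding xyb(1)[symmetric] c_def[symmetric] xa
      by (simp only: Lz K2' mult_zero_right)
  qed
  ultimately show thesis
    using separatrix_of_quasi_homogeneous_branch[OF assms(1,2) N M NM] that by blast
qed

section \<open>Linear parts\<close>

lemma eigenvalues_linear_part_iff:
  "eigenvalues (linear_part V) l1 l2 \<longleftrightarrow>
    l1 + l2 = cps_coeff (fst V) 0 1 - cps_coeff (snd V) 1 0 \<and>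
    l1 * l2 = cps_coeff (snd V) 0 1 * cps_coeff (fst V) 1 0 - cps_coeff (snd V) 1 0 * cps_coeff (fst V) 0 1"
  (is "_ \<longleftrightarrow> l1 + l2 = ?tr \<and> l1 * l2 = ?det")
proof -
  have det: "det (mat z - linear_part V) = z * z - ?tr * z + ?det" for z
    by (simp add: linear_part_def det_2 mat_def vector_2 cps_coeff_dx cps_coeff_dy algebra_simps)
  show ?thesis
  proof
    assume *: "eigenvalues (linear_part V) l1 l2"
    have "?det = l1 * l2"
      using *[unfolded eigenvalues_def det, rule_format, of 0] by simp
    moreover have "1 - ?tr + ?det = (1 - l1) * (1 - l2)"
      using *[unfolded eigenvalues_def det, rule_format, of 1] by simp
    ultimately show "l1 + l2 = ?tr \<and> l1 * l2 = ?det" by (simp add: algebra_simps)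
  next
    assume *: "l1 + l2 = ?tr \<and> l1 * l2 = ?det"
    have "z * z - (l1 + l2) * z + l1 * l2 = (z - l1) * (z - l2)" for z
      by (simp add: algebra_simps)
    then show "eigenvalues (linear_part V) l1 l2"
      unfolding eigenvalues_def det using * by metis
  qed
qed

lemma nilpotent_not_irreducible:
  assumes "cps_coeff (fst V) 0 1 = cps_coeff (snd V) 1 0"
    and "cps_coeff (snd V) 0 1 * cps_coeff (fst V) 1 0 = cps_coeff (snd V) 1 0 * cps_coeff (fst V) 0 1"
  shows "\<not> irreducible_singularity V"
  using assms
  by (auto simp: irreducible_singularity_def simple_singularity_def saddle_node_def
      eigenvalues_linear_part_iff)

lemma simple_not_saddle_node: "simple_singularity V \<Longrightarrow> \<not> saddle_node V"
  by (auto simp: simple_singularity_def saddle_node_def eigenvalues_linear_part_iff)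

lemma triangular_eigenvalues:
  assumes "cps_coeff (snd V) 0 1 = 0 \<or> cps_coeff (fst V) 1 0 = 0"
  shows "eigenvalues (linear_part V) (- cps_coeff (snd V) 1 0) (cps_coeff (fst V) 0 1)"
  using assms by (auto simp: eigenvalues_linear_part_iff)

lemma simple_singularity_of_negative_ratio:
  assumes "singular V" "eigenvalues (linear_part V) (of_int a) (of_int b)" "a * b < 0"
  shows "simple_singularity V"
proof -
  have "of_int a / of_int b \<notin> pos_rats"
  proof
    assume "of_int a / of_int b \<in> pos_rats"
    then obtain c where c: "0 < c" "(of_int a / of_int b :: complex) = of_rat c"
      by (auto simp: pos_rats_def)
    have "of_rat (of_int a / of_int b) = (of_rat c :: complex)"
      using c(2) by (simp add: of_rat_divide)
    then have "c = of_int a / of_int b" by (simp only: of_rat_eq_iff)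
    then show False using c(1) assms(3) by (auto simp: zero_less_divide_iff mult_less_0_iff)
  qed
  moreover have "of_int a * of_int b \<noteq> (0 :: complex)"
    using assms(3) by (auto simp flip: of_int_mult)
  ultimately show ?thesis using assms(1,2) unfolding simple_singularity_def by blast
qed

section \<open>Strict transforms\<close>

text \<open>
  The exponent and the quotient are determined because the equation of the exceptional divisor
  can be cancelled.
\<close>

lemma strict_transform_eqI:
  assumes "pullback c V = exceptional c ^ k *\<^sub>F V'"
    and "\<not> (exceptional c dvd fst V' \<and> exceptional c dvd snd V')"
  shows "strict_transform c V = V'"
  unfolding strict_transform_def
proof (rule the_equality)
  let ?e = "exceptional c"
  have e: "?e \<noteq> 0"
  proof (cases c)
    case None
    have "cps_coeff cps_Y 0 1 \<noteq> 0" by (simp add: cps_coeff_Y)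
    then show ?thesis using None by auto
  next
    case (Some t)
    have "cps_coeff cps_X 1 0 \<noteq> 0" by (simp add: cps_coeff_X)
    then show ?thesis using Some by auto
  qed
  have less: False if "k < l" "?e ^ k *\<^sub>F U = ?e ^ l *\<^sub>F U'"
      "\<not> (?e dvd fst U \<and> ?e dvd snd U)" for k l U U'
  proof -
    obtain r where r: "l = k + Suc r" using \<open>k < l\<close> less_iff_Suc_add by auto
    have "?e ^ k * fst U = ?e ^ k * (?e * (?e ^ r * fst U'))"
      "?e ^ k * snd U = ?e ^ k * (?e * (?e ^ r * snd U'))"
      using that(2) by (simp_all add: form_scale_def r power_add mult_ac)
    then have "fst U = ?e * (?e ^ r * fst U')" "snd U = ?e * (?e ^ r * snd U')"
      using e by simp_all
    then show False using that(3) by simp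
  qed
  show "(\<exists>k. pullback c V = ?e ^ k *\<^sub>F V') \<and> \<not> (?e dvd fst V' \<and> ?e dvd snd V')"
    using assms by blast
  fix U assume "(\<exists>k. pullback c V = ?e ^ k *\<^sub>F U) \<and> \<not> (?e dvd fst U \<and> ?e dvd snd U)"
  then obtain l where l: "pullback c V = ?e ^ l *\<^sub>F U" and U: "\<not> (?e dvd fst U \<and> ?e dvd snd U)"
    by blast
  have eq: "?e ^ l *\<^sub>F U = ?e ^ k *\<^sub>F V'" using l assms(1) by simp
  have "l = k"
    using less[of l k U V'] less[of k l V' U] eq U assms(2) by (metis linorder_neqE_nat)
  then show "U = V'" using eq e by (auto simp: form_scale_def prod_eq_iff)
qed

lemma fps_X_plus_const_power_0: "fps_nth ((fps_X + fps_const (t :: complex)) ^ j) 0 = t ^ j"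
  by (simp add: fps_power_zeroth)

lemma fps_X_plus_const_power_1:
  "fps_nth ((fps_X + fps_const (t :: complex)) ^ j) (Suc 0) = of_nat j * t ^ (j - 1)"
proof (induction j)
  case (Suc j)
  then show ?case by (cases j) (simp_all add: distrib_right fps_X_plus_const_power_0 algebra_simps)
qed simp

lemma cps_coeff_blowup_fin:
  "cps_coeff (cps_blowup_fin t F) k l =
    (\<Sum>j\<le>k. cps_coeff F (k - j) j * fps_nth ((fps_X + fps_const t) ^ j) l)"
  by (simp add: cps_coeff_def cps_blowup_fin.rep_eq fps_blowup_fin_def fps_sum_nth)

lemma cps_coeff_blowup_inf:
  "cps_coeff (cps_blowup_inf F) k l = (if l < k then 0 else cps_coeff F k (l - k))"
  by (simp add: cps_coeff_def cps_blowup_inf.rep_eq fps_blowup_inf_def fps_X_power_mult_nth)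

definition vanishes_to_order :: "nat \<Rightarrow> form \<Rightarrow> bool" where
  "vanishes_to_order \<nu> V \<longleftrightarrow>
    (\<forall>i j. i + j < \<nu> \<longrightarrow> cps_coeff (fst V) i j = 0 \<and> cps_coeff (snd V) i j = 0)"

text \<open>
  For \<open>V = R dx + S dy\<close> with leading homogeneous parts of degree \<open>\<nu>\<close>, the tangent cone
  \<open>x R\<^sub>\<nu> + y S\<^sub>\<nu>\<close> and the part \<open>S\<^sub>\<nu>\<close>, both restricted to the line \<open>x = 1\<close>.
\<close>

definition tangent_cone :: "nat \<Rightarrow> form \<Rightarrow> complex poly" where
  "tangent_cone \<nu> V = (\<Sum>j\<le>\<nu>. monom (cps_coeff (fst V) (\<nu> - j) j) j
    + monom (cps_coeff (snd V) (\<nu> - j) j) (j + 1))"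

definition leading_snd :: "nat \<Rightarrow> form \<Rightarrow> complex poly" where
  "leading_snd \<nu> V = (\<Sum>j\<le>\<nu>. monom (cps_coeff (snd V) (\<nu> - j) j) j)"

text \<open>
  The strict transform is the pull-back divided by \<open>x\<^sup>\<nu>\<close> whenever the tangent cone is not zero; its
  linear part depends on the leading homogeneous part of \<open>V\<close> only, except for the coefficient of
  \<open>x dx\<close>, which does not enter the eigenvalues.
\<close>

lemma blowup_fin_germ:
  assumes "vanishes_to_order \<nu> V"
  obtains V' where "pullback (Some t) V = cps_X ^ \<nu> *\<^sub>F V'"
    "cps_coeff (fst V') 0 0 = poly (tangent_cone \<nu> V) t"
    "cps_coeff (fst V') 0 1 = poly (pderiv (tangent_cone \<nu> V)) t"
    "cps_coeff (snd V') 0 0 = 0" "cps_coeff (snd V') 0 1 = 0"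
    "cps_coeff (snd V') 1 0 = poly (leading_snd \<nu> V) t"
proof -
  obtain R S where V: "V = (R, S)" by force
  have low: "cps_coeff R i j = 0" "cps_coeff S i j = 0" if "i + j < \<nu>" for i j
    using assms that by (auto simp: vanishes_to_order_def V)
  have low': "cps_coeff (cps_blowup_fin t R) k l = 0" "cps_coeff (cps_blowup_fin t S) k l = 0"
    if "k < \<nu>" for k l
    using that by (auto simp: cps_coeff_blowup_fin low intro!: sum.neutral)
  define A where "A = cps_blowup_fin t R + (cps_Y + cps_const t) * cps_blowup_fin t S"
  define B where "B = cps_X * cps_blowup_fin t S"
  have pb: "pullback (Some t) V = (A, B)" by (simp add: V A_def B_def)
  have A: "cps_coeff A k l = cps_coeff (cps_blowup_fin t R) k l + t * cps_coeff (cps_blowup_fin t S) k l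
      + (if l = 0 then 0 else cps_coeff (cps_blowup_fin t S) k (l - 1))" for k l
    by (simp add: A_def distrib_right cps_coeff_Y_mult)
  have B: "cps_coeff B k l = (if k = 0 then 0 else cps_coeff (cps_blowup_fin t S) (k - 1) l)" for k l
    by (simp add: B_def cps_coeff_X_mult)
  have A0: "cps_coeff A k l = 0" if "k < \<nu>" for k l using that by (simp add: A low')
  have B0: "cps_coeff B k l = 0" if "k < \<nu>" for k l using that by (simp add: B low')
  obtain A' where A': "A = cps_X ^ \<nu> * A'" "\<And>i j. cps_coeff A' i j = cps_coeff A (i + \<nu>) j"
    using cps_X_power_factor[of \<nu> A, OF A0] by metis
  obtain B' where B': "B = cps_X ^ \<nu> * B'" "\<And>i j. cps_coeff B' i j = cps_coeff B (i + \<nu>) j"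
    using cps_X_power_factor[of \<nu> B, OF B0] by metis
  show thesis
  proof (rule that[of "(A', B')"])
    show "pullback (Some t) V = cps_X ^ \<nu> *\<^sub>F (A', B')"
      by (simp add: pb form_scale_def A'(1) B'(1))
    show "cps_coeff (fst (A', B')) 0 0 = poly (tangent_cone \<nu> V) t"
      by (simp add: A'(2) A cps_coeff_blowup_fin fps_X_plus_const_power_0 tangent_cone_def V
          poly_sum poly_monom sum.distrib sum_distrib_left mult_ac)
    have *: "t * (c * (of_nat j * t ^ (j - Suc 0))) = of_nat j * (c * t ^ j)" for c j
      by (cases j) auto
    have "poly (pderiv (tangent_cone \<nu> V)) t = (\<Sum>j\<le>\<nu>. cps_coeff R (\<nu> - j) j * (of_nat j * t ^ (j - 1))
        + of_nat (Suc j) * (cps_coeff S (\<nu> - j) j * t ^ j))"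
      unfolding tangent_cone_def higher_pderiv_sum[of 1, simplified] poly_sum
      by (intro sum.cong refl) (simp add: pderiv_add pderiv_monom poly_monom V algebra_simps)
    also have "\<dots> = cps_coeff A \<nu> 1"
      by (simp add: A cps_coeff_blowup_fin fps_X_plus_const_power_0 fps_X_plus_const_power_1
          sum_distrib_left sum.distrib * distrib_right)
    finally show "cps_coeff (fst (A', B')) 0 1 = poly (pderiv (tangent_cone \<nu> V)) t"
      by (simp add: A'(2))
    show "cps_coeff (snd (A', B')) 0 0 = 0" "cps_coeff (snd (A', B')) 0 1 = 0"
      by (cases \<nu>; simp add: B'(2) B low')+
    show "cps_coeff (snd (A', B')) 1 0 = poly (leading_snd \<nu> V) t"
      by (simp add: B'(2) B cps_coeff_blowup_fin fps_X_plus_const_power_0 leading_snd_def V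
          poly_sum poly_monom)
  qed
qed

lemma blowup_fin_regular:
  assumes "vanishes_to_order \<nu> V" "poly (tangent_cone \<nu> V) t \<noteq> 0"
  shows "\<not> singular (strict_transform (Some t) V)"
proof -
  obtain V' where V': "pullback (Some t) V = cps_X ^ \<nu> *\<^sub>F V'"
    "cps_coeff (fst V') 0 0 = poly (tangent_cone \<nu> V) t"
    using blowup_fin_germ[OF assms(1), of t] by metis
  have "strict_transform (Some t) V = V'"
    by (rule strict_transform_eqI) (use V' assms(2) in \<open>auto simp: cps_X_dvd_iff\<close>)
  then show ?thesis using V' assms(2) by (simp add: singular_def)
qed

lemma blowup_fin_singular:
  assumes "vanishes_to_order \<nu> V" "poly (tangent_cone \<nu> V) t = 0"
    "poly (pderiv (tangent_cone \<nu> V)) t \<noteq> 0"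
  shows "singular (strict_transform (Some t) V)"
    "eigenvalues (linear_part (strict_transform (Some t) V))
      (- poly (leading_snd \<nu> V) t) (poly (pderiv (tangent_cone \<nu> V)) t)"
proof -
  obtain V' where V': "pullback (Some t) V = cps_X ^ \<nu> *\<^sub>F V'"
    "cps_coeff (fst V') 0 0 = poly (tangent_cone \<nu> V) t"
    "cps_coeff (fst V') 0 1 = poly (pderiv (tangent_cone \<nu> V)) t"
    "cps_coeff (snd V') 0 0 = 0" "cps_coeff (snd V') 0 1 = 0"
    "cps_coeff (snd V') 1 0 = poly (leading_snd \<nu> V) t"
    using blowup_fin_germ[OF assms(1), of t] by metis
  have "cps_coeff (fst V') 0 1 \<noteq> 0" using V'(3) assms(3) by simp
  then have st: "strict_transform (Some t) V = V'"
    by (intro strict_transform_eqI[where k = \<nu>]) (use V'(1) in \<open>auto simp: cps_X_dvd_iff\<close>)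
  show "singular (strict_transform (Some t) V)"
    unfolding st using V' assms(2) by (simp add: singular_def)
  show "eigenvalues (linear_part (strict_transform (Some t) V))
      (- poly (leading_snd \<nu> V) t) (poly (pderiv (tangent_cone \<nu> V)) t)"
    using triangular_eigenvalues[of V', OF disjI1[OF V'(5)]] unfolding st V'(3) V'(6) .
qed

text \<open>
  In the other chart only the direction \<open>[0 : 1]\<close> occurs, so that single coefficients take the
  place of the values of the tangent cone and its derivative.
\<close>

lemma blowup_inf_germ:
  assumes "vanishes_to_order \<nu> V"
  obtains V' where "pullback None V = cps_Y ^ \<nu> *\<^sub>F V'"
    "cps_coeff (snd V') 0 0 = cps_coeff (snd V) 0 \<nu>"
    "0 < \<nu> \<Longrightarrow> cps_coeff (snd V') 1 0 = cps_coeff (fst V) 0 \<nu> + cps_coeff (snd V) 1 (\<nu> - 1)"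
    "cps_coeff (fst V') 0 0 = 0" "cps_coeff (fst V') 1 0 = 0"
    "cps_coeff (fst V') 0 1 = cps_coeff (fst V) 0 \<nu>"
proof -
  obtain R S where V: "V = (R, S)" by force
  have low: "cps_coeff R i j = 0" "cps_coeff S i j = 0" if "i + j < \<nu>" for i j
    using assms that by (auto simp: vanishes_to_order_def V)
  have low': "cps_coeff (cps_blowup_inf R) k l = 0" "cps_coeff (cps_blowup_inf S) k l = 0"
    if "l < \<nu>" for k l
    using that by (auto simp: cps_coeff_blowup_inf low)
  define A where "A = cps_Y * cps_blowup_inf R"
  define B where "B = cps_X * cps_blowup_inf R + cps_blowup_inf S"
  have pb: "pullback None V = (A, B)" by (simp add: V A_def B_def)
  have A: "cps_coeff A k l = (if l = 0 then 0 else cps_coeff (cps_blowup_inf R) k (l - 1))" for k l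
    by (simp add: A_def cps_coeff_Y_mult)
  have B: "cps_coeff B k l = (if k = 0 then 0 else cps_coeff (cps_blowup_inf R) (k - 1) l)
      + cps_coeff (cps_blowup_inf S) k l" for k l
    by (simp add: B_def cps_coeff_X_mult)
  have A0: "cps_coeff A k l = 0" if "l < \<nu>" for k l using that by (simp add: A low')
  have B0: "cps_coeff B k l = 0" if "l < \<nu>" for k l using that by (simp add: B low')
  obtain A' where A': "A = cps_Y ^ \<nu> * A'" "\<And>i j. cps_coeff A' i j = cps_coeff A i (j + \<nu>)"
    using cps_Y_power_factor[of \<nu> A, OF A0] by metis
  obtain B' where B': "B = cps_Y ^ \<nu> * B'" "\<And>i j. cps_coeff B' i j = cps_coeff B i (j + \<nu>)"
    using cps_Y_power_factor[of \<nu> B, OF B0] by metis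
  show thesis
  proof (rule that[of "(A', B')"])
    show "pullback None V = cps_Y ^ \<nu> *\<^sub>F (A', B')"
      by (simp add: pb form_scale_def A'(1) B'(1))
    show "cps_coeff (snd (A', B')) 0 0 = cps_coeff (snd V) 0 \<nu>"
      by (simp add: B'(2) B cps_coeff_blowup_inf V)
    show "cps_coeff (snd (A', B')) 1 0 = cps_coeff (fst V) 0 \<nu> + cps_coeff (snd V) 1 (\<nu> - 1)"
      if "0 < \<nu>"
      using that by (simp add: B'(2) B cps_coeff_blowup_inf V)
    show "cps_coeff (fst (A', B')) 0 0 = 0" "cps_coeff (fst (A', B')) 1 0 = 0"
      by (simp_all add: A'(2) A low')
    show "cps_coeff (fst (A', B')) 0 1 = cps_coeff (fst V) 0 \<nu>"
      by (simp add: A'(2) A cps_coeff_blowup_inf V)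
  qed
qed

lemma blowup_inf_regular:
  assumes "vanishes_to_order \<nu> V" "cps_coeff (snd V) 0 \<nu> \<noteq> 0"
  shows "\<not> singular (strict_transform None V)"
proof -
  obtain V' where V': "pullback None V = cps_Y ^ \<nu> *\<^sub>F V'"
    "cps_coeff (snd V') 0 0 = cps_coeff (snd V) 0 \<nu>"
    using blowup_inf_germ[OF assms(1)] by metis
  have "strict_transform None V = V'"
    by (rule strict_transform_eqI) (use V' assms(2) in \<open>auto simp: cps_Y_dvd_iff\<close>)
  then show ?thesis using V' assms(2) by (simp add: singular_def)
qed

lemma blowup_inf_singular:
  assumes "vanishes_to_order \<nu> V" "cps_coeff (snd V) 0 \<nu> = 0" "0 < \<nu>"
    "cps_coeff (fst V) 0 \<nu> + cps_coeff (snd V) 1 (\<nu> - 1) \<noteq> 0"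
  shows "singular (strict_transform None V)"
    "eigenvalues (linear_part (strict_transform None V))
      (- (cps_coeff (fst V) 0 \<nu> + cps_coeff (snd V) 1 (\<nu> - 1))) (cps_coeff (fst V) 0 \<nu>)"
proof -
  obtain V' where V': "pullback None V = cps_Y ^ \<nu> *\<^sub>F V'"
    "cps_coeff (snd V') 0 0 = cps_coeff (snd V) 0 \<nu>"
    "cps_coeff (snd V') 1 0 = cps_coeff (fst V) 0 \<nu> + cps_coeff (snd V) 1 (\<nu> - 1)"
    "cps_coeff (fst V') 0 0 = 0" "cps_coeff (fst V') 1 0 = 0"
    "cps_coeff (fst V') 0 1 = cps_coeff (fst V) 0 \<nu>"
    using blowup_inf_germ[OF assms(1)] assms(3) by metis
  have "cps_coeff (snd V') 1 0 \<noteq> 0" using V'(3) assms(4) by simp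
  then have st: "strict_transform None V = V'"
    by (intro strict_transform_eqI[where k = \<nu>]) (use V'(1) in \<open>auto simp: cps_Y_dvd_iff\<close>)
  show "singular (strict_transform None V)"
    unfolding st using V' assms(2) by (simp add: singular_def)
  show "eigenvalues (linear_part (strict_transform None V))
      (- (cps_coeff (fst V) 0 \<nu> + cps_coeff (snd V) 1 (\<nu> - 1))) (cps_coeff (fst V) 0 \<nu>)"
    using triangular_eigenvalues[of V', OF disjI2[OF V'(5)]] unfolding st V'(3) V'(6) .
qed

section \<open>Towers of blow-ups\<close>

definition regular_or_simple :: "form \<Rightarrow> bool" where
  "regular_or_simple V \<longleftrightarrow> (singular V \<longrightarrow> simple_singularity V)"

text \<open>
  \<open>V'\<close> is reached from \<open>V\<close> by blowing up non-irreducible points in such a way that at each stage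
  only one point of the exceptional divisor is left to be considered.
\<close>

inductive reduces_to :: "form \<Rightarrow> form \<Rightarrow> bool" where
  refl: "reduces_to V V"
| blowup: "reduces_to V V'" if "singular V" "\<not> irreducible_singularity V"
    "\<And>c. c \<noteq> c0 \<Longrightarrow> regular_or_simple (strict_transform c V)"
    "reduces_to (strict_transform c0 V) V'"

lemma reduces_to_trans: "reduces_to U V \<Longrightarrow> reduces_to V V' \<Longrightarrow> reduces_to U V'"
  by (induction rule: reduces_to.induct) (auto intro: reduces_to.blowup)

lemma germ_at_Cons: "germ_at V (c # cs) = germ_at (strict_transform c V) cs"
  by (simp add: germ_at_def)

lemma germ_at_Nil: "germ_at V [] = V"
  by (simp add: germ_at_def)

text \<open>
  The centres of the tower, one over the other, form a reduction of singularities.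
\<close>

lemma generalized_curve_reduces_to:
  assumes "reduces_to V V'" "regular_or_simple V'"
  shows "generalized_curve V"
proof -
  have "\<exists>T. blowup_centres T \<and>
      (\<forall>cs\<in>T. singular (germ_at V cs) \<and> \<not> irreducible_singularity (germ_at V cs)) \<and>
      (\<forall>cs\<in>points_after T. regular_or_simple (germ_at V cs))"
    using assms
  proof (induction rule: reduces_to.induct)
    case (refl V)
    then show ?case
      by (intro exI[of _ "{}"]) (auto simp: blowup_centres_def points_after_def germ_at_Nil)
  next
    case (blowup V c0 V')
    obtain T where "blowup_centres T"
      and T: "\<forall>cs\<in>T. singular (germ_at (strict_transform c0 V) cs) \<and>
        \<not> irreducible_singularity (germ_at (strict_transform c0 V) cs)"
      "\<forall>cs\<in>points_after T. regular_or_simple (germ_at (strict_transform c0 V) cs)"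
      using blowup.IH[OF blowup.prems] by blast
    then have fin: "finite T" and prefix: "\<And>cs c. cs @ [c] \<in> T \<Longrightarrow> cs \<in> T"
      unfolding blowup_centres_def by blast+
    let ?T = "insert [] ((#) c0 ` T)"
    have closed: "cs \<in> ?T" if "cs @ [c] \<in> ?T" for cs c
      using that prefix by (cases cs) auto
    have after: "regular_or_simple (germ_at V cs)" if cs: "cs \<in> points_after ?T" for cs
    proof -
      from cs have "cs \<noteq> []" "cs \<notin> ?T" "butlast cs \<in> ?T" by (auto simp: points_after_def)
      then obtain c cs' where c: "cs = c # cs'" by (cases cs) auto
      show ?thesis
      proof (cases "c = c0")
        case True
        then have "cs' \<in> points_after T"
          using \<open>cs \<notin> ?T\<close> \<open>butlast cs \<in> ?T\<close> by (cases "cs' = []") (auto simp: c points_after_def)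
        then show ?thesis using T(2) True by (simp add: c germ_at_Cons)
      next
        case False
        then have "cs' = []" using \<open>butlast cs \<in> ?T\<close> by (cases "cs' = []") (auto simp: c)
        then show ?thesis using blowup(3)[OF False] by (simp add: c germ_at_Cons germ_at_Nil)
      qed
    qed
    have inside: "singular (germ_at V cs) \<and> \<not> irreducible_singularity (germ_at V cs)"
      if "cs \<in> ?T" for cs
      using that T(1) blowup(1,2) by (auto simp: germ_at_Nil germ_at_Cons)
    show ?case
      unfolding blowup_centres_def
      using fin closed inside after by (intro exI[of _ ?T]) blast
  qed
  then obtain T where "blowup_centres T"
    "\<forall>cs\<in>T. singular (germ_at V cs) \<and> \<not> irreducible_singularity (germ_at V cs)"
    "\<forall>cs\<in>points_after T. regular_or_simple (germ_at V cs)" by blast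
  moreover from this have "\<forall>cs\<in>points_after T. \<not> saddle_node (germ_at V cs)"
    unfolding regular_or_simple_def using simple_not_saddle_node saddle_node_def by blast
  ultimately show ?thesis
    unfolding generalized_curve_def reduction_of_singularities_def
    by (intro exI[of _ T]) (auto simp: regular_or_simple_def irreducible_singularity_def)
qed

lemma saddle_node_at_origin:
  assumes "saddle_node V" "reduction_of_singularities V T"
  shows "\<exists>cs\<in>points_after T. saddle_node (germ_at V cs)"
proof -
  have "[] \<notin> T"
    using assms by (auto simp: reduction_of_singularities_def germ_at_Nil irreducible_singularity_def)
  then have "[] \<in> points_after T" by (simp add: points_after_def)
  then show ?thesis using assms(1) by (intro bexI[of _ "[]"]) (simp_all add: germ_at_Nil)
qed

text \<open>
  A point that is not irreducible has to be blown up and one that is irreducible must not, so a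
  reduction of singularities contains the whole tower and stops exactly at the saddle-node.
\<close>

lemma saddle_node_over_centre:
  assumes "singular V" "\<not> irreducible_singularity V"
    and T: "reduction_of_singularities V T"
    and sub: "\<And>T'. reduction_of_singularities (strict_transform c V) T' \<Longrightarrow>
      \<exists>cs\<in>points_after T'. saddle_node (germ_at (strict_transform c V) cs)"
  shows "\<exists>cs\<in>points_after T. saddle_node (germ_at V cs)"
proof -
  have nil: "[] \<in> T"
  proof (rule ccontr)
    assume "[] \<notin> T"
    then have "[] \<in> points_after T" by (simp add: points_after_def)
    then show False using T assms(1,2) by (auto simp: reduction_of_singularities_def germ_at_Nil)
  qed
  define T' where "T' = {cs. c # cs \<in> T}"
  have "finite T'"
  proof -
    have "finite ((#) c -` T)"
      using T by (intro finite_vimageI) (auto simp: reduction_of_singularities_def blowup_centres_def)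
    then show ?thesis by (simp add: T'_def vimage_def)
  qed
  moreover have "cs \<in> T'" if "cs @ [c'] \<in> T'" for cs c'
  proof -
    have "(c # cs) @ [c'] \<in> T" using that by (simp add: T'_def)
    then show ?thesis
      using T unfolding T'_def mem_Collect_eq reduction_of_singularities_def blowup_centres_def by blast
  qed
  moreover have after: "c # cs \<in> points_after T" if "cs \<in> points_after T'" for cs
    using that nil by (cases "cs = []") (auto simp: points_after_def T'_def)
  ultimately have "reduction_of_singularities (strict_transform c V) T'"
    using T unfolding reduction_of_singularities_def blowup_centres_def germ_at_Cons[symmetric]
    by (auto simp: T'_def)
  then show ?thesis using sub after by (metis germ_at_Cons)
qed

lemma not_generalized_curve_reduces_to:
  assumes "reduces_to V V'"
    and "singular V'" "\<not> irreducible_singularity V'" "saddle_node (strict_transform c V')"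
  shows "\<not> generalized_curve V"
proof -
  have "\<exists>cs\<in>points_after T. saddle_node (germ_at V cs)" if "reduction_of_singularities V T" for T
    using assms that
  proof (induction arbitrary: T rule: reduces_to.induct)
    case (refl V)
    show ?case by (rule saddle_node_over_centre[OF refl(1,2,4), of c]) (rule saddle_node_at_origin[OF refl(3)])
  next
    case (blowup V c0 V')
    show ?case
      by (rule saddle_node_over_centre[OF blowup(1,2,9), of c0]) (rule blowup.IH[OF blowup(6-8)])
  qed
  then show ?thesis unfolding generalized_curve_def by blast
qed

lemma not_generalized_curve_saddle_node: "saddle_node V \<Longrightarrow> \<not> generalized_curve V"
  using saddle_node_at_origin unfolding generalized_curve_def by blast

section \<open>Coefficients indexed by the integers\<close>

text \<open>
  Monomial substitutions act linearly on exponents.  Extending the coefficients by zero to negative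
  exponents makes the formulas for the coefficients of a blow-up free of case distinctions.
\<close>

definition zcoeff :: "cps \<Rightarrow> int \<Rightarrow> int \<Rightarrow> complex" where
  "zcoeff F k l = (if 0 \<le> k \<and> 0 \<le> l then cps_coeff F (nat k) (nat l) else 0)"

lemma zcoeff_of_nat: "zcoeff F (int k) (int l) = cps_coeff F k l"
  by (simp add: zcoeff_def)

lemma zcoeff_add: "zcoeff (F + G) k l = zcoeff F k l + zcoeff G k l"
  by (simp add: zcoeff_def)

lemma zcoeff_uminus: "zcoeff (- F) k l = - zcoeff F k l"
  by (simp add: zcoeff_def)

lemma zcoeff_of_nat_mult: "zcoeff (of_nat c * F) k l = of_nat c * zcoeff F k l"
  by (simp add: zcoeff_def)

lemma zcoeff_X_mult: "zcoeff (cps_X * F) k l = zcoeff F (k - 1) l"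
  by (auto simp: zcoeff_def cps_coeff_X_mult nat_diff_distrib)

lemma zcoeff_Y_mult: "zcoeff (cps_Y * F) k l = zcoeff F k (l - 1)"
  by (auto simp: zcoeff_def cps_coeff_Y_mult nat_diff_distrib)

lemma zcoeff_X_power: "zcoeff (cps_X ^ a) k l = (if k = int a \<and> l = 0 then 1 else 0)"
  by (auto simp: zcoeff_def cps_coeff_X_power)

lemma zcoeff_Y_power: "zcoeff (cps_Y ^ a) k l = (if k = 0 \<and> l = int a then 1 else 0)"
  by (auto simp: zcoeff_def cps_coeff_Y_power)

lemma zcoeff_blowup_fin_0: "zcoeff (cps_blowup_fin 0 F) k l = zcoeff F (k - l) l"
proof (cases "0 \<le> k \<and> 0 \<le> l")
  case True
  have "cps_coeff (cps_blowup_fin 0 F) (nat k) (nat l)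
      = (\<Sum>j\<le>nat k. if j = nat l then cps_coeff F (nat k - nat l) (nat l) else 0)"
    unfolding cps_coeff_blowup_fin by (intro sum.cong) (auto simp: fps_X_power_nth)
  then show ?thesis using True by (auto simp: zcoeff_def nat_diff_distrib)
qed (auto simp: zcoeff_def)

lemma zcoeff_blowup_inf: "zcoeff (cps_blowup_inf F) k l = zcoeff F k (l - k)"
  by (auto simp: zcoeff_def cps_coeff_blowup_inf nat_diff_distrib)

lemma zcoeff_X_factor:
  assumes "\<And>k l. k < int K \<Longrightarrow> zcoeff F k l = 0"
  obtains G where "F = cps_X ^ K * G"
    "\<And>k l. zcoeff G k l = (if k < 0 then 0 else zcoeff F (k + int K) l)"
proof -
  have low: "cps_coeff F i j = 0" if "i < K" for i j
    using assms[of "int i" "int j"] that by (simp add: zcoeff_of_nat)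
  obtain G where G: "F = cps_X ^ K * G" "\<And>i j. cps_coeff G i j = cps_coeff F (i + K) j"
    using cps_X_power_factor[of K F, OF low] by metis
  have "zcoeff G k l = (if k < 0 then 0 else zcoeff F (k + int K) l)" for k l
    by (auto simp: zcoeff_def G(2) nat_add_distrib)
  then show thesis by (rule that[OF G(1)])
qed

lemma zcoeff_Y_factor:
  assumes "\<And>k l. l < int K \<Longrightarrow> zcoeff F k l = 0"
  obtains G where "F = cps_Y ^ K * G"
    "\<And>k l. zcoeff G k l = (if l < 0 then 0 else zcoeff F k (l + int K))"
proof -
  have low: "cps_coeff F i j = 0" if "j < K" for i j
    using assms[of "int j" "int i"] that by (simp add: zcoeff_of_nat)
  obtain G where G: "F = cps_Y ^ K * G" "\<And>i j. cps_coeff G i j = cps_coeff F i (j + K)"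
    using cps_Y_power_factor[of K F, OF low] by metis
  have "zcoeff G k l = (if l < 0 then 0 else zcoeff F k (l + int K))" for k l
    by (auto simp: zcoeff_def G(2) nat_add_distrib)
  then show thesis by (rule that[OF G(1)])
qed

lemma vanishes_to_order_zcoeff:
  assumes "\<And>k l. k + l < int \<nu> \<Longrightarrow> zcoeff (fst V) k l = 0 \<and> zcoeff (snd V) k l = 0"
  shows "vanishes_to_order \<nu> V"
  unfolding vanishes_to_order_def
proof (intro allI impI)
  fix i j assume "i + j < \<nu>"
  then show "cps_coeff (fst V) i j = 0 \<and> cps_coeff (snd V) i j = 0"
    using assms[of "int i" "int j"] by (simp add: zcoeff_of_nat)
qed

lemma coeff_tangent_cone: "coeff (tangent_cone \<nu> V) j =
    zcoeff (fst V) (int \<nu> - int j) (int j) + zcoeff (snd V) (int \<nu> + 1 - int j) (int j - 1)"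
proof -
  have "coeff (tangent_cone \<nu> V) j =
      (\<Sum>i\<le>\<nu>. if i = j then cps_coeff (fst V) (\<nu> - j) j else 0)
      + (\<Sum>i\<le>\<nu>. if i + 1 = j then cps_coeff (snd V) (\<nu> - (j - 1)) (j - 1) else 0)"
    unfolding tangent_cone_def coeff_sum sum.distrib[symmetric]
    by (intro sum.cong refl) auto
  also have "(\<Sum>i\<le>\<nu>. if i = j then cps_coeff (fst V) (\<nu> - j) j else 0)
      = zcoeff (fst V) (int \<nu> - int j) (int j)"
    by (auto simp: zcoeff_def nat_diff_distrib)
  also have "(\<Sum>i\<le>\<nu>. if i + 1 = j then cps_coeff (snd V) (\<nu> - (j - 1)) (j - 1) else 0)
      = zcoeff (snd V) (int \<nu> + 1 - int j) (int j - 1)"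
    by (cases j) (auto simp: zcoeff_def nat_diff_distrib)
  finally show ?thesis .
qed

lemma coeff_leading_snd: "coeff (leading_snd \<nu> V) j = zcoeff (snd V) (int \<nu> - int j) (int j)"
proof -
  have "coeff (leading_snd \<nu> V) j = (\<Sum>i\<le>\<nu>. if i = j then cps_coeff (snd V) (\<nu> - j) j else 0)"
    unfolding leading_snd_def coeff_sum by (intro sum.cong refl) auto
  then show ?thesis by (auto simp: zcoeff_def nat_diff_distrib)
qed

section \<open>The toric part of the reduction\<close>

text \<open>
  The assumption on \<open>h\<close> says that its weighted order is at least \<open>m n - n - m\<close>.
\<close>

locale quasi_homogeneous_form =
  fixes n m :: nat and h :: cps
  assumes two_le_n: "2 \<le> n" and n_le_m: "n \<le> m"
    and weight: "\<And>i j. cps_coeff h i j \<noteq> 0 \<Longrightarrow> n * m \<le> n * (i + 1) + m * (j + 1)"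
begin

text \<open>
  A composition of blow-ups at the origins of the charts is a monomial map
  \<open>x = X\<^sup>\<alpha> Y\<^sup>\<beta>\<close>, \<open>y = X\<^sup>\<gamma> Y\<^sup>\<delta>\<close> with \<open>\<alpha> \<delta> - \<beta> \<gamma> = 1\<close>.  It turns \<open>y\<^sup>n - x\<^sup>m\<close> into
  \<open>X\<^sup>\<gamma>\<^sup>n Y\<^sup>\<beta>\<^sup>m (Y\<^sup>n\<^sup>1 - X\<^sup>m\<^sup>1)\<close>, where \<open>n1\<close> and \<open>m1\<close> are the two exponents defined next.
\<close>

definition n_exp :: "int \<Rightarrow> int \<Rightarrow> int" where
  "n_exp \<beta> \<delta> = int n * \<delta> - int m * \<beta>"

definition m_exp :: "int \<Rightarrow> int \<Rightarrow> int" where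
  "m_exp \<alpha> \<gamma> = int m * \<alpha> - int n * \<gamma>"

text \<open>
  With \<open>H = x y h\<close> one has \<open>W = - m (x\<^sup>m + H) dx / x + n (y\<^sup>n + H) dy / y\<close>.  In the logarithmic basis the
  pull-back is linear: \<open>dx / x\<close> becomes \<open>\<alpha> dX / X + \<beta> dY / Y\<close>, and \<open>dy / y\<close> becomes
  \<open>\<gamma> dX / X + \<delta> dY / Y\<close>.  After division by \<open>X\<^sup>\<gamma>\<^sup>n Y\<^sup>\<beta>\<^sup>m\<close> the coefficients of \<open>dX / X\<close> and \<open>dY / Y\<close> are
  \<open>- m \<alpha> X\<^sup>m\<^sup>1 + n \<gamma> Y\<^sup>n\<^sup>1 - m1 H'\<close> and \<open>- m \<beta> X\<^sup>m\<^sup>1 + n \<delta> Y\<^sup>n\<^sup>1 + n1 H'\<close>.  Here \<open>H'\<close> is the transform of \<open>H\<close>,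
  whose coefficients are obtained by inverting the map of exponents.
\<close>

definition pulled_coeff :: "int \<Rightarrow> int \<Rightarrow> int \<Rightarrow> int \<Rightarrow> int \<Rightarrow> int \<Rightarrow> complex" where
  "pulled_coeff \<alpha> \<beta> \<gamma> \<delta> i j =
    zcoeff h (\<delta> * (i + \<gamma> * int n) - \<gamma> * (j + \<beta> * int m) - 1)
             (\<alpha> * (j + \<beta> * int m) - \<beta> * (i + \<gamma> * int n) - 1)"

definition dx_coeff :: "int \<Rightarrow> int \<Rightarrow> int \<Rightarrow> int \<Rightarrow> int \<Rightarrow> int \<Rightarrow> complex" where
  "dx_coeff \<alpha> \<beta> \<gamma> \<delta> i j =
    (if i = m_exp \<alpha> \<gamma> \<and> j = 0 then - of_int (int m * \<alpha>) else 0)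
    + (if i = 0 \<and> j = n_exp \<beta> \<delta> then of_int (int n * \<gamma>) else 0)
    - of_int (m_exp \<alpha> \<gamma>) * pulled_coeff \<alpha> \<beta> \<gamma> \<delta> i j"

definition dy_coeff :: "int \<Rightarrow> int \<Rightarrow> int \<Rightarrow> int \<Rightarrow> int \<Rightarrow> int \<Rightarrow> complex" where
  "dy_coeff \<alpha> \<beta> \<gamma> \<delta> i j =
    (if i = m_exp \<alpha> \<gamma> \<and> j = 0 then - of_int (int m * \<beta>) else 0)
    + (if i = 0 \<and> j = n_exp \<beta> \<delta> then of_int (int n * \<delta>) else 0)
    + of_int (n_exp \<beta> \<delta>) * pulled_coeff \<alpha> \<beta> \<gamma> \<delta> i j"

definition toric_exponents :: "int \<Rightarrow> int \<Rightarrow> int \<Rightarrow> int \<Rightarrow> bool" where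
  "toric_exponents \<alpha> \<beta> \<gamma> \<delta> \<longleftrightarrow> 1 \<le> \<alpha> \<and> 0 \<le> \<beta> \<and> 0 \<le> \<gamma> \<and> 1 \<le> \<delta> \<and> \<alpha> * \<delta> = \<beta> * \<gamma> + 1
    \<and> 0 < n_exp \<beta> \<delta> \<and> 0 < m_exp \<alpha> \<gamma> \<and> (0 < \<beta> \<longrightarrow> 0 < \<gamma>)"

text \<open>
  The value is 1 if the axis is exceptional and 0 otherwise: \<open>X = 0\<close> is exceptional if \<open>\<gamma> > 0\<close>, and
  \<open>Y = 0\<close> if \<open>\<beta> > 0\<close>.  The germ of the strict transform is the logarithmic form multiplied by the
  equations of the exceptional axes.
\<close>

definition divisor :: "int \<Rightarrow> int" where
  "divisor \<gamma> = (if \<gamma> = 0 then 0 else 1)"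

definition toric_germ :: "int \<Rightarrow> int \<Rightarrow> int \<Rightarrow> int \<Rightarrow> form \<Rightarrow> bool" where
  "toric_germ \<alpha> \<beta> \<gamma> \<delta> V \<longleftrightarrow> (\<forall>k l.
    zcoeff (fst V) k l = dx_coeff \<alpha> \<beta> \<gamma> \<delta> (k + 1 - divisor \<gamma>) (l - divisor \<beta>) \<and>
    zcoeff (snd V) k l = dy_coeff \<alpha> \<beta> \<gamma> \<delta> (k - divisor \<gamma>) (l + 1 - divisor \<beta>))"

lemma toric_germ_origin: "toric_germ 1 0 0 1 (model_form n m h)"
proof -
  have exp: "m_exp 1 0 = int m" "n_exp 0 1 = int n" by (simp_all add: m_exp_def n_exp_def)
  have pulled: "pulled_coeff 1 0 0 1 i j = zcoeff h (i - 1) (j - 1)" for i j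
    by (simp add: pulled_coeff_def)
  have "zcoeff (fst (model_form n m h)) k l = dx_coeff 1 0 0 1 (k + 1) l" for k l
  proof -
    have k: "k = int (m - 1) \<longleftrightarrow> k + 1 = int m" using two_le_n n_le_m by auto
    have "zcoeff (fst (model_form n m h)) k l
        = - (of_nat m * ((if k = int (m - 1) \<and> l = 0 then 1 else 0) + zcoeff h k (l - 1)))"
      by (simp only: model_form_fst zcoeff_add zcoeff_uminus zcoeff_of_nat_mult zcoeff_X_power
          mult.commute[of h] zcoeff_Y_mult)
    moreover obtain c where "zcoeff h k (l - 1) = c" "pulled_coeff 1 0 0 1 (k + 1) l = c"
      by (simp add: pulled)
    ultimately show ?thesis
      unfolding dx_coeff_def exp k by (cases "k + 1 = int m \<and> l = 0") (auto simp: distrib_left)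
  qed
  moreover have "zcoeff (snd (model_form n m h)) k l = dy_coeff 1 0 0 1 k (l + 1)" for k l
  proof -
    have l: "l = int (n - 1) \<longleftrightarrow> l + 1 = int n" using two_le_n by auto
    have "zcoeff (snd (model_form n m h)) k l
        = of_nat n * ((if k = 0 \<and> l = int (n - 1) then 1 else 0) + zcoeff h (k - 1) l)"
      by (simp only: model_form_snd zcoeff_add zcoeff_of_nat_mult zcoeff_Y_power
          mult.commute[of h] zcoeff_X_mult)
    moreover obtain c where "zcoeff h (k - 1) l = c" "pulled_coeff 1 0 0 1 k (l + 1) = c"
      by (simp add: pulled)
    ultimately show ?thesis
      unfolding dy_coeff_def exp l by (cases "k = 0 \<and> l + 1 = int n") (auto simp: distrib_left)
  qed
  ultimately show ?thesis by (simp add: toric_germ_def divisor_def)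
qed

lemma toric_exponents_origin: "toric_exponents 1 0 0 1"
  using two_le_n n_le_m by (simp add: toric_exponents_def n_exp_def m_exp_def)

context
  fixes \<alpha> \<beta> \<gamma> \<delta> :: int
  assumes exps: "toric_exponents \<alpha> \<beta> \<gamma> \<delta>"
begin

abbreviation "n1 \<equiv> n_exp \<beta> \<delta>"
abbreviation "m1 \<equiv> m_exp \<alpha> \<gamma>"

lemma exps_facts: "1 \<le> \<alpha>" "0 \<le> \<beta>" "0 \<le> \<gamma>" "1 \<le> \<delta>" "\<alpha> * \<delta> = \<beta> * \<gamma> + 1" "0 < n1" "0 < m1"
  "0 < \<beta> \<Longrightarrow> 0 < \<gamma>"
  using exps by (auto simp: toric_exponents_def)

text \<open>
  The Newton polygon of \<open>H\<close> lies above the segment from \<open>(m, 0)\<close> to \<open>(0, n)\<close> and does not contain its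
  vertices, as \<open>H\<close> is divisible by \<open>x y\<close>.  The map of exponents carries the segment to the one from
  \<open>(m1, 0)\<close> to \<open>(0, n1)\<close>.
\<close>

lemma pulled_coeff_support:
  assumes nz: "pulled_coeff \<alpha> \<beta> \<gamma> \<delta> i j \<noteq> 0"
  shows "1 \<le> i" "1 \<le> j" "n1 * m1 \<le> n1 * i + m1 * j"
proof -
  \<comment> \<open>The exponents of \<open>x\<close> and \<open>y\<close> in the monomial that is sent to \<open>X\<^sup>i Y\<^sup>j\<close>.\<close>
  define I where "I = \<delta> * (i + \<gamma> * int n) - \<gamma> * (j + \<beta> * int m)"
  define J where "J = \<alpha> * (j + \<beta> * int m) - \<beta> * (i + \<gamma> * int n)"
  have "zcoeff h (I - 1) (J - 1) \<noteq> 0" using nz by (simp add: pulled_coeff_def I_def J_def)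
  then have IJ: "1 \<le> I" "1 \<le> J" and c: "cps_coeff h (nat (I - 1)) (nat (J - 1)) \<noteq> 0"
    by (auto simp: zcoeff_def split: if_splits)
  have "int (n * m) \<le> int (n * (nat (I - 1) + 1) + m * (nat (J - 1) + 1))"
    using weight[OF c] by (simp only: of_nat_le_iff)
  then have w: "int n * int m \<le> int n * I + int m * J" using IJ by (simp add: algebra_simps)
  have i: "i + \<gamma> * int n = \<alpha> * I + \<gamma> * J"
    using exps_facts(5) unfolding I_def J_def by algebra
  have j: "j + \<beta> * int m = \<beta> * I + \<delta> * J"
    using exps_facts(5) unfolding I_def J_def by algebra
  have nm: "n1 * m1 + n1 * \<gamma> * int n + m1 * \<beta> * int m = int n * int m"
    using exps_facts(5) unfolding n_exp_def m_exp_def by algebra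
  have "n1 * i + m1 * j + n1 * \<gamma> * int n + m1 * \<beta> * int m = int n * I + int m * J"
    using exps_facts(5) i j unfolding n_exp_def m_exp_def by algebra
  with nm w show "n1 * m1 \<le> n1 * i + m1 * j" by linarith
  have "\<gamma> * (int n * int m) \<le> \<gamma> * (int n * I + int m * J)"
    using w exps_facts(3) by (rule mult_left_mono)
  moreover have "int m * i = I * m1 + \<gamma> * (int n * I + int m * J) - \<gamma> * (int n * int m)"
    using i unfolding m_exp_def by algebra
  moreover have "0 < I * m1" using IJ exps_facts(7) by simp
  ultimately have "0 < int m * i" by linarith
  then show "1 \<le> i" using two_le_n n_le_m by (simp add: zero_less_mult_iff)
  have "\<beta> * (int n * int m) \<le> \<beta> * (int n * I + int m * J)"
    using w exps_facts(2) by (rule mult_left_mono)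
  moreover have "int n * j = J * n1 + \<beta> * (int n * I + int m * J) - \<beta> * (int n * int m)"
    using j unfolding n_exp_def by algebra
  moreover have "0 < J * n1" using IJ exps_facts(6) by simp
  ultimately have "0 < int n * j" by linarith
  then show "1 \<le> j" using two_le_n by (simp add: zero_less_mult_iff)
qed

lemma pulled_coeff_0: "i < 1 \<or> j < 1 \<Longrightarrow> pulled_coeff \<alpha> \<beta> \<gamma> \<delta> i j = 0"
  using pulled_coeff_support[of i j] by force

lemma pulled_coeff_degree:
  assumes "pulled_coeff \<alpha> \<beta> \<gamma> \<delta> i j \<noteq> 0"
  shows "min n1 m1 \<le> i + j" "n1 \<noteq> m1 \<Longrightarrow> min n1 m1 < i + j"
proof -
  note s = pulled_coeff_support[OF assms]
  have *: "(a :: int) \<le> i' + j' \<and> (a \<noteq> b \<longrightarrow> a < i' + j')"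
    if "a \<le> b" "0 < a" "1 \<le> i'" "1 \<le> j'" "a * b \<le> a * i' + b * j'" for a b i' j'
  proof (cases "a = b")
    case True
    then have "a * a \<le> a * (i' + j')" using that(5) by (simp add: distrib_left)
    then show ?thesis using that(2) True by simp
  next
    case False
    then have "a * i' < b * i'" using that by simp
    then have "b * a < b * (i' + j')" using that(5) by (simp add: distrib_left mult.commute)
    then show ?thesis using that(1,2) by (simp add: mult_less_cancel_left)
  qed
  have "min n1 m1 \<le> i + j \<and> (n1 \<noteq> m1 \<longrightarrow> min n1 m1 < i + j)"
  proof (cases "n1 \<le> m1")
    case True
    then show ?thesis using *[of n1 m1 i j] s exps_facts(6) by (simp add: min_def)
  next
    case False
    then show ?thesis using *[of m1 n1 j i] s exps_facts(7) by (simp add: min_def algebra_simps)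
  qed
  then show "min n1 m1 \<le> i + j" "n1 \<noteq> m1 \<Longrightarrow> min n1 m1 < i + j" by auto
qed

lemma dx_coeff_neg: "i < 0 \<or> j < 0 \<Longrightarrow> dx_coeff \<alpha> \<beta> \<gamma> \<delta> i j = 0"
  using exps_facts pulled_coeff_0[of i j] by (auto simp: dx_coeff_def)

lemma dy_coeff_neg: "i < 0 \<or> j < 0 \<Longrightarrow> dy_coeff \<alpha> \<beta> \<gamma> \<delta> i j = 0"
  using exps_facts pulled_coeff_0[of i j] by (auto simp: dy_coeff_def)

lemma dx_coeff_low: "i + j < min n1 m1 \<Longrightarrow> dx_coeff \<alpha> \<beta> \<gamma> \<delta> i j = 0"
  using exps_facts pulled_coeff_degree(1)[of i j] by (force simp: dx_coeff_def)

lemma dy_coeff_low: "i + j < min n1 m1 \<Longrightarrow> dy_coeff \<alpha> \<beta> \<gamma> \<delta> i j = 0"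
  using exps_facts pulled_coeff_degree(1)[of i j] by (force simp: dy_coeff_def)

lemma toric_germ_order:
  assumes "toric_germ \<alpha> \<beta> \<gamma> \<delta> V" "int \<nu> = min n1 m1 + divisor \<gamma> + divisor \<beta> - 1"
  shows "vanishes_to_order \<nu> V"
  by (rule vanishes_to_order_zcoeff)
    (use assms in \<open>auto simp: toric_germ_def intro!: dx_coeff_low dy_coeff_low\<close>)

text \<open>
  The contribution of \<open>H'\<close> to the sum of the two logarithmic coefficients is \<open>(n1 - m1) H'\<close>, which
  has either the factor zero or terms of higher degree only.
\<close>

lemma toric_germ_tangent_cone:
  assumes "toric_germ \<alpha> \<beta> \<gamma> \<delta> V" "int \<nu> = min n1 m1 + divisor \<gamma> + divisor \<beta> - 1"
  shows "coeff (tangent_cone \<nu> V) j =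
    (if m1 \<le> n1 \<and> int j = divisor \<beta> then - of_int (int m * (\<alpha> + \<beta>)) else 0)
    + (if n1 \<le> m1 \<and> int j = n1 + divisor \<beta> then of_int (int n * (\<gamma> + \<delta>)) else 0)"
proof -
  define i' j' where "i' = min n1 m1 - (int j - divisor \<beta>)" and "j' = int j - divisor \<beta>"
  have "coeff (tangent_cone \<nu> V) j = dx_coeff \<alpha> \<beta> \<gamma> \<delta> i' j' + dy_coeff \<alpha> \<beta> \<gamma> \<delta> i' j'"
    using assms unfolding coeff_tangent_cone
    by (simp add: toric_germ_def i'_def j'_def algebra_simps)
  also have "\<dots> = (if i' = m1 \<and> j' = 0 then - of_int (int m * (\<alpha> + \<beta>)) else 0)
      + (if i' = 0 \<and> j' = n1 then of_int (int n * (\<gamma> + \<delta>)) else 0)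
      + of_int (n1 - m1) * pulled_coeff \<alpha> \<beta> \<gamma> \<delta> i' j'"
    by (auto simp: dx_coeff_def dy_coeff_def algebra_simps)
  also have "of_int (n1 - m1) * pulled_coeff \<alpha> \<beta> \<gamma> \<delta> i' j' = 0"
    using pulled_coeff_degree(2)[of i' j'] by (auto simp: i'_def j'_def)
  also have "i' = m1 \<and> j' = 0 \<longleftrightarrow> m1 \<le> n1 \<and> int j = divisor \<beta>"
    by (auto simp: i'_def j'_def)
  also have "i' = 0 \<and> j' = n1 \<longleftrightarrow> n1 \<le> m1 \<and> int j = n1 + divisor \<beta>"
    by (auto simp: i'_def j'_def)
  finally show ?thesis by simp
qed

end

text \<open>
  If \<open>n1 < m1\<close>, the strict transform of the curve passes through the origin of the first chart.
\<close>

lemma toric_step_fin: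
  assumes exps: "toric_exponents \<alpha> \<beta> \<gamma> \<delta>" and V: "toric_germ \<alpha> \<beta> \<gamma> \<delta> V"
    and less: "n_exp \<beta> \<delta> < m_exp \<alpha> \<gamma>"
  shows "toric_exponents (\<alpha> + \<beta>) \<beta> (\<gamma> + \<delta>) \<delta>"
    "toric_germ (\<alpha> + \<beta>) \<beta> (\<gamma> + \<delta>) \<delta> (strict_transform (Some 0) V)"
proof -
  note ex = exps_facts[OF exps]
  let ?n = "n_exp \<beta> \<delta>"
  have m': "m_exp (\<alpha> + \<beta>) (\<gamma> + \<delta>) = m_exp \<alpha> \<gamma> - ?n"
    by (simp add: m_exp_def n_exp_def algebra_simps)
  show exps': "toric_exponents (\<alpha> + \<beta>) \<beta> (\<gamma> + \<delta>) \<delta>"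
    using ex less m' by (auto simp: toric_exponents_def algebra_simps)
  let ?dx = "dx_coeff \<alpha> \<beta> \<gamma> \<delta>" and ?dy = "dy_coeff \<alpha> \<beta> \<gamma> \<delta>"
  let ?dx' = "dx_coeff (\<alpha> + \<beta>) \<beta> (\<gamma> + \<delta>) \<delta>" and ?dy' = "dy_coeff (\<alpha> + \<beta>) \<beta> (\<gamma> + \<delta>) \<delta>"
  have pulled: "pulled_coeff (\<alpha> + \<beta>) \<beta> (\<gamma> + \<delta>) \<delta> i j = pulled_coeff \<alpha> \<beta> \<gamma> \<delta> (i - j + ?n) j" for i j
    unfolding pulled_coeff_def n_exp_def
    by (intro arg_cong2[where f = "zcoeff h"]) (simp_all add: algebra_simps)
  have c: "i = m_exp \<alpha> \<gamma> - ?n \<and> j = 0 \<longleftrightarrow> i - j + ?n = m_exp \<alpha> \<gamma> \<and> j = 0"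
    "i = 0 \<and> j = ?n \<longleftrightarrow> i - j + ?n = 0 \<and> j = ?n" for i j
    by auto
  have dx': "?dx' i j = ?dx (i - j + ?n) j + ?dy (i - j + ?n) j" for i j
    unfolding dx_coeff_def dy_coeff_def pulled m' c[of i j]
    by (cases "i - j + ?n = m_exp \<alpha> \<gamma> \<and> j = 0"; cases "i - j + ?n = 0 \<and> j = ?n")
      (simp_all only: if_True if_False simp_thms, simp_all add: algebra_simps)
  have dy': "?dy' i j = ?dy (i - j + ?n) j" for i j
    unfolding dy_coeff_def pulled m' c[of i j] by simp
  define e1 e2 where "e1 = divisor \<gamma>" and "e2 = divisor \<beta>"
  have e: "0 \<le> e1" "0 \<le> e2" by (auto simp: e1_def e2_def divisor_def)
  define K where "K = nat (?n + e1 + e2 - 1)"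
  have K: "int K = ?n + e1 + e2 - 1" using ex(6) e by (simp add: K_def)
  obtain R S where RS: "V = (R, S)" by force
  have R: "zcoeff R k l = ?dx (k + 1 - e1) (l - e2)" and S: "zcoeff S k l = ?dy (k - e1) (l + 1 - e2)" for k l
    using V by (auto simp: toric_germ_def RS e1_def e2_def)
  define A where "A = cps_blowup_fin 0 R + cps_Y * cps_blowup_fin 0 S"
  define B where "B = cps_X * cps_blowup_fin 0 S"
  have pb: "pullback (Some 0) V = (A, B)"
    by (simp add: RS A_def B_def cps_const_numeral_simps)
  have A: "zcoeff A k l = ?dx' (k - int K) (l - e2)" for k l
    unfolding A_def zcoeff_add zcoeff_Y_mult zcoeff_blowup_fin_0 R S dx' K
    by (simp add: algebra_simps)
  have B: "zcoeff B k l = ?dy' (k - int K - 1) (l + 1 - e2)" for k l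
    unfolding B_def zcoeff_X_mult zcoeff_blowup_fin_0 S dy' K by (simp add: algebra_simps)
  have A0: "zcoeff A k l = 0" if "k < int K" for k l
    using that by (simp add: A dx_coeff_neg[OF exps'])
  have B0: "zcoeff B k l = 0" if "k < int K" for k l
    using that by (simp add: B dy_coeff_neg[OF exps'])
  obtain A' where A': "A = cps_X ^ K * A'"
    "\<And>k l. zcoeff A' k l = (if k < 0 then 0 else zcoeff A (k + int K) l)"
    using zcoeff_X_factor[of K A, OF A0] by metis
  obtain B' where B': "B = cps_X ^ K * B'"
    "\<And>k l. zcoeff B' k l = (if k < 0 then 0 else zcoeff B (k + int K) l)"
    using zcoeff_X_factor[of K B, OF B0] by metis
  have A'': "zcoeff A' k l = ?dx' k (l - e2)" for k l
    by (simp add: A'(2) A dx_coeff_neg[OF exps'])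
  have B'': "zcoeff B' k l = ?dy' (k - 1) (l + 1 - e2)" for k l
    by (simp add: B'(2) B dy_coeff_neg[OF exps'])
  have "zcoeff A' 0 (?n + e2) = of_int (int n * (\<gamma> + \<delta>))"
    using less pulled_coeff_0[OF exps', of 0 ?n] by (simp add: A'' dx_coeff_def m')
  moreover have "int n * (\<gamma> + \<delta>) \<noteq> 0" using ex two_le_n by auto
  ultimately have "zcoeff A' 0 (?n + e2) \<noteq> 0" by (metis of_int_eq_0_iff)
  then have "\<not> cps_X dvd A'" by (auto simp: cps_X_dvd_iff zcoeff_def split: if_splits)
  then have "strict_transform (Some 0) V = (A', B')"
    by (intro strict_transform_eqI[where k = K]) (auto simp: pb form_scale_def A'(1) B'(1))
  moreover have "divisor (\<gamma> + \<delta>) = 1" using ex by (simp add: divisor_def)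
  ultimately show "toric_germ (\<alpha> + \<beta>) \<beta> (\<gamma> + \<delta>) \<delta> (strict_transform (Some 0) V)"
    by (simp add: toric_germ_def A'' B'' e2_def)
qed

text \<open>
  If \<open>m1 < n1\<close>, the strict transform of the curve passes through the origin of the second chart.
\<close>

lemma toric_step_inf:
  assumes exps: "toric_exponents \<alpha> \<beta> \<gamma> \<delta>" and V: "toric_germ \<alpha> \<beta> \<gamma> \<delta> V"
    and less: "m_exp \<alpha> \<gamma> < n_exp \<beta> \<delta>" and \<gamma>: "0 < \<gamma>"
  shows "toric_exponents \<alpha> (\<alpha> + \<beta>) \<gamma> (\<gamma> + \<delta>)"
    "toric_germ \<alpha> (\<alpha> + \<beta>) \<gamma> (\<gamma> + \<delta>) (strict_transform None V)"
proof -
  note ex = exps_facts[OF exps]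
  let ?m = "m_exp \<alpha> \<gamma>"
  have n': "n_exp (\<alpha> + \<beta>) (\<gamma> + \<delta>) = n_exp \<beta> \<delta> - ?m"
    by (simp add: m_exp_def n_exp_def algebra_simps)
  show exps': "toric_exponents \<alpha> (\<alpha> + \<beta>) \<gamma> (\<gamma> + \<delta>)"
    using ex less n' \<gamma> by (auto simp: toric_exponents_def algebra_simps)
  let ?dx = "dx_coeff \<alpha> \<beta> \<gamma> \<delta>" and ?dy = "dy_coeff \<alpha> \<beta> \<gamma> \<delta>"
  let ?dx' = "dx_coeff \<alpha> (\<alpha> + \<beta>) \<gamma> (\<gamma> + \<delta>)" and ?dy' = "dy_coeff \<alpha> (\<alpha> + \<beta>) \<gamma> (\<gamma> + \<delta>)"
  have pulled: "pulled_coeff \<alpha> (\<alpha> + \<beta>) \<gamma> (\<gamma> + \<delta>) i j = pulled_coeff \<alpha> \<beta> \<gamma> \<delta> i (j - i + ?m)" for i j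
    unfolding pulled_coeff_def m_exp_def
    by (intro arg_cong2[where f = "zcoeff h"]) (simp_all add: algebra_simps)
  have c: "i = ?m \<and> j = 0 \<longleftrightarrow> i = ?m \<and> j - i + ?m = 0"
    "i = 0 \<and> j = n_exp \<beta> \<delta> - ?m \<longleftrightarrow> i = 0 \<and> j - i + ?m = n_exp \<beta> \<delta>" for i j
    by auto
  have dx': "?dx' i j = ?dx i (j - i + ?m)" for i j
    unfolding dx_coeff_def pulled n' c[of i j] by simp
  have dy': "?dy' i j = ?dx i (j - i + ?m) + ?dy i (j - i + ?m)" for i j
    unfolding dx_coeff_def dy_coeff_def pulled n' c[of i j]
    by (cases "i = ?m \<and> j - i + ?m = 0"; cases "i = 0 \<and> j - i + ?m = n_exp \<beta> \<delta>")
      (simp_all only: if_True if_False simp_thms, simp_all add: algebra_simps)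
  define e1 e2 where "e1 = divisor \<gamma>" and "e2 = divisor \<beta>"
  have e: "0 \<le> e1" "0 \<le> e2" by (auto simp: e1_def e2_def divisor_def)
  define K where "K = nat (?m + e1 + e2 - 1)"
  have K: "int K = ?m + e1 + e2 - 1" using ex(7) e by (simp add: K_def)
  obtain R S where RS: "V = (R, S)" by force
  have R: "zcoeff R k l = ?dx (k + 1 - e1) (l - e2)" and S: "zcoeff S k l = ?dy (k - e1) (l + 1 - e2)" for k l
    using V by (auto simp: toric_germ_def RS e1_def e2_def)
  define A where "A = cps_Y * cps_blowup_inf R"
  define B where "B = cps_X * cps_blowup_inf R + cps_blowup_inf S"
  have pb: "pullback None V = (A, B)" by (simp add: RS A_def B_def)
  have A: "zcoeff A k l = ?dx' (k + 1 - e1) (l - int K - 1)" for k l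
    unfolding A_def zcoeff_Y_mult zcoeff_blowup_inf R dx' K by (simp add: algebra_simps)
  have B: "zcoeff B k l = ?dy' (k - e1) (l - int K)" for k l
    unfolding B_def zcoeff_add zcoeff_X_mult zcoeff_blowup_inf R S dy' K by (simp add: algebra_simps)
  have A0: "zcoeff A k l = 0" if "l < int K" for k l
    using that by (simp add: A dx_coeff_neg[OF exps'])
  have B0: "zcoeff B k l = 0" if "l < int K" for k l
    using that by (simp add: B dy_coeff_neg[OF exps'])
  obtain A' where A': "A = cps_Y ^ K * A'"
    "\<And>k l. zcoeff A' k l = (if l < 0 then 0 else zcoeff A k (l + int K))"
    using zcoeff_Y_factor[of K A, OF A0] by metis
  obtain B' where B': "B = cps_Y ^ K * B'"
    "\<And>k l. zcoeff B' k l = (if l < 0 then 0 else zcoeff B k (l + int K))"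
    using zcoeff_Y_factor[of K B, OF B0] by metis
  have A'': "zcoeff A' k l = ?dx' (k + 1 - e1) (l - 1)" for k l
    by (simp add: A'(2) A dx_coeff_neg[OF exps'])
  have B'': "zcoeff B' k l = ?dy' (k - e1) l" for k l
    by (simp add: B'(2) B dy_coeff_neg[OF exps'])
  have "zcoeff B' (?m + e1) 0 = - of_int (int m * (\<alpha> + \<beta>))"
    using less pulled_coeff_0[OF exps', of ?m 0] by (simp add: B'' dy_coeff_def n')
  moreover have "int m * (\<alpha> + \<beta>) \<noteq> 0" using ex two_le_n n_le_m by auto
  ultimately have "zcoeff B' (?m + e1) 0 \<noteq> 0" by (metis neg_equal_0_iff_equal of_int_eq_0_iff)
  then have "\<not> cps_Y dvd B'" by (auto simp: cps_Y_dvd_iff zcoeff_def split: if_splits)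
  then have "strict_transform None V = (A', B')"
    by (intro strict_transform_eqI[where k = K]) (auto simp: pb form_scale_def A'(1) B'(1))
  moreover have "divisor (\<alpha> + \<beta>) = 1" using ex by (simp add: divisor_def)
  ultimately show "toric_germ \<alpha> (\<alpha> + \<beta>) \<gamma> (\<gamma> + \<delta>) (strict_transform None V)"
    by (simp add: toric_germ_def A'' B'' e1_def)
qed

text \<open>
  If both axes are exceptional, both coefficients have order at least two.  In the other cases the
  linear part is nilpotent, unless the curve is the node \<open>y\<^sup>2 = x\<^sup>2\<close> at the origin.
\<close>

lemma toric_germ_not_irreducible:
  assumes exps: "toric_exponents \<alpha> \<beta> \<gamma> \<delta>" and V: "toric_germ \<alpha> \<beta> \<gamma> \<delta> V"
    and node: "\<gamma> = 0 \<Longrightarrow> \<not> (n = 2 \<and> m = 2)"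
  shows "singular V" "\<not> irreducible_singularity V"
proof -
  note ex = exps_facts[OF exps]
  let ?dx = "dx_coeff \<alpha> \<beta> \<gamma> \<delta>" and ?dy = "dy_coeff \<alpha> \<beta> \<gamma> \<delta>"
  have R: "cps_coeff (fst V) k l = ?dx (int k + 1 - divisor \<gamma>) (int l - divisor \<beta>)"
    and S: "cps_coeff (snd V) k l = ?dy (int k - divisor \<gamma>) (int l + 1 - divisor \<beta>)" for k l
    using V unfolding toric_germ_def zcoeff_of_nat[symmetric] by blast+
  have p0: "pulled_coeff \<alpha> \<beta> \<gamma> \<delta> i j = 0" if "i < 1 \<or> j < 1" for i j
    by (rule pulled_coeff_0[OF exps that])
  have neg: "?dx i j = 0" "?dy i j = 0" if "i < 0 \<or> j < 0" for i j
    using dx_coeff_neg[OF exps that] dy_coeff_neg[OF exps that] by auto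
  have zero: "?dx 0 0 = 0" "?dy 0 0 = 0"
    using ex p0[of 0 0] by (auto simp: dx_coeff_def dy_coeff_def)
  consider "0 < \<beta>" "0 < \<gamma>" | "\<beta> = 0" "0 < \<gamma>" | "\<beta> = 0" "\<gamma> = 0"
    using ex(2,3,8) by linarith
  then have "singular V \<and> cps_coeff (fst V) 0 1 = cps_coeff (snd V) 1 0 \<and>
    cps_coeff (snd V) 0 1 * cps_coeff (fst V) 1 0 = cps_coeff (snd V) 1 0 * cps_coeff (fst V) 0 1"
  proof cases
    case 1
    then show ?thesis using neg zero by (simp add: singular_def R S divisor_def)
  next
    case 2
    then have "\<alpha> = 1" "\<delta> = 1" using ex by (auto simp: zmult_eq_1_iff)
    then have "?dx 0 1 = 0" "?dy 0 1 = 0"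
      using two_le_n n_le_m ex 2 p0[of 0 1] by (auto simp: dx_coeff_def dy_coeff_def n_exp_def)
    then show ?thesis using 2 neg zero by (simp add: singular_def R S divisor_def)
  next
    case 3
    then have \<alpha>: "\<alpha> = 1" "\<delta> = 1" using ex by (auto simp: zmult_eq_1_iff)
    have m: "3 \<le> m" using node 3 two_le_n n_le_m by linarith
    have "pulled_coeff \<alpha> \<beta> \<gamma> \<delta> 1 1 = 0"
    proof (rule ccontr)
      assume "pulled_coeff \<alpha> \<beta> \<gamma> \<delta> 1 1 \<noteq> 0"
      from pulled_coeff_degree(1)[OF exps this]
        pulled_coeff_support(3)[OF exps this]
      have *: "int n * int m \<le> int n + int m" using 3 \<alpha> by (simp add: n_exp_def m_exp_def)
      have "2 * int m \<le> int n * int m" using two_le_n by (intro mult_right_mono) auto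
      moreover have "int n * 3 \<le> int n * int m" using m by (intro mult_left_mono) auto
      ultimately show False using * two_le_n n_le_m m by linarith
    qed
    then have "?dx 1 1 = 0" "?dy 1 1 = 0"
      using m two_le_n 3 \<alpha> by (auto simp: dx_coeff_def dy_coeff_def)
    moreover have "?dx 1 0 = 0" "?dy 0 1 = 0" "?dx 2 0 = 0"
      using m two_le_n 3 \<alpha> p0[of 1 0] p0[of 0 1] p0[of 2 0]
      by (auto simp: dx_coeff_def dy_coeff_def n_exp_def m_exp_def)
    ultimately show ?thesis using 3 by (simp add: singular_def R S divisor_def)
  qed
  then show "singular V" "\<not> irreducible_singularity V"
    using nilpotent_not_irreducible by blast+
qed

text \<open>
  At a point other than the origins of the charts the logarithmic form has a pole only along the
  new divisor, where its coefficient is the leading part of the sum of the two coefficients.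
\<close>

definition cone_value :: "int \<Rightarrow> int \<Rightarrow> int \<Rightarrow> int \<Rightarrow> complex \<Rightarrow> complex" where
  "cone_value \<alpha> \<beta> \<gamma> \<delta> t =
    (if m_exp \<alpha> \<gamma> \<le> n_exp \<beta> \<delta> then - of_int (int m * (\<alpha> + \<beta>)) * t ^ nat (divisor \<beta>) else 0)
    + (if n_exp \<beta> \<delta> \<le> m_exp \<alpha> \<gamma>
       then of_int (int n * (\<gamma> + \<delta>)) * t ^ nat (n_exp \<beta> \<delta> + divisor \<beta>) else 0)"

lemma toric_germ_orderE:
  assumes exps: "toric_exponents \<alpha> \<beta> \<gamma> \<delta>" and V: "toric_germ \<alpha> \<beta> \<gamma> \<delta> V"
  obtains \<nu> where "int \<nu> = min (n_exp \<beta> \<delta>) (m_exp \<alpha> \<gamma>) + divisor \<gamma> + divisor \<beta> - 1"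
    "vanishes_to_order \<nu> V"
    "\<And>t. poly (tangent_cone \<nu> V) t = cone_value \<alpha> \<beta> \<gamma> \<delta> t"
proof -
  note ex = exps_facts[OF exps]
  have e: "0 \<le> divisor \<beta>" "0 \<le> divisor \<gamma>" by (auto simp: divisor_def)
  define \<nu> where "\<nu> = nat (min (n_exp \<beta> \<delta>) (m_exp \<alpha> \<gamma>) + divisor \<gamma> + divisor \<beta> - 1)"
  have \<nu>: "int \<nu> = min (n_exp \<beta> \<delta>) (m_exp \<alpha> \<gamma>) + divisor \<gamma> + divisor \<beta> - 1"
    using ex(6,7) e by (simp add: \<nu>_def)
  have j: "int j = divisor \<beta> \<longleftrightarrow> nat (divisor \<beta>) = j"
    "int j = n_exp \<beta> \<delta> + divisor \<beta> \<longleftrightarrow> nat (n_exp \<beta> \<delta> + divisor \<beta>) = j" for j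
    using e ex(6) by auto
  have "tangent_cone \<nu> V =
      (if m_exp \<alpha> \<gamma> \<le> n_exp \<beta> \<delta> then monom (- of_int (int m * (\<alpha> + \<beta>))) (nat (divisor \<beta>)) else 0)
      + (if n_exp \<beta> \<delta> \<le> m_exp \<alpha> \<gamma>
         then monom (of_int (int n * (\<gamma> + \<delta>))) (nat (n_exp \<beta> \<delta> + divisor \<beta>)) else 0)"
    by (rule poly_eqI) (simp add: toric_germ_tangent_cone[OF exps V \<nu>] j)
  then have "poly (tangent_cone \<nu> V) t = cone_value \<alpha> \<beta> \<gamma> \<delta> t" for t
    by (simp add: cone_value_def poly_monom)
  with \<nu> toric_germ_order[OF exps V \<nu>] show thesis by (rule that)
qed

text \<open>
  At a corner the eigenvalues are integers of opposite sign, whose absolute values are the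
  multiplicities of \<open>y\<^sup>n - x\<^sup>m\<close> along the two divisors.  If only the new divisor passes through the point,
  the germ is regular.
\<close>

lemma toric_corner_inf:
  assumes exps: "toric_exponents \<alpha> \<beta> \<gamma> \<delta>" and V: "toric_germ \<alpha> \<beta> \<gamma> \<delta> V"
    and le: "n_exp \<beta> \<delta> \<le> m_exp \<alpha> \<gamma>"
  shows "regular_or_simple (strict_transform None V)"
proof -
  note ex = exps_facts[OF exps]
  let ?n = "n_exp \<beta> \<delta>"
  obtain \<nu> where \<nu>: "int \<nu> = min ?n (m_exp \<alpha> \<gamma>) + divisor \<gamma> + divisor \<beta> - 1"
    "vanishes_to_order \<nu> V"
    using toric_germ_orderE[OF exps V] by metis
  have \<nu>': "int \<nu> = ?n + divisor \<gamma> + divisor \<beta> - 1" using \<nu>(1) le by simp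
  have R: "zcoeff (fst V) k l = dx_coeff \<alpha> \<beta> \<gamma> \<delta> (k + 1 - divisor \<gamma>) (l - divisor \<beta>)"
    and S: "zcoeff (snd V) k l = dy_coeff \<alpha> \<beta> \<gamma> \<delta> (k - divisor \<gamma>) (l + 1 - divisor \<beta>)" for k l
    using V unfolding toric_germ_def by blast+
  have dy: "dy_coeff \<alpha> \<beta> \<gamma> \<delta> 0 ?n = of_int (int n * \<delta>)"
    using ex pulled_coeff_0[OF exps, of 0 ?n] by (simp add: dy_coeff_def)
  show ?thesis
  proof (cases "\<gamma> = 0")
    case True
    have "zcoeff (snd V) 0 (int \<nu>) = of_int (int n * \<delta>)"
      using True dy by (simp add: S \<nu>' divisor_def)
    then have "cps_coeff (snd V) 0 \<nu> = of_int (int n * \<delta>)"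
      using zcoeff_of_nat[of "snd V" 0 \<nu>] by simp
    moreover have "int n * \<delta> \<noteq> 0" using ex two_le_n by auto
    ultimately have "cps_coeff (snd V) 0 \<nu> \<noteq> 0" by (metis of_int_eq_0_iff)
    then show ?thesis using blowup_inf_regular[OF \<nu>(2)] by (simp add: regular_or_simple_def)
  next
    case False
    then have e1: "divisor \<gamma> = 1" "0 < \<gamma>" using ex(3) by (auto simp: divisor_def)
    have dx: "dx_coeff \<alpha> \<beta> \<gamma> \<delta> 0 ?n = of_int (int n * \<gamma>)"
      using ex pulled_coeff_0[OF exps, of 0 ?n] by (simp add: dx_coeff_def)
    have \<nu>0: "0 < \<nu>" using \<nu>' e1 ex(6) by (auto simp: divisor_def split: if_splits)
    have "zcoeff (snd V) 0 (int \<nu>) = 0"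
      by (simp add: S e1 dy_coeff_neg[OF exps])
    then have 1: "cps_coeff (snd V) 0 \<nu> = 0"
      using zcoeff_of_nat[of "snd V" 0 \<nu>] by simp
    have "zcoeff (fst V) 0 (int \<nu>) = of_int (int n * \<gamma>)"
      by (simp add: R \<nu>' e1 dx)
    then have 2: "cps_coeff (fst V) 0 \<nu> = of_int (int n * \<gamma>)"
      using zcoeff_of_nat[of "fst V" 0 \<nu>] by simp
    have z3: "zcoeff (snd V) 1 (int \<nu> - 1) = of_int (int n * \<delta>)"
      by (simp add: S \<nu>' e1 dy)
    have 3: "cps_coeff (snd V) 1 (\<nu> - 1) = of_int (int n * \<delta>)"
    proof -
      have "int (\<nu> - 1) = int \<nu> - 1" using \<nu>0 by simp
      then show ?thesis
        using zcoeff_of_nat[of "snd V" 1 "\<nu> - 1"] z3 by (simp only: of_nat_1)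
    qed
    have sum: "cps_coeff (fst V) 0 \<nu> + cps_coeff (snd V) 1 (\<nu> - 1) = of_int (int n * (\<gamma> + \<delta>))"
      unfolding 2 3 by (simp add: algebra_simps)
    have pos: "0 < int n * (\<gamma> + \<delta>)" "0 < int n * \<gamma>" using ex e1 two_le_n by auto
    have nz: "cps_coeff (fst V) 0 \<nu> + cps_coeff (snd V) 1 (\<nu> - 1) \<noteq> 0"
      unfolding sum of_int_eq_0_iff using pos by linarith
    have "simple_singularity (strict_transform None V)"
    proof (rule simple_singularity_of_negative_ratio)
      show "singular (strict_transform None V)"
        by (rule blowup_inf_singular(1)[OF \<nu>(2) 1 \<nu>0 nz])
      show "eigenvalues (linear_part (strict_transform None V))
          (of_int (- (int n * (\<gamma> + \<delta>)))) (of_int (int n * \<gamma>))"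
        using blowup_inf_singular(2)[OF \<nu>(2) 1 \<nu>0 nz] unfolding sum unfolding 2 of_int_minus .
      show "- (int n * (\<gamma> + \<delta>)) * (int n * \<gamma>) < 0" using pos by (simp add: mult_pos_pos)
    qed
    then show ?thesis by (simp add: regular_or_simple_def)
  qed
qed

lemma toric_corner_fin:
  assumes exps: "toric_exponents \<alpha> \<beta> \<gamma> \<delta>" and V: "toric_germ \<alpha> \<beta> \<gamma> \<delta> V"
    and le: "m_exp \<alpha> \<gamma> \<le> n_exp \<beta> \<delta>"
  shows "regular_or_simple (strict_transform (Some 0) V)"
proof -
  note ex = exps_facts[OF exps]
  let ?m = "m_exp \<alpha> \<gamma>"
  obtain \<nu> where \<nu>: "int \<nu> = min (n_exp \<beta> \<delta>) ?m + divisor \<gamma> + divisor \<beta> - 1"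
    "vanishes_to_order \<nu> V"
    "\<And>t. poly (tangent_cone \<nu> V) t = cone_value \<alpha> \<beta> \<gamma> \<delta> t"
    using toric_germ_orderE[OF exps V] by metis
  have pos: "0 < int m * (\<alpha> + \<beta>)" using ex two_le_n n_le_m by auto
  have n0: "0 ^ nat (n_exp \<beta> \<delta> + divisor \<beta>) = (0 :: complex)"
    using ex(6) by (auto simp: divisor_def zero_power)
  show ?thesis
  proof (cases "\<beta> = 0")
    case True
    have "poly (tangent_cone \<nu> V) 0 = - of_int (int m * (\<alpha> + \<beta>))"
      unfolding \<nu>(3) cone_value_def n0 using le True by (simp add: divisor_def)
    moreover have "- of_int (int m * (\<alpha> + \<beta>)) \<noteq> (0 :: complex)"
      unfolding neg_equal_0_iff_equal of_int_eq_0_iff using pos by linarith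
    ultimately have "poly (tangent_cone \<nu> V) 0 \<noteq> 0" by metis
    then show ?thesis using blowup_fin_regular[OF \<nu>(2)] by (simp add: regular_or_simple_def)
  next
    case False
    then have \<beta>: "0 < \<beta>" "divisor \<beta> = 1" "divisor \<gamma> = 1"
      using ex(2,8) by (auto simp: divisor_def)
    have p0: "poly (tangent_cone \<nu> V) 0 = 0"
      unfolding \<nu>(3) cone_value_def n0 using \<beta> by simp
    have p1: "poly (pderiv (tangent_cone \<nu> V)) 0 = - of_int (int m * (\<alpha> + \<beta>))"
      using ex(6) le
      by (simp add: poly_0_coeff_0 coeff_pderiv toric_germ_tangent_cone[OF exps V \<nu>(1)] \<beta>)
    have l0: "poly (leading_snd \<nu> V) 0 = - of_int (int m * \<beta>)"
    proof -
      have "zcoeff (snd V) (int \<nu>) 0 = dy_coeff \<alpha> \<beta> \<gamma> \<delta> ?m 0"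
        using V \<nu>(1) le by (simp add: toric_germ_def \<beta>)
      also have "\<dots> = - of_int (int m * \<beta>)"
        using ex pulled_coeff_0[OF exps, of ?m 0] by (simp add: dy_coeff_def)
      finally show ?thesis by (simp add: poly_0_coeff_0 coeff_leading_snd)
    qed
    have p1': "poly (pderiv (tangent_cone \<nu> V)) 0 \<noteq> 0"
      unfolding p1 neg_equal_0_iff_equal of_int_eq_0_iff using pos by linarith
    have "simple_singularity (strict_transform (Some 0) V)"
    proof (rule simple_singularity_of_negative_ratio)
      show "singular (strict_transform (Some 0) V)"
        by (rule blowup_fin_singular(1)[OF \<nu>(2) p0 p1'])
      show "eigenvalues (linear_part (strict_transform (Some 0) V))
          (of_int (int m * \<beta>)) (of_int (- (int m * (\<alpha> + \<beta>))))"
        using blowup_fin_singular(2)[OF \<nu>(2) p0 p1'] unfolding l0 p1 by simp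
      show "int m * \<beta> * - (int m * (\<alpha> + \<beta>)) < 0"
        using pos \<beta>(1) two_le_n n_le_m by (simp add: mult_pos_pos)
    qed
    then show ?thesis by (simp add: regular_or_simple_def)
  qed
qed

text \<open>
  Each blow-up subtracts the smaller of the two exponents of the residual curve
  \<open>y\<^sup>n\<^sup>1 = x\<^sup>m\<^sup>1\<close> from the larger one.
\<close>

theorem toric_reduction:
  assumes "toric_exponents \<alpha> \<beta> \<gamma> \<delta>" "toric_germ \<alpha> \<beta> \<gamma> \<delta> V"
    and "\<gamma> = 0 \<Longrightarrow> \<not> (n = 2 \<and> m = 2)"
  shows "\<exists>\<alpha>' \<beta>' \<gamma>' \<delta>' V'. reduces_to V V' \<and> toric_exponents \<alpha>' \<beta>' \<gamma>' \<delta>' \<and>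
    toric_germ \<alpha>' \<beta>' \<gamma>' \<delta>' V' \<and> n_exp \<beta>' \<delta>' = m_exp \<alpha>' \<gamma>' \<and> (\<gamma>' = 0 \<longrightarrow> \<not> (n = 2 \<and> m = 2))"
  using assms
proof (induction "nat (n_exp \<beta> \<delta> + m_exp \<alpha> \<gamma>)" arbitrary: \<alpha> \<beta> \<gamma> \<delta> V rule: less_induct)
  case less
  note exps = less.prems(1) and V = less.prems(2)
  note ex = exps_facts[OF exps]
  note sing = toric_germ_not_irreducible[OF less.prems]
  have m': "m_exp (\<alpha> + \<beta>) (\<gamma> + \<delta>) = m_exp \<alpha> \<gamma> - n_exp \<beta> \<delta>"
    and n': "n_exp (\<alpha> + \<beta>) (\<gamma> + \<delta>) = n_exp \<beta> \<delta> - m_exp \<alpha> \<gamma>"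
    by (simp_all add: m_exp_def n_exp_def algebra_simps)
  obtain \<nu> where \<nu>: "vanishes_to_order \<nu> V"
    "\<And>t. poly (tangent_cone \<nu> V) t = cone_value \<alpha> \<beta> \<gamma> \<delta> t"
    using toric_germ_orderE[OF exps V] by metis
  have generic: "regular_or_simple (strict_transform (Some t) V)"
    if "t \<noteq> 0" "n_exp \<beta> \<delta> \<noteq> m_exp \<alpha> \<gamma>" for t
  proof -
    have pos: "int m * (\<alpha> + \<beta>) \<noteq> 0" "int n * (\<gamma> + \<delta>) \<noteq> 0" using ex two_le_n n_le_m by auto
    have "poly (tangent_cone \<nu> V) t \<noteq> 0"
      unfolding \<nu>(2) cone_value_def
      by (cases "n_exp \<beta> \<delta> \<le> m_exp \<alpha> \<gamma>") (use that pos in \<open>auto simp del: of_int_mult of_int_add\<close>)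
    then show ?thesis using blowup_fin_regular[OF \<nu>(1)] by (simp add: regular_or_simple_def)
  qed
  consider "n_exp \<beta> \<delta> = m_exp \<alpha> \<gamma>" | "n_exp \<beta> \<delta> < m_exp \<alpha> \<gamma>" | "m_exp \<alpha> \<gamma> < n_exp \<beta> \<delta>"
    by linarith
  then show ?case
  proof cases
    case 1
    then show ?thesis using less.prems reduces_to.refl by blast
  next
    case 2
    have off: "regular_or_simple (strict_transform c V)" if "c \<noteq> Some 0" for c
    proof (cases c)
      case None
      then show ?thesis using toric_corner_inf[OF exps V] 2 by simp
    next
      case (Some t)
      then show ?thesis using generic[of t] that 2 by simp
    qed
    note step = toric_step_fin[OF exps V 2]
    have "nat (n_exp \<beta> \<delta> + m_exp (\<alpha> + \<beta>) (\<gamma> + \<delta>)) < nat (n_exp \<beta> \<delta> + m_exp \<alpha> \<gamma>)"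
      using ex(6,7) m' by auto
    moreover have "\<gamma> + \<delta> \<noteq> 0" using ex by linarith
    ultimately obtain \<alpha>' \<beta>' \<gamma>' \<delta>' V' where
      "reduces_to (strict_transform (Some 0) V) V'" "toric_exponents \<alpha>' \<beta>' \<gamma>' \<delta>'"
      "toric_germ \<alpha>' \<beta>' \<gamma>' \<delta>' V'" "n_exp \<beta>' \<delta>' = m_exp \<alpha>' \<gamma>'" "\<gamma>' = 0 \<longrightarrow> \<not> (n = 2 \<and> m = 2)"
      using less.hyps[OF _ step] by blast
    then show ?thesis using reduces_to.blowup[OF sing off] by blast
  next
    case 3
    have \<gamma>: "0 < \<gamma>"
    proof (rule ccontr)
      assume "\<not> 0 < \<gamma>"
      then have "\<gamma> = 0" using ex(3) by simp
      moreover have "\<beta> = 0" using \<open>\<not> 0 < \<gamma>\<close> ex(2,8) by linarith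
      ultimately have "\<gamma> = 0" "\<beta> = 0" "\<alpha> = 1" "\<delta> = 1"
        using ex(1,4,5) by (auto simp: zmult_eq_1_iff)
      then show False using 3 n_le_m by (simp add: n_exp_def m_exp_def)
    qed
    have off: "regular_or_simple (strict_transform c V)" if "c \<noteq> None" for c
    proof -
      from that obtain t where "c = Some t" by auto
      then show ?thesis using generic[of t] toric_corner_fin[OF exps V] 3 by (cases "t = 0") auto
    qed
    note step = toric_step_inf[OF exps V 3 \<gamma>]
    have "nat (n_exp (\<alpha> + \<beta>) (\<gamma> + \<delta>) + m_exp \<alpha> \<gamma>) < nat (n_exp \<beta> \<delta> + m_exp \<alpha> \<gamma>)"
      using ex(6,7) n' by auto
    then obtain \<alpha>' \<beta>' \<gamma>' \<delta>' V' where
      "reduces_to (strict_transform None V) V'" "toric_exponents \<alpha>' \<beta>' \<gamma>' \<delta>'"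
      "toric_germ \<alpha>' \<beta>' \<gamma>' \<delta>' V'" "n_exp \<beta>' \<delta>' = m_exp \<alpha>' \<gamma>'" "\<gamma>' = 0 \<longrightarrow> \<not> (n = 2 \<and> m = 2)"
      using less.hyps[OF _ step] \<gamma> by blast
    then show ?thesis using reduces_to.blowup[OF sing off] by blast
  qed
qed

text \<open>
  For \<open>n1 = m1 = d\<close> the tangent cone is a multiple of \<open>t\<^sup>d - 1\<close>, up to a power of \<open>t\<close>.
\<close>

lemma final_points_off_curve:
  assumes exps: "toric_exponents \<alpha> \<beta> \<gamma> \<delta>" and V: "toric_germ \<alpha> \<beta> \<gamma> \<delta> V"
    and eq: "n_exp \<beta> \<delta> = m_exp \<alpha> \<gamma>" and c: "\<And>t. c = Some t \<Longrightarrow> t ^ nat (n_exp \<beta> \<delta>) \<noteq> 1"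
  shows "regular_or_simple (strict_transform c V)"
proof (cases c)
  case None
  then show ?thesis using toric_corner_inf[OF exps V] eq by simp
next
  case (Some t)
  note ex = exps_facts[OF exps]
  have mn: "int n * (\<gamma> + \<delta>) = int m * (\<alpha> + \<beta>)" using eq by (simp add: n_exp_def m_exp_def algebra_simps)
  obtain \<nu> where \<nu>: "vanishes_to_order \<nu> V"
    "\<And>t. poly (tangent_cone \<nu> V) t = cone_value \<alpha> \<beta> \<gamma> \<delta> t"
    using toric_germ_orderE[OF exps V] by metis
  show ?thesis
  proof (cases "t = 0")
    case True
    then show ?thesis using toric_corner_fin[OF exps V] eq Some by simp
  next
    case False
    have "nat (n_exp \<beta> \<delta> + divisor \<beta>) = nat (n_exp \<beta> \<delta>) + nat (divisor \<beta>)"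
      using ex(6) by (simp add: nat_add_distrib divisor_def)
    then have "poly (tangent_cone \<nu> V) t =
        of_int (int m * (\<alpha> + \<beta>)) * (t ^ nat (divisor \<beta>) * (t ^ nat (n_exp \<beta> \<delta>) - 1))"
      unfolding \<nu>(2) cone_value_def mn using eq by (simp add: power_add algebra_simps)
    moreover have "int m * (\<alpha> + \<beta>) \<noteq> 0" using ex two_le_n n_le_m by auto
    ultimately have "poly (tangent_cone \<nu> V) t \<noteq> 0"
      using False c[OF Some] by (simp del: of_int_mult of_int_add)
    then show ?thesis using blowup_fin_regular[OF \<nu>(1)] Some by (simp add: regular_or_simple_def)
  qed
qed

text \<open>
  At a root of \<open>t\<^sup>d - 1\<close> the two eigenvalues are the derivative of the tangent cone and, up to sign,
  the value of the leading coefficient of \<open>dy\<close>; the common factor \<open>u = d t\<^sup>b\<^sup>-\<^sup>1\<close> cancels in the quotient.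
\<close>

lemma final_points_on_curve:
  assumes exps: "toric_exponents \<alpha> \<beta> \<gamma> \<delta>" and V: "toric_germ \<alpha> \<beta> \<gamma> \<delta> V"
    and eq: "n_exp \<beta> \<delta> = m_exp \<alpha> \<gamma>" and t: "t ^ nat (n_exp \<beta> \<delta>) = 1"
  defines "\<rho> \<equiv> \<Sum>j\<le>nat (n_exp \<beta> \<delta>). pulled_coeff \<alpha> \<beta> \<gamma> \<delta> (n_exp \<beta> \<delta> - int j) (int j) * t ^ j"
  shows "singular (strict_transform (Some t) V)"
    "\<exists>u. u \<noteq> 0 \<and> eigenvalues (linear_part (strict_transform (Some t) V))
      (- (u * (1 + \<rho>))) (u * of_int (int m * (\<alpha> + \<beta>)))"
proof -
  note ex = exps_facts[OF exps]
  define d where "d = nat (n_exp \<beta> \<delta>)"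
  have d: "n_exp \<beta> \<delta> = int d" "m_exp \<alpha> \<gamma> = int d" "0 < d" using ex(6) eq by (auto simp: d_def)
  have td: "t ^ d = 1" using t by (simp add: d_def)
  have t0: "t \<noteq> 0" using td d(3) by (auto simp: zero_power)
  have mn: "int n * (\<gamma> + \<delta>) = int m * (\<alpha> + \<beta>)" using eq by (simp add: n_exp_def m_exp_def algebra_simps)
  define C :: complex where "C = of_int (int m * (\<alpha> + \<beta>))"
  have C: "C \<noteq> 0" unfolding C_def of_int_eq_0_iff using ex two_le_n n_le_m by auto
  obtain \<nu> where \<nu>: "int \<nu> = min (n_exp \<beta> \<delta>) (m_exp \<alpha> \<gamma>) + divisor \<gamma> + divisor \<beta> - 1"
    "vanishes_to_order \<nu> V"
    using toric_germ_orderE[OF exps V] by metis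
  define b where "b = nat (divisor \<beta>)"
  have b: "divisor \<beta> = int b" "b \<le> 1" by (auto simp: b_def divisor_def)
  have cone: "tangent_cone \<nu> V = monom C (d + b) - monom C b"
    by (rule poly_eqI)
      (auto simp: toric_germ_tangent_cone[OF exps V \<nu>(1)] mn C_def[symmetric] d b
        simp flip: of_nat_add simp del: of_int_mult of_int_add of_nat_add)
  have p0: "poly (tangent_cone \<nu> V) t = 0"
    by (simp add: cone poly_monom power_add td)
  define u where "u = of_nat d * t ^ b / t"
  have u: "u \<noteq> 0" using d(3) t0 by (simp add: u_def)
  have p1: "poly (pderiv (tangent_cone \<nu> V)) t = u * C"
  proof -
    have "t * poly (pderiv (tangent_cone \<nu> V)) t = of_nat d * t ^ b * C"
    proof -
      have "t * (of_nat k * C * t ^ (k - 1)) = of_nat k * C * t ^ k" for k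
        by (cases k) auto
      then have "t * poly (pderiv (monom C k)) t = of_nat k * C * t ^ k" for k
        by (simp add: pderiv_monom poly_monom)
      then show ?thesis
        by (simp add: cone pderiv_diff right_diff_distrib power_add td) (simp add: algebra_simps)
    qed
    then show ?thesis using t0 by (simp add: u_def field_simps)
  qed
  have l: "poly (leading_snd \<nu> V) t = u * (1 + \<rho>)"
  proof -
    have coeff: "coeff (leading_snd \<nu> V) j = dy_coeff \<alpha> \<beta> \<gamma> \<delta> (int d - (int j + 1 - int b)) (int j + 1 - int b)" for j
    proof -
      have "int \<nu> - int j - divisor \<gamma> = int d - (int j + 1 - int b)" using \<nu>(1) by (simp add: d b)
      moreover have "zcoeff (snd V) (int \<nu> - int j) (int j) =
          dy_coeff \<alpha> \<beta> \<gamma> \<delta> (int \<nu> - int j - divisor \<gamma>) (int j + 1 - divisor \<beta>)"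
        using V unfolding toric_germ_def by blast
      ultimately show ?thesis by (simp only: coeff_leading_snd b)
    qed
    \<comment> \<open>The coefficient of \<open>dY / Y\<close>, which differs from that of \<open>dY\<close> by a factor \<open>t\<close> if the second axis is
        not exceptional.\<close>
    define B where "B = (\<Sum>j\<le>d. monom (dy_coeff \<alpha> \<beta> \<gamma> \<delta> (int d - int j) (int j)) j)"
    have coeff_B: "coeff B j = dy_coeff \<alpha> \<beta> \<gamma> \<delta> (int d - int j) (int j)" for j
    proof -
      have "coeff B j = (if j \<le> d then dy_coeff \<alpha> \<beta> \<gamma> \<delta> (int d - int j) (int j) else 0)"
        by (simp add: B_def coeff_sum)
      then show ?thesis using dy_coeff_neg[OF exps, of "int d - int j"] by auto
    qed
    have "monom 1 (1 - b) * leading_snd \<nu> V = B"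
    proof (rule poly_eqI)
      fix j
      show "coeff (monom 1 (1 - b) * leading_snd \<nu> V) j = coeff B j"
      proof (cases "b = 1")
        case True
        then show ?thesis by (simp add: coeff coeff_B)
      next
        case False
        then have b0: "b = 0" using b by linarith
        then have "\<beta> = 0" using b by (auto simp: divisor_def split: if_splits)
        then have "dy_coeff \<alpha> \<beta> \<gamma> \<delta> (int d) 0 = 0"
          using d pulled_coeff_0[OF exps, of "int d" 0] by (simp add: dy_coeff_def)
        then show ?thesis
          using b0 by (cases j) (simp_all add: coeff_monom_mult coeff coeff_B add.commute)
      qed
    qed
    then have "t ^ (1 - b) * poly (leading_snd \<nu> V) t = poly B t"
      by (metis poly_mult poly_monom mult_1)
    moreover have "t ^ (1 - b) = t / t ^ b" using b(2) t0 by (cases b) auto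
    moreover have "poly B t = of_nat d * (1 + \<rho>)"
    proof -
      have "poly B t = (\<Sum>j\<le>d. (if j = 0 then - of_int (int m * \<beta>) else 0)
          + (if j = d then of_int (int n * \<delta>) else 0)
          + of_nat d * (pulled_coeff \<alpha> \<beta> \<gamma> \<delta> (int d - int j) (int j) * t ^ j))"
        unfolding B_def poly_sum poly_monom
        by (intro sum.cong refl) (use d(3) td in \<open>auto simp: dy_coeff_def d algebra_simps\<close>)
      also have "\<dots> = of_int (int n * \<delta> - int m * \<beta>) + of_nat d * \<rho>"
        by (simp add: sum.distrib sum_distrib_left \<rho>_def d)
      also have "int n * \<delta> - int m * \<beta> = int d" using d(1) by (simp add: n_exp_def)
      finally show ?thesis by (simp add: algebra_simps)
    qed
    ultimately have "t / t ^ b * poly (leading_snd \<nu> V) t = of_nat d * (1 + \<rho>)" by (simp only:)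
    then show ?thesis using t0 by (simp add: u_def field_simps)
  qed
  have p1': "poly (pderiv (tangent_cone \<nu> V)) t \<noteq> 0" using p1 u C by simp
  show "singular (strict_transform (Some t) V)"
    by (rule blowup_fin_singular(1)[OF \<nu>(2) p0 p1'])
  show "\<exists>u. u \<noteq> 0 \<and> eigenvalues (linear_part (strict_transform (Some t) V))
      (- (u * (1 + \<rho>))) (u * of_int (int m * (\<alpha> + \<beta>)))"
    using blowup_fin_singular(2)[OF \<nu>(2) p0 p1'] u unfolding l p1 C_def by blast
qed

end

section \<open>Residues\<close>

text \<open>
  The terms of \<open>h\<close> that contribute to the residues, those of weight exactly \<open>m n - n - m\<close>.
\<close>

definition resonant_pairs :: "nat \<Rightarrow> nat \<Rightarrow> (nat \<times> nat) set" where
  "resonant_pairs n m = {(r, s). r + 2 \<le> m \<and> s + 2 \<le> n \<and> n * (r + 1) + m * (s + 1) = m * n}"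

definition resonance :: "nat \<Rightarrow> nat \<Rightarrow> nat \<Rightarrow> nat \<Rightarrow> cps \<Rightarrow> complex \<Rightarrow> complex" where
  "resonance n m p q h \<xi> = (\<Sum>(r, s)\<in>resonant_pairs n m. cps_coeff h r s *
     \<xi> powi (int p * (int r + 1) + int q * (int s + 1) - int q * int n))"

lemma finite_resonant_pairs: "finite (resonant_pairs n m)"
  by (rule finite_subset[of _ "{..m} \<times> {..n}"]) (auto simp: resonant_pairs_def)

lemma resonant_pairsI:
  assumes "0 < n" "0 < m" "n * (r + 1) + m * (s + 1) = m * n"
  shows "(r, s) \<in> resonant_pairs n m"
proof -
  have "n * (r + 1) < n * m" "m * (s + 1) < m * n" using assms by (auto simp: mult.commute)
  then have "r + 1 < m" "s + 1 < n" by (simp_all only: mult_less_cancel1)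
  then show ?thesis using assms(3) by (simp add: resonant_pairs_def)
qed

context quasi_homogeneous_form
begin

text \<open>
  The monomials of \<open>H'\<close> of degree \<open>n1 = m1\<close> are the images of those of \<open>H\<close> of weight \<open>m n\<close>.
\<close>

lemma residue_sum:
  assumes exps: "toric_exponents \<alpha> \<beta> \<gamma> \<delta>" and eq: "n_exp \<beta> \<delta> = m_exp \<alpha> \<gamma>"
  shows "(\<Sum>j\<le>nat (n_exp \<beta> \<delta>). pulled_coeff \<alpha> \<beta> \<gamma> \<delta> (n_exp \<beta> \<delta> - int j) (int j) * t ^ j) =
    (\<Sum>(r, s)\<in>resonant_pairs n m. cps_coeff h r s *
      t powi (\<beta> * (int r + 1) + \<delta> * (int s + 1) - \<beta> * int m))"
proof -
  note ex = exps_facts[OF exps]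
  define D where "D = n_exp \<beta> \<delta>"
  have D: "D = int n * \<delta> - int m * \<beta>" "D = int m * \<alpha> - int n * \<gamma>" "0 < D"
    using eq ex(6) by (simp_all add: D_def n_exp_def m_exp_def)
  let ?p = "\<lambda>j. pulled_coeff \<alpha> \<beta> \<gamma> \<delta> (D - int j) (int j)"
  let ?I = "\<lambda>j. \<delta> * (D - int j + \<gamma> * int n) - \<gamma> * (int j + \<beta> * int m)"
  let ?J = "\<lambda>j. \<alpha> * (int j + \<beta> * int m) - \<beta> * (D - int j + \<gamma> * int n)"
  let ?e = "\<lambda>r s. \<beta> * (int r + 1) + \<delta> * (int s + 1) - \<beta> * int m"
  let ?S = "{j. j \<le> nat D \<and> ?p j \<noteq> 0}"
  let ?T = "{(r, s) \<in> resonant_pairs n m. cps_coeff h r s \<noteq> 0}"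
  have forth: "1 \<le> ?I j" "1 \<le> ?J j" "(nat (?I j - 1), nat (?J j - 1)) \<in> ?T"
    "?p j = cps_coeff h (nat (?I j - 1)) (nat (?J j - 1))"
    "?e (nat (?I j - 1)) (nat (?J j - 1)) = int j" if "?p j \<noteq> 0" for j
  proof -
    have p: "?p j = zcoeff h (?I j - 1) (?J j - 1)" by (simp add: pulled_coeff_def)
    then show IJ: "1 \<le> ?I j" "1 \<le> ?J j" using that by (auto simp: zcoeff_def split: if_splits)
    then show c: "?p j = cps_coeff h (nat (?I j - 1)) (nat (?J j - 1))"
      unfolding p by (simp add: zcoeff_def)
    have "int n * ?I j + int m * ?J j = int m * int n"
      using ex(5) D(1,2) by algebra
    moreover have "int (nat (?I j - 1)) + 1 = ?I j" "int (nat (?J j - 1)) + 1 = ?J j"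
      using IJ by simp_all
    ultimately have "int (n * (nat (?I j - 1) + 1) + m * (nat (?J j - 1) + 1)) = int (m * n)"
      by (simp only: of_nat_add of_nat_mult of_nat_1)
    then have "n * (nat (?I j - 1) + 1) + m * (nat (?J j - 1) + 1) = m * n"
      by (simp only: of_nat_eq_iff)
    then show "(nat (?I j - 1), nat (?J j - 1)) \<in> ?T"
      using resonant_pairsI two_le_n n_le_m c that by simp
    have "\<beta> * ?I j + \<delta> * ?J j - \<beta> * int m = int j" using ex(5) by algebra
    then show "?e (nat (?I j - 1)) (nat (?J j - 1)) = int j" using IJ by simp
  qed
  have pair: "?p (nat (?e r s)) = cps_coeff h r s" "nat (?e r s) \<le> nat D"
    "?I (nat (?e r s)) = int r + 1" "?J (nat (?e r s)) = int s + 1" "0 \<le> ?e r s"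
    if "(r, s) \<in> ?T" for r s
  proof -
    define i where "i = \<alpha> * (int r + 1) + \<gamma> * (int s + 1) - \<gamma> * int n"
    have w: "int n * (int r + 1) + int m * (int s + 1) = int m * int n"
    proof -
      have "n * (r + 1) + m * (s + 1) = m * n" using that by (simp add: resonant_pairs_def)
      then have "int (n * (r + 1) + m * (s + 1)) = int (m * n)" by simp
      then show ?thesis by (simp only: of_nat_add of_nat_mult of_nat_1)
    qed
    have "D * (i + ?e r s) = D * D"
      using D(1,2) ex(5) w unfolding i_def by algebra
    then have ie: "i + ?e r s = D" using D(3) by simp
    have I: "\<delta> * (i + \<gamma> * int n) - \<gamma> * (?e r s + \<beta> * int m) = int r + 1"
      using ex(5) unfolding i_def by algebra
    have J: "\<alpha> * (?e r s + \<beta> * int m) - \<beta> * (i + \<gamma> * int n) = int s + 1"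
      using ex(5) unfolding i_def by algebra
    have p: "pulled_coeff \<alpha> \<beta> \<gamma> \<delta> i (?e r s) = cps_coeff h r s"
      unfolding pulled_coeff_def I J by (simp add: zcoeff_of_nat)
    then have pos: "1 \<le> i" "1 \<le> ?e r s"
      using pulled_coeff_support[OF exps, of i "?e r s"] that by auto
    then show "0 \<le> ?e r s" by simp
    have D_e: "int (nat (?e r s)) = ?e r s" "D - ?e r s = i" using ie pos by auto
    show "?p (nat (?e r s)) = cps_coeff h r s" unfolding D_e using p .
    show "nat (?e r s) \<le> nat D" using ie pos by simp
    show "?I (nat (?e r s)) = int r + 1" "?J (nat (?e r s)) = int s + 1" unfolding D_e by (fact I J)+
  qed
  have "(\<Sum>j\<le>nat D. ?p j * t ^ j) = (\<Sum>j\<in>?S. ?p j * t ^ j)"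
    by (rule sum.mono_neutral_right) auto
  also have "\<dots> = (\<Sum>(r, s)\<in>?T. cps_coeff h r s * t powi ?e r s)"
  proof (rule sum.reindex_bij_witness[of _ "\<lambda>(r, s). nat (?e r s)" "\<lambda>j. (nat (?I j - 1), nat (?J j - 1))"])
    fix j assume j: "j \<in> ?S"
    then have nz: "?p j \<noteq> 0" by simp
    show "(case (nat (?I j - 1), nat (?J j - 1)) of (r, s) \<Rightarrow> nat (?e r s)) = j"
      unfolding prod.case forth(5)[OF nz] by simp
    show "(nat (?I j - 1), nat (?J j - 1)) \<in> ?T" by (rule forth(3)[OF nz])
    show "(case (nat (?I j - 1), nat (?J j - 1)) of (r, s) \<Rightarrow> cps_coeff h r s * t powi ?e r s) = ?p j * t ^ j"
      unfolding prod.case forth(5)[OF nz] forth(4)[OF nz] by (simp only: power_int_of_nat)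
  next
    fix b assume b: "b \<in> ?T"
    obtain r s where rs: "b = (r, s)" by force
    note f = pair[OF b[unfolded rs]]
    show "(\<lambda>j. (nat (?I j - 1), nat (?J j - 1))) (case b of (r, s) \<Rightarrow> nat (?e r s)) = b"
      unfolding rs prod.case f by simp
    show "(case b of (r, s) \<Rightarrow> nat (?e r s)) \<in> ?S"
      using f(1,2) b unfolding rs by simp
  qed
  also have "\<dots> = (\<Sum>(r, s)\<in>resonant_pairs n m. cps_coeff h r s * t powi ?e r s)"
    by (rule sum.mono_neutral_left) (auto simp: finite_resonant_pairs)
  finally show ?thesis unfolding D_def .
qed

end

text \<open>
  The exponent that remains at the end of Euclid's algorithm divides \<open>n\<close> and \<open>m\<close> and is a combination of them.
\<close>

lemma toric_exponents_gcd:
  assumes "int n = (\<alpha> + \<beta>) * D" "int m = (\<gamma> + \<delta>) * D" "\<alpha> * int m - \<gamma> * int n = D" "0 < D"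
  shows "D = int (gcd n m)"
proof -
  have "int (gcd n m) dvd \<alpha> * int m - \<gamma> * int n" by (intro dvd_diff dvd_mult) auto
  moreover have "D dvd int n" "D dvd int m" using assms(1,2) by simp_all
  then have "D dvd int (gcd n m)" by (metis gcd_int_int_eq gcd_greatest)
  ultimately show ?thesis using assms(3,4) by (intro zdvd_antisym_nonneg) auto
qed

text \<open>
  The toric tower ends at a germ \<open>V\<close> such that the points on its exceptional divisor are regular or
  simple except possibly those on the curve, which correspond to the roots of unity.  By their
  eigenvalues, a vanishing residue gives a saddle-node and any other admissible one a simple point.
\<close>

lemma (in quasi_homogeneous_form) generalized_curve_iff_residues:
  fixes p q :: nat
  assumes not22: "\<not> (n = 2 \<and> m = 2)"
    and pq: "int m * int p - int n * int q = int (gcd n m)"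
    and not_neg: "\<And>\<xi>. \<xi> ^ gcd n m = 1 \<Longrightarrow>
      1 + resonance n m p q h \<xi> \<notin> neg_rats"
  shows "generalized_curve (model_form n m h) \<longleftrightarrow> (\<forall>\<xi>. \<xi> ^ gcd n m = 1 \<longrightarrow>
      1 + resonance n m p q h \<xi> \<notin> neg_rats \<union> {0})"
proof -
  obtain \<alpha> \<beta> \<gamma> \<delta> V where red: "reduces_to (model_form n m h) V"
    and exps: "toric_exponents \<alpha> \<beta> \<gamma> \<delta>" and V: "toric_germ \<alpha> \<beta> \<gamma> \<delta> V"
    and eq: "n_exp \<beta> \<delta> = m_exp \<alpha> \<gamma>" and \<gamma>: "\<gamma> = 0 \<Longrightarrow> \<not> (n = 2 \<and> m = 2)"
    using toric_reduction[OF toric_exponents_origin toric_germ_origin] not22 by blast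
  note ex = exps_facts[OF exps]
  note sing = toric_germ_not_irreducible[OF exps V \<gamma>]
  define D where "D = n_exp \<beta> \<delta>"
  have D: "D = int n * \<delta> - int m * \<beta>" "D = int m * \<alpha> - int n * \<gamma>" "0 < D"
    using eq ex(6) by (simp_all add: D_def n_exp_def m_exp_def)
  have det: "\<alpha> * \<delta> - \<beta> * \<gamma> = 1" using ex(5) by simp
  have "(\<alpha> + \<beta>) * D = \<alpha> * (int n * \<delta> - int m * \<beta>) + \<beta> * (int m * \<alpha> - int n * \<gamma>)"
    by (simp only: distrib_right D(1)[symmetric] D(2)[symmetric])
  also have "\<dots> = (\<alpha> * \<delta> - \<beta> * \<gamma>) * int n" by (simp add: algebra_simps)
  finally have n_eq: "int n = (\<alpha> + \<beta>) * D" by (simp add: det)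
  have "(\<gamma> + \<delta>) * D = \<gamma> * (int n * \<delta> - int m * \<beta>) + \<delta> * (int m * \<alpha> - int n * \<gamma>)"
    by (simp only: distrib_right D(1)[symmetric] D(2)[symmetric])
  then have "(\<gamma> + \<delta>) * D = (\<alpha> * \<delta> - \<beta> * \<gamma>) * int m" by (simp add: algebra_simps)
  then have m_eq: "int m = (\<gamma> + \<delta>) * D" by (simp add: det)
  have "\<alpha> * int m - \<gamma> * int n = D" unfolding D(2) by (simp only: mult.commute)
  then have gcd: "D = int (gcd n m)" by (rule toric_exponents_gcd[OF n_eq m_eq _ D(3)])
  have pq': "int m * int p - int n * int q = D" using pq gcd by simp
  have d: "nat (n_exp \<beta> \<delta>) = gcd n m" using gcd by (simp add: D_def)
  define C where "C = int m * (\<alpha> + \<beta>)"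
  have C: "0 < C" unfolding C_def using ex two_le_n n_le_m by (intro mult_pos_pos) auto
  have residue: "(\<Sum>j\<le>nat (n_exp \<beta> \<delta>).
      pulled_coeff \<alpha> \<beta> \<gamma> \<delta> (n_exp \<beta> \<delta> - int j) (int j) * t ^ j) = resonance n m p q h (inverse t)"
    if t: "t ^ gcd n m = 1" for t
  proof -
    have t0: "t \<noteq> 0" using t two_le_n by (auto simp: zero_power)
    \<comment> \<open>Both \<open>(- \<beta>, - \<delta>)\<close> and \<open>(p, q)\<close> solve \<open>m p - n q = gcd n m\<close>, and the two exponents add up to
        \<open>gcd n m\<close>; as \<open>t\<close> is a root of unity of this order, the statement refers to \<open>1 / t\<close>.\<close>
    have exponent: "t powi (\<beta> * (int r + 1) + \<delta> * (int s + 1) - \<beta> * int m)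
        = inverse t powi (int p * (int r + 1) + int q * (int s + 1) - int q * int n)"
      if "(r, s) \<in> resonant_pairs n m" for r s
    proof -
      let ?e = "\<beta> * (int r + 1) + \<delta> * (int s + 1) - \<beta> * int m"
      let ?e' = "int p * (int r + 1) + int q * (int s + 1) - int q * int n"
      have "n * (r + 1) + m * (s + 1) = m * n" using that by (simp add: resonant_pairs_def)
      then have "int (n * (r + 1) + m * (s + 1)) = int (m * n)" by simp
      then have w: "int n * (int r + 1) + int m * (int s + 1) = int m * int n"
        by (simp only: of_nat_add of_nat_mult of_nat_1)
      have bp: "(\<beta> + int p) * int m = (\<delta> + int q) * int n"
        using pq' D(1) by (simp add: algebra_simps)
      have "int n * ((\<beta> + int p) * (int r + 1) + (\<delta> + int q) * (int s + 1))
          = int n * ((\<beta> + int p) * int m)"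
        using w bp by algebra
      then have "(\<beta> + int p) * (int r + 1) + (\<delta> + int q) * (int s + 1) = (\<beta> + int p) * int m"
        using two_le_n by simp
      then have "?e + ?e' = D" using pq' by (simp add: algebra_simps)
      then have "?e + ?e' = int (gcd n m)" using gcd by simp
      then have "t powi ?e * t powi ?e' = 1"
        using t t0 by (simp add: power_int_add[symmetric])
      then have "inverse (t powi ?e') = t powi ?e" by (intro inverse_unique) (simp only: mult.commute)
      then show ?thesis by (simp only: power_int_inverse)
    qed
    show ?thesis
      unfolding residue_sum[OF exps eq] resonance_def
      by (intro sum.cong refl) (use exponent in auto)
  qed
  have point: "singular (strict_transform (Some t) V)"
    "\<exists>u. u \<noteq> 0 \<and> eigenvalues (linear_part (strict_transform (Some t) V))
      (- (u * (1 + resonance n m p q h (inverse t)))) (u * of_int C)" if t: "t ^ gcd n m = 1" for t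
    using final_points_on_curve[OF exps V eq, of t] t unfolding d residue[OF t, unfolded d] C_def
    by blast+
  show ?thesis
  proof
    assume gc: "generalized_curve (model_form n m h)"
    show "\<forall>\<xi>. \<xi> ^ gcd n m = 1 \<longrightarrow> 1 + resonance n m p q h \<xi> \<notin> neg_rats \<union> {0}"
    proof (intro allI impI)
      fix \<xi> :: complex assume \<xi>: "\<xi> ^ gcd n m = 1"
      have "1 + resonance n m p q h \<xi> \<noteq> 0"
      proof
        assume zero: "1 + resonance n m p q h \<xi> = 0"
        have t: "inverse \<xi> ^ gcd n m = 1" using \<xi> by (simp add: power_inverse)
        obtain u where "u \<noteq> 0" "eigenvalues (linear_part (strict_transform (Some (inverse \<xi>)) V)) 0 (u * of_int C)"
          using point(2)[OF t] zero by auto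
        then have "saddle_node (strict_transform (Some (inverse \<xi>)) V)"
          unfolding saddle_node_def using point(1)[OF t] C
          by (auto simp: eigenvalues_linear_part_iff intro!: exI[of _ "u * of_int C"])
        then show False using not_generalized_curve_reduces_to[OF red sing] gc by blast
      qed
      then show "1 + resonance n m p q h \<xi> \<notin> neg_rats \<union> {0}" using not_neg[OF \<xi>] by simp
    qed
  next
    assume *: "\<forall>\<xi>. \<xi> ^ gcd n m = 1 \<longrightarrow> 1 + resonance n m p q h \<xi> \<notin> neg_rats \<union> {0}"
    have simple: "regular_or_simple (strict_transform (Some t) V)" if t: "t ^ gcd n m = 1" for t
    proof -
      let ?U = "strict_transform (Some t) V" and ?\<rho> = "1 + resonance n m p q h (inverse t)"
      have "inverse t ^ gcd n m = 1" using t by (simp add: power_inverse)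
      then have good: "?\<rho> \<notin> neg_rats \<union> {0}" using * by blast
      obtain u where u: "u \<noteq> 0" "eigenvalues (linear_part ?U) (- (u * ?\<rho>)) (u * of_int C)"
        using point(2)[OF t] by blast
      have "- (u * ?\<rho>) / (u * of_int C) \<notin> pos_rats"
      proof
        assume "- (u * ?\<rho>) / (u * of_int C) \<in> pos_rats"
        then obtain c where c: "0 < c" "- (u * ?\<rho>) / (u * of_int C) = of_rat c"
          by (auto simp: pos_rats_def)
        have "u * of_int C \<noteq> 0" using u(1) C by simp
        from c(2)[unfolded nonzero_divide_eq_eq[OF this]]
        have "u * ?\<rho> = - (of_rat c * (u * of_int C))" by (metis minus_minus)
        then have "u * ?\<rho> = u * - (of_rat c * of_int C)"
          by (simp only: mult_minus_right mult.left_commute)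
        then have "?\<rho> = - (of_rat c * of_int C)" using u(1) by (simp only: mult_cancel_left) simp
        also have "\<dots> = of_rat (- (c * of_int C))" by (simp add: of_rat_minus of_rat_mult)
        finally show False using good c(1) C by (auto simp: neg_rats_def)
      qed
      moreover have "- (u * ?\<rho>) * (u * of_int C) \<noteq> 0" using u(1) good C by simp
      ultimately show ?thesis
        using point(1)[OF t] u(2) unfolding regular_or_simple_def simple_singularity_def by blast
    qed
    have "regular_or_simple (strict_transform c V)" for c
    proof (cases "\<exists>t. c = Some t \<and> t ^ gcd n m = 1")
      case True
      then show ?thesis using simple by blast
    next
      case False
      then show ?thesis using final_points_off_curve[OF exps V eq, of c] unfolding d by blast
    qed
    then have "reduces_to V (strict_transform None V)" "regular_or_simple (strict_transform None V)"
      using reduces_to.blowup[OF sing _ reduces_to.refl, of None] by blast+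
    then show "generalized_curve (model_form n m h)"
      using generalized_curve_reduces_to reduces_to_trans[OF red] by blast
  qed
qed

text \<open>
  The eigenvalues at the origin are \<open>2 (1 - c)\<close> and \<open>- 2 (1 + c)\<close>.  If their quotient is a positive
  rational number, then \<open>1 - c\<close> and \<open>1 + c\<close> are rational numbers of opposite sign, as their sum is 2.
\<close>

lemma generalized_curve_node:
  fixes h :: cps
  defines "c \<equiv> cps_coeff h 0 0"
  assumes neg: "1 + c \<notin> neg_rats" "1 - c \<notin> neg_rats"
  shows "generalized_curve (model_form 2 2 h) \<longleftrightarrow> 1 + c \<noteq> 0 \<and> 1 - c \<noteq> 0"
proof -
  let ?W = "model_form 2 2 h"
  have fst: "cps_coeff (fst ?W) i j = - (2 * (cps_coeff cps_X i j + cps_coeff (cps_Y * h) i j))" for i j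
    by (simp only: model_form_fst cps_coeff_uminus cps_coeff_of_nat_mult cps_coeff_add mult.commute[of h])
      simp
  have snd: "cps_coeff (snd ?W) i j = 2 * (cps_coeff cps_Y i j + cps_coeff (cps_X * h) i j)" for i j
    by (simp only: model_form_snd cps_coeff_of_nat_mult cps_coeff_add mult.commute[of h]) simp
  have sing: "singular ?W"
    by (simp add: singular_def fst snd cps_coeff_X cps_coeff_Y cps_coeff_X_mult cps_coeff_Y_mult)
  have eig: "eigenvalues (linear_part ?W) (2 * (1 - c)) (- (2 * (1 + c)))"
    by (simp add: eigenvalues_linear_part_iff fst snd cps_coeff_X cps_coeff_Y cps_coeff_X_mult
        cps_coeff_Y_mult c_def algebra_simps)
  show ?thesis
  proof
    assume gc: "generalized_curve ?W"
    then have "\<not> saddle_node ?W" using not_generalized_curve_saddle_node by blast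
    then have no: "\<not> (eigenvalues (linear_part ?W) l1 0 \<and> l1 \<noteq> 0)" for l1
      using sing unfolding saddle_node_def by blast
    show "1 + c \<noteq> 0 \<and> 1 - c \<noteq> 0"
    proof (intro conjI notI)
      assume "1 + c = 0"
      then have "c = - 1" by (simp add: add_eq_0_iff)
      then show False using eig no[of 4] by simp
    next
      assume "1 - c = 0"
      then have "eigenvalues (linear_part ?W) (- 4) 0"
        using eig by (auto simp: eigenvalues_linear_part_iff)
      then show False using no[of "- 4"] by simp
    qed
  next
    assume nz: "1 + c \<noteq> 0 \<and> 1 - c \<noteq> 0"
    have "2 * (1 - c) / (- (2 * (1 + c))) \<notin> pos_rats"
    proof
      assume "2 * (1 - c) / (- (2 * (1 + c))) \<in> pos_rats"
      then obtain r where r: "0 < r" "2 * (1 - c) / (- (2 * (1 + c))) = of_rat r"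
        by (auto simp: pos_rats_def)
      have c_eq: "1 - c = - (of_rat r * (1 + c))"
      proof -
        have "- (2 * (1 + c)) \<noteq> 0"
          using nz by (metis neg_equal_0_iff_equal mult_eq_0_iff zero_neq_numeral)
        from r(2)[unfolded nonzero_divide_eq_eq[OF this]]
        have "2 * (1 - c) = 2 * (- (of_rat r * (1 + c)))" by (simp only: mult_minus_right mult.left_commute)
        then show ?thesis by (simp only: mult_cancel_left) simp
      qed
      have "r \<noteq> 1"
      proof
        assume "r = 1"
        then have "(2 :: complex) = 0" using c_eq by (simp add: algebra_simps)
        then show False by simp
      qed
      then have r1: "1 - of_rat r \<noteq> (0 :: complex)" by (metis of_rat_1 of_rat_eq_iff right_minus_eq)
      have "(1 - of_rat r) * (1 + c) = 2" "(1 - of_rat r) * (1 - c) = - (2 * of_rat r)"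
        using c_eq by algebra+
      then have "1 + c = of_rat (2 / (1 - r))" "1 - c = of_rat (- (2 * r) / (1 - r))"
        using r1 by (simp_all add: of_rat_divide of_rat_diff of_rat_mult of_rat_minus field_simps)
      moreover have "2 / (1 - r) < 0 \<or> - (2 * r) / (1 - r) < 0"
        using \<open>r \<noteq> 1\<close> r(1) by (cases "r < 1") (auto simp: divide_less_0_iff)
      ultimately show False using neg by (auto simp: neg_rats_def)
    qed
    moreover have "2 * (1 - c) * (- (2 * (1 + c))) \<noteq> 0"
      using nz by (metis neg_equal_0_iff_equal mult_eq_0_iff zero_neq_numeral)
    ultimately have "simple_singularity ?W"
      unfolding simple_singularity_def using sing eig by blast
    then show "generalized_curve ?W"
      using generalized_curve_reduces_to[OF reduces_to.refl] by (simp add: regular_or_simple_def)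
  qed
qed

text \<open>
  If the residue is \<open>- x / y\<close>, the ramification by \<open>b = x\<close> turns the ratio \<open>m n' y / x\<close> of eigenvalues into
  the integer \<open>a = m n' y\<close>.
\<close>

lemma separatrix_of_negative_residue:
  fixes \<xi> :: complex and n m p q :: nat
  assumes n: "2 \<le> n" and m: "2 \<le> m"
    and weight: "\<And>i j. cps_coeff h i j \<noteq> 0 \<Longrightarrow> n * m \<le> n * (i + 1) + m * (j + 1)"
    and pq: "int m * int p - int n * int q = int (gcd n m)"
    and \<xi>: "\<xi> ^ gcd n m = 1"
    and neg: "1 + resonance n m p q h \<xi> \<in> neg_rats"
  obtains g where "irreducible g" "g dvd wedge (model_form n m h) (form_d g)"
    "\<not> g dvd cps_Y ^ n - cps_X ^ m"
proof -
  define d where "d = gcd n m"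
  obtain n' m' where n': "n = d * n'" and m': "m = d * m'"
    unfolding d_def by (meson dvd_def gcd_dvd1 gcd_dvd2)
  have pos: "0 < d" "0 < n'" "0 < m'" using n m n' m' by (auto intro!: Nat.gr0I)
  from neg obtain c where c: "c < 0" "1 + resonance n m p q h \<xi> = of_rat c"
    by (auto simp: neg_rats_def)
  obtain x y where xy: "quotient_of (- c) = (x, y)" by force
  then have y: "0 < y" and c_eq: "- c = of_int x / of_int y"
    using quotient_of_denom_pos quotient_of_div by blast+
  have x: "0 < x"
  proof -
    have "0 < of_int x / (of_int y :: rat)" using c(1) c_eq by simp
    then show ?thesis using y by (simp add: zero_less_divide_iff)
  qed
  define b N M a where "b = nat x" and "N = n' * b" and "M = m' * b" and "a = m * n' * nat y"
  have b: "0 < b" using x by (simp add: b_def)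
  have N: "0 < N" and M: "0 < M" and a: "0 < a"
    using pos b y m by (auto simp: N_def M_def a_def)
  have NM: "N * m = M * n" by (simp add: N_def M_def n' m')
  have "n + m \<le> n * m"
  proof -
    obtain k l where "n = Suc (Suc k)" "m = Suc (Suc l)"
      using n m by (metis add_2_eq_Suc le_Suc_ex)
    then show ?thesis by simp
  qed
  then have "d * (n' + m') \<le> d * (n' * m)"
    unfolding n' m' by (simp add: algebra_simps)
  then have "n' + m' \<le> n' * m" using pos(1) by simp
  then have "b * (n' + m') \<le> b * (n' * m)" by (rule mult_left_mono) simp
  then have wt: "N + M \<le> N * m" by (simp add: N_def M_def algebra_simps)
  have low: "N * m - N - M \<le> N * i + M * j" if "cps_coeff h i j \<noteq> 0" for i j
  proof -
    have "d * (n' * m) \<le> d * (n' * (i + 1) + m' * (j + 1))"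
      using weight[OF that] unfolding n' m' by (simp add: algebra_simps)
    then have "n' * m \<le> n' * (i + 1) + m' * (j + 1)" using pos(1) by simp
    then have "b * (n' * m) \<le> b * (n' * (i + 1) + m' * (j + 1))" by (rule mult_left_mono) simp
    then have "N * m \<le> N * i + M * j + N + M" by (simp add: N_def M_def algebra_simps)
    then show ?thesis by linarith
  qed
  \<comment> \<open>On resonant monomials the power of \<open>\<xi>\<close> in the residue is \<open>w0\<^sup>s\<^sup>+\<^sup>1\<close>, the value of
      \<open>x y x\<^sup>r y\<^sup>s\<close> at the point \<open>x = 1\<close>, \<open>y = w0\<close> of the curve \<open>y\<^sup>n = x\<^sup>m\<close>.\<close>
  have "n' \<noteq> 0" using pos(2) by simp
  then obtain w0 where w0: "w0 ^ n' = inverse \<xi>" using exists_complex_root[of n' "inverse \<xi>"] by metis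
  have \<xi>0: "\<xi> \<noteq> 0" using \<xi> pos(1) by (auto simp: d_def zero_power)
  have \<xi>d: "\<xi> ^ d = 1" using \<xi> by (simp only: d_def)
  have "w0 ^ n = (w0 ^ n') ^ d" by (simp only: n' mult.commute[of d] power_mult)
  also have "\<dots> = 1" by (simp only: w0 power_inverse \<xi>d) simp
  finally have w0n: "w0 ^ n = 1" .
  then have w00: "w0 \<noteq> 0" using n by (auto simp: zero_power)
  have exponent: "\<xi> powi (int p * (int r + 1) + int q * (int s + 1) - int q * int n) = w0 * w0 ^ s"
    if rs: "(r, s) \<in> resonant_pairs n m" for r s
  proof -
    let ?E = "int p * (int r + 1) + int q * (int s + 1) - int q * int n"
    have "n * (r + 1) + m * (s + 1) = m * n" using rs by (simp add: resonant_pairs_def)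
    then have "d * (n' * (r + 1) + m' * (s + 1)) = d * (m' * n)"
      unfolding n' m' by (simp add: algebra_simps)
    then have "n' * (r + 1) + m' * (s + 1) = m' * n" using pos(1) by simp
    then have "int (n' * (r + 1) + m' * (s + 1)) = int (m' * n)" by simp
    then have w: "int n' * (int r + 1) = int m' * int n - int m' * (int s + 1)"
      by (simp only: of_nat_add of_nat_mult of_nat_1)
    have "int d * (int m' * int p - int n' * int q) = int m * int p - int n * int q"
      by (simp add: n' m' algebra_simps)
    also have "\<dots> = int d * 1" using pq by (simp only: d_def mult_1_right)
    finally have pq': "int m' * int p - int n' * int q = 1" using pos(1) by simp
    have "int n' * ?E = int p * (int n' * (int r + 1)) + int n' * int q * (int s + 1) - int n' * int q * int n"
      by (simp add: algebra_simps)
    also have "\<dots> = (int m' * int p - int n' * int q) * (int n - (int s + 1))"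
      unfolding w by (simp add: algebra_simps)
    finally have E: "int n' * ?E = int n - (int s + 1)" by (simp add: pq')
    have "w0 powi (int n - int (Suc s)) = w0 powi int n / w0 powi int (Suc s)"
      using w00 by (intro power_int_diff) simp
    then have w0s: "w0 powi (int n - int (Suc s)) = 1 / w0 ^ Suc s"
      by (simp only: power_int_of_nat w0n)
    have "\<xi> = inverse (w0 ^ n')" using w0 by simp
    then have "\<xi> powi ?E = inverse (w0 powi (int n' * ?E))"
      by (simp only: power_int_inverse power_int_mult power_int_of_nat)
    also have "\<dots> = inverse (w0 powi (int n - int (Suc s)))" unfolding E by (simp add: add.commute)
    also have "\<dots> = w0 * w0 ^ s"
      by (simp only: w0s) simp
    finally show ?thesis .
  qed
  have res: "w0 * (\<Sum>i\<le>N * m. \<Sum>j\<le>N * m.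
      if N * i + M * j = N * m - N - M then cps_coeff h i j * w0 ^ j else 0)
    = resonance n m p q h \<xi>"
  proof -
    have cond: "N * i + M * j = N * m - N - M \<longleftrightarrow> (i, j) \<in> resonant_pairs n m" for i j
    proof -
      have "N * i + M * j = N * m - N - M \<longleftrightarrow> N * (i + 1) + M * (j + 1) = N * m"
        using wt by auto
      also have "\<dots> \<longleftrightarrow> b * (n' * (i + 1) + m' * (j + 1)) = b * (n' * m)"
        by (simp add: N_def M_def algebra_simps)
      also have "\<dots> \<longleftrightarrow> d * (n' * (i + 1) + m' * (j + 1)) = d * (n' * m)"
        using b pos(1) by simp
      also have "\<dots> \<longleftrightarrow> n * (i + 1) + m * (j + 1) = m * n"
        by (simp add: n' m' algebra_simps)
      also have "\<dots> \<longleftrightarrow> (i, j) \<in> resonant_pairs n m"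
        using resonant_pairsI[of n m i j] n m by (auto simp: resonant_pairs_def)
      finally show ?thesis .
    qed
    have sub: "resonant_pairs n m \<subseteq> {..N * m} \<times> {..N * m}"
    proof -
      have mN: "m \<le> N * m" using N by simp
      have nN: "n \<le> N * m" unfolding NM using M by simp
      show ?thesis
      proof (rule subrelI)
        fix i j assume "(i, j) \<in> resonant_pairs n m"
        then have "i \<le> m" "j \<le> n" by (auto simp: resonant_pairs_def)
        then show "(i, j) \<in> {..N * m} \<times> {..N * m}"
          using order_trans[OF _ mN] order_trans[OF _ nN] by (intro SigmaI) (simp_all only: atMost_iff)
      qed
    qed
    have "w0 * (\<Sum>i\<le>N * m. \<Sum>j\<le>N * m.
        if N * i + M * j = N * m - N - M then cps_coeff h i j * w0 ^ j else 0)
      = (\<Sum>z\<in>{..N * m} \<times> {..N * m}. if z \<in> resonant_pairs n m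
          then cps_coeff h (fst z) (snd z) * (w0 * w0 ^ snd z) else 0)"
      unfolding cond sum.cartesian_product sum_distrib_left by (intro sum.cong refl) auto
    also have "\<dots> = (\<Sum>z\<in>resonant_pairs n m. cps_coeff h (fst z) (snd z) * (w0 * w0 ^ snd z))"
      by (rule sum.mono_neutral_cong_right) (use sub in auto)
    also have "\<dots> = resonance n m p q h \<xi>"
      unfolding resonance_def by (intro sum.cong refl) (auto simp: exponent)
    finally show ?thesis .
  qed
  show thesis
  proof (rule dicritical_of_negative_residue[OF _ _ N M NM wt low w0n a])
    have "(of_rat c :: complex) = of_rat (- (of_int x / of_int y))" using c_eq by simp
    also have "\<dots> = - (of_nat b / of_nat (nat y))"
      using x y by (simp add: of_rat_minus of_rat_divide b_def)
    finally have "of_nat a * (of_rat c :: complex) = - of_nat (m * N)"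
      using y by (simp add: a_def N_def)
    then show "of_nat (m * N) + of_nat a * (1 + w0 * (\<Sum>i\<le>N * m. \<Sum>j\<le>N * m.
        if N * i + M * j = N * m - N - M then cps_coeff h i j * w0 ^ j else 0)) = 0"
      unfolding res c(2) by simp
  qed (use n m that in auto)
qed

section \<open>Foliations with prescribed separatrices\<close>

text \<open>
  Both properties do not change if the form is multiplied by a unit, and two series defining the
  same curve divide each other.
\<close>

lemma Fol_singular_and_separatrices:
  assumes "foliation W \<in> Fol f"
  shows "singular W"
    and "\<And>g. irreducible g \<Longrightarrow> g dvd wedge W (form_d g) \<Longrightarrow> g dvd f"
proof -
  from assms obtain W' where W': "foliation W = foliation W'" "W' \<in> Fol_forms f"
    "union_of_separatrices W' f"
    by (auto simp: Fol_def)
  have "W = 1 *\<^sub>F W" by (simp add: form_scale_def)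
  then have "W \<in> foliation W"
    unfolding foliation_def mem_Collect_eq by (intro exI[of _ 1] conjI) simp_all
  then have "W \<in> foliation W'" by (simp only: W'(1))
  then obtain u where u: "W = u *\<^sub>F W'" "u dvd 1"
    unfolding foliation_def mem_Collect_eq by (elim exE conjE)
  show "singular W"
    using W'(2) by (simp add: u(1) Fol_forms_def is_foliation_form_def singular_def form_scale_def
        cps_coeff_mult)
  fix g assume g: "irreducible g" "g dvd wedge W (form_d g)"
  obtain v where v: "1 = u * v" using u(2) by (auto simp: dvd_def)
  have "wedge W' (form_d g) = u * v * wedge W' (form_d g)" using v by simp
  also have "\<dots> = v * wedge W (form_d g)"
    by (simp add: u(1) wedge_def form_scale_def algebra_simps)
  finally have sep: "curve g \<in> separatrices W'" using g unfolding separatrices_def by auto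
  obtain G where G: "finite G" "curve ` G = separatrices W'" "curve (\<Prod>G) = curve f"
    using W'(3) by (auto simp: union_of_separatrices_def)
  from sep obtain k where k: "k \<in> G" "curve g = curve k" unfolding G(2)[symmetric] by auto
  have refl: "x \<in> curve x" for x by (simp add: curve_def)
  have "g dvd k" using refl[of k] unfolding k(2)[symmetric] by (simp add: curve_def)
  also have "k dvd \<Prod>G" using G(1) k(1) by (rule dvd_prodI)
  also have "\<Prod>G dvd f" using refl[of f] unfolding G(3)[symmetric] by (simp add: curve_def)
  finally show "g dvd f" .
qed

lemma finite_box: "finite {(i, j). i + 2 \<le> m \<and> j + 2 \<le> (n :: nat)}" for m :: nat
  by (rule finite_subset[of _ "{..m} \<times> {..n}"]) auto

lemma cps_coeff_truncated_polynomial: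
  "cps_coeff (\<Sum>(i, j)\<in>{(i, j). i + 2 \<le> m \<and> j + 2 \<le> n}. cps_const (a i j) * cps_X ^ i * cps_Y ^ j) k l
    = (if k + 2 \<le> m \<and> l + 2 \<le> n then a k l else 0)"
proof -
  have coeff: "cps_coeff (cps_const (a i j) * cps_X ^ i * cps_Y ^ j) k l
      = (if (i, j) = (k, l) then a k l else 0)" for i j
    by (auto simp: mult.assoc cps_coeff_X_power_mult cps_coeff_Y_power)
  have "cps_coeff (\<Sum>(i, j)\<in>{(i, j). i + 2 \<le> m \<and> j + 2 \<le> n}.
      cps_const (a i j) * cps_X ^ i * cps_Y ^ j) k l
    = (\<Sum>z\<in>{(i, j). i + 2 \<le> m \<and> j + 2 \<le> n}. if z = (k, l) then a k l else 0)"
    unfolding cps_coeff_sum by (intro sum.cong refl) (auto simp: coeff split: prod.split)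
  also have "\<dots> = (if k + 2 \<le> m \<and> l + 2 \<le> n then a k l else 0)"
    using finite_box[of m n] by simp
  finally show ?thesis .
qed

text \<open>
  The product \<open>f g\<close> has only terms of weight at least \<open>m n\<close>, so that it does not interfere with the
  conditions on \<open>\<Delta>\<close>.
\<close>

lemma cps_coeff_curve_mult:
  assumes "n * i + m * j < n * m"
  shows "cps_coeff ((cps_Y ^ n - cps_X ^ m) * g) i j = 0"
proof -
  have "n * i < n * m" "n * m > m * j" using assms by linarith+
  then have "i < m" "j < n" by (simp_all add: mult.commute[of n])
  then show ?thesis by (simp add: left_diff_distrib cps_coeff_X_power_mult cps_coeff_Y_power_mult)
qed

theorem theorem3p4:
  fixes n m d p q :: nat
    and a :: "nat \<Rightarrow> nat \<Rightarrow> complex"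
    and f g \<Delta> :: cps
    and W :: form
  assumes "0 < n" and "n \<le> m"
    and "d = gcd n m"
    and "0 < p" and "0 < q"
    and "int m * int p - int n * int q = int d"
    and "f = cps_Y ^ n - cps_X ^ m"
    and "\<Delta> = (\<Sum>(i, j) \<in> {(i, j). i + 2 \<le> m \<and> j + 2 \<le> n}.
                 cps_const (a i j) * cps_X ^ i * cps_Y ^ j)"
    and "W = form_d f + (\<Delta> + f * g) *\<^sub>F (- (of_nat m * cps_Y), of_nat n * cps_X)"
    and "foliation W \<in> Fol f"
  shows "generalized_curve W \<longleftrightarrow>
    weighted_order n m \<Delta> \<ge> ereal (real m * real n - real n - real m) \<and>
    (\<forall>\<xi>::complex. \<xi> ^ d = 1 \<longrightarrow>
      1 + (\<Sum>(r, s) \<in> {(r, s). r + 2 \<le> m \<and> s + 2 \<le> n \<and> n * (r + 1) + m * (s + 1) = m * n}.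
             a r s * \<xi> powi (int p * (int r + 1) + int q * (int s + 1) - int q * int n))
      \<notin> neg_rats \<union> {0})"
proof -
  define h where "h = \<Delta> + f * g"
  have W: "W = model_form n m h" using assms(7,9) by (simp add: model_form_def h_def)
  have m0: "0 < m" using assms(1,2) by simp
  note sep = Fol_singular_and_separatrices[OF assms(10)]
  have \<Delta>: "cps_coeff \<Delta> i j = (if i + 2 \<le> m \<and> j + 2 \<le> n then a i j else 0)" for i j
    unfolding assms(8) by (rule cps_coeff_truncated_polynomial)
  have h_low: "cps_coeff h i j = cps_coeff \<Delta> i j" if "n * i + m * j < n * m" for i j
    using cps_coeff_curve_mult[OF that] by (simp add: h_def assms(7))
  have n2: "2 \<le> n"
  proof (rule ccontr)
    assume "\<not> 2 \<le> n"
    then have "n = 1" using assms(1) by simp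
    \<comment> \<open>For \<open>n = 1\<close> the curve is smooth and \<open>W\<close> does not vanish at the origin.\<close>
    then have "cps_coeff (snd W) 0 0 = 1"
      unfolding W model_form_snd cps_coeff_of_nat_mult cps_coeff_add mult.commute[of h]
      by (simp add: cps_coeff_X_mult cps_coeff_1)
    then show False using sep(1) by (simp add: singular_def)
  qed
  have no_extra: False
    if "irreducible k" "k dvd wedge (model_form n m h) (form_d k)" "\<not> k dvd cps_Y ^ n - cps_X ^ m" for k
    using sep(2)[of k] that unfolding W assms(7) by blast
  obtain n' m' where n': "n = d * n'" and m': "m = d * m'"
    unfolding assms(3) by (meson dvd_def gcd_dvd1 gcd_dvd2)
  have pos: "0 < d" "0 < n'" "0 < m'" using assms(1) m0 n' m' by (auto intro!: Nat.gr0I)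
  have weight: "n * m \<le> n * (i + 1) + m * (j + 1)" if ij: "cps_coeff h i j \<noteq> 0" for i j
  proof (rule ccontr)
    assume "\<not> ?thesis"
    then have "d * (n' * i + m' * j + n' + m') < d * (n' * m)"
      unfolding n' m' by (simp add: algebra_simps)
    then have lt: "n' * i + m' * j + n' + m' < n' * m" using pos(1) by simp
    have "n' * m = m' * n" by (simp add: n' m')
    then show False
      using dicritical_of_small_weight[OF assms(1) m0 pos(2,3) _ ij lt] no_extra by blast
  qed
  have order: "weighted_order n m \<Delta> \<ge> ereal (real m * real n - real n - real m)"
    unfolding weighted_order_def
  proof (rule INF_greatest, clarify)
    fix i j assume ij: "cps_coeff \<Delta> i j \<noteq> 0"
    have "n * m \<le> n * (i + 1) + m * (j + 1)"
    proof (cases "n * i + m * j < n * m")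
      case True
      then show ?thesis using weight[of i j] h_low[OF True] ij by simp
    qed simp
    then have "real (n * m) \<le> real (n * (i + 1) + m * (j + 1))" by (simp only: of_nat_le_iff)
    then show "ereal (real m * real n - real n - real m) \<le> ereal (real (i * n + j * m))"
      by (simp add: algebra_simps)
  qed
  have h_a: "cps_coeff h r s = a r s" if "(r, s) \<in> resonant_pairs n m" for r s
  proof -
    have rs: "r + 2 \<le> m" "s + 2 \<le> n" "n * (r + 1) + m * (s + 1) = m * n"
      using that by (auto simp: resonant_pairs_def)
    then have "n * r + m * s < n * m" using assms(1) by (simp add: algebra_simps)
    then show ?thesis using rs by (simp add: h_low \<Delta>)
  qed
  have sum: "(\<Sum>(r, s) \<in> {(r, s). r + 2 \<le> m \<and> s + 2 \<le> n \<and> n * (r + 1) + m * (s + 1) = m * n}.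
      a r s * \<xi> powi (int p * (int r + 1) + int q * (int s + 1) - int q * int n)) = resonance n m p q h \<xi>" for \<xi>
    unfolding resonant_pairs_def[symmetric] resonance_def by (intro sum.cong refl) (auto simp: h_a)
  have pq: "int m * int p - int n * int q = int (gcd n m)" using assms(3,6) by simp
  have not_neg: "1 + resonance n m p q h \<xi> \<notin> neg_rats" if \<xi>: "\<xi> ^ gcd n m = 1" for \<xi>
  proof
    assume "1 + resonance n m p q h \<xi> \<in> neg_rats"
    then show False
      using separatrix_of_negative_residue[OF n2 order_trans[OF n2 assms(2)] weight pq \<xi>] no_extra
      by blast
  qed
  interpret quasi_homogeneous_form n m h
    by standard (use n2 assms(2) weight in auto)
  have "generalized_curve W \<longleftrightarrow> (\<forall>\<xi>. \<xi> ^ d = 1 \<longrightarrow> 1 + resonance n m p q h \<xi> \<notin> neg_rats \<union> {0})"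
  proof (cases "n = 2 \<and> m = 2")
    case False
    show ?thesis
      using generalized_curve_iff_residues[OF False pq not_neg]
      unfolding W assms(3) .
  next
    case True
    then have d: "d = 2" using assms(3) by simp
    have "int p - int q = 1" using pq True by simp
    moreover have "resonant_pairs 2 2 = {(0, 0)}" by (auto simp: resonant_pairs_def)
    ultimately have node: "resonance n m p q h \<xi> = cps_coeff h 0 0 * \<xi>" for \<xi>
      using True by (simp add: resonance_def algebra_simps)
    have roots: "\<xi> ^ d = 1 \<longleftrightarrow> \<xi> = 1 \<or> \<xi> = - 1" for \<xi> :: complex
      unfolding d by (rule power2_eq_1_iff)
    have neg: "1 + cps_coeff h 0 0 \<notin> neg_rats" "1 - cps_coeff h 0 0 \<notin> neg_rats"
      using not_neg[of 1] not_neg[of "- 1"] roots[of 1] roots[of "- 1"] by (simp_all add: node assms(3))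
    have "resonance 2 2 p q h \<xi> = cps_coeff h 0 0 * \<xi>" for \<xi> using node[of \<xi>] True by simp
    then show ?thesis
      using generalized_curve_node[OF neg] neg True unfolding W roots by auto
  qed
  then show ?thesis using order unfolding sum by blast
qed

end
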